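(* Let $\Omega\subset\mathbb{R}^N$ ($N\ge1$) be a bounded domain with smooth boundary, let $u_0\in L^\infty(\Omega)\cap W_0^{1,2}(\Omega)$ with $u_0\ge0$, $\frac1{u_0}\in L^\infty_{loc}(\Omega)$ and $\|u_0\|_{\Phi,\infty}\le L$ for some $L>0$. Let $T_{\max}\in(0,\infty]$ and $u$ be the locally positive weak solution of $u_t=u\Delta u+u\int_\Omega|\nabla u|^2$ in $\Omega\times(0,T_{\max})$, $u=0$ on $\partial\Omega$, $u(\cdot,0)=u_0$, together with its maximal existence time, as provided by the existence theorem described in the context. Then: (i) If $\int_\Omega u_0<1$, then $T_{\max}=\infty$ and $\int_\Omega u(x,t)\,dx\to0$ as $t\to\infty$. (ii) If $\int_\Omega u_0=1$, then $T_{\max}=\infty$ and $\int_\Omega u(x,t)\,dx=1$ for all $t>0$. (iii) If $\int_\Omega u_0>1$, then $T_{\max}<\infty$ and $\limsup_{t\nearrow T_{\max}}\int_\Omega u(x,t)\,dx=\infty$.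
   Context: $\Phi$ solves $-\Delta\Phi=1$ in $\Omega$, $\Phi=0$ on $\partial\Omega$; $\|v\|_{\Phi,\infty}:=\operatorname{ess\,sup}_\Omega|v/\Phi|$. A weak solution in $\Omega\times(0,T)$ is a nonnegative $u\in L^\infty_{loc}(\bar\Omega\times[0,T))\cap L^2_{loc}([0,T);W_0^{1,2}(\Omega))$ with $u_t\in L^2_{loc}(\bar\Omega\times[0,T))$ and $-\int_0^T\!\int_\Omega u\varphi_t+\int_0^T\!\int_\Omega\nabla u\cdot\nabla(u\varphi)=\int_\Omega u_0\varphi(\cdot,0)+\int_0^T(\int_\Omega u\varphi)(\int_\Omega|\nabla u|^2)dt$ for all $\varphi\in C_0^\infty(\Omega\times[0,T))$; it is locally positive if $1/u\in L^\infty_{loc}(\Omega\times[0,T])$. The existence theorem provides $T_{\max}\in(0,\infty]$ and a locally positive weak solution $u$ in $\Omega\times(0,T_{\max})$ such that: either $T_{\max}=\infty$ or $\limsup_{t\nearrow T_{\max}}\|u(\cdot,t)\|_{L^\infty(\Omega)}=\infty$; for every smoothly bounded $\Omega'\subset\subset\Omega$, with $\phi$ solving $-\Delta\phi=1$ in $\Omega'$, $\phi=0$ on $\partial\Omega'$, there is $C_{\Omega'}>0$ with $\int_\Omega|\nabla u(\cdot,t)|^2\le\int_\Omega|\nabla u_0|^2\exp\big[\frac1{2C_{\Omega'}}(\sup_{\tau\in(0,t)}\int_\Omega u(\cdot,\tau))(\int_{\Omega'}\phi\ln u(\cdot,t)-\int_{\Omega'}\phi\ln u_0+\int_0^t\int_{\Omega'}u)\big]$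 for a.e. $t$; and $\|u(\cdot,t)\|_{\Phi,\infty}\le\max\{\|u_0\|_{\Phi,\infty},\sup_{\tau\in(0,t)}\int_\Omega|\nabla u(\cdot,\tau)|^2\}$ for a.e. $t\in(0,T_{\max})$. *)

theory Defs
  imports "HOL-Analysis.Analysis" "HOL-Probability.Essential_Supremum"
begin

definition pderiv :: "'a::euclidean_space \<Rightarrow> ('a \<Rightarrow> real) \<Rightarrow> 'a \<Rightarrow> real" where
  "pderiv i f x = frechet_derivative f (at x) i"

fun Ck :: "nat \<Rightarrow> 'a::euclidean_space set \<Rightarrow> ('a \<Rightarrow> real) \<Rightarrow> bool" where
  "Ck 0 S f = continuous_on S f"
| "Ck (Suc k) S f = (f differentiable_on S \<and> (\<forall>i\<in>Basis. Ck k S (pderiv i f)))"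

definition Cinf :: "'a::euclidean_space set \<Rightarrow> ('a \<Rightarrow> real) \<Rightarrow> bool" where
  "Cinf S f = (\<forall>k. Ck k S f)"

definition grad :: "('a::euclidean_space \<Rightarrow> real) \<Rightarrow> 'a \<Rightarrow> 'a" where
  "grad f x = (\<Sum>i\<in>Basis. pderiv i f x *\<^sub>R i)"

definition laplacian :: "('a::euclidean_space \<Rightarrow> real) \<Rightarrow> 'a \<Rightarrow> real" where
  "laplacian f x = (\<Sum>i\<in>Basis. pderiv i (pderiv i f) x)"

definition smooth_boundary :: "'a::euclidean_space set \<Rightarrow> bool" where
  "smooth_boundary \<Omega> = (\<forall>x0\<in>frontier \<Omega>. \<exists>r>0. \<exists>\<rho>. Cinf (ball x0 r) \<rho> \<and>
      (\<forall>x\<in>ball x0 r. x \<in> \<Omega> \<longleftrightarrow> \<rho> x < 0) \<and> grad \<rho> x0 \<noteq> 0)"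

definition smoothly_bounded :: "'a::euclidean_space set \<Rightarrow> bool" where
  "smoothly_bounded \<Omega> = (open \<Omega> \<and> bounded \<Omega> \<and> \<Omega> \<noteq> {} \<and> smooth_boundary \<Omega>)"

definition smooth_bounded_domain :: "'a::euclidean_space set \<Rightarrow> bool" where
  "smooth_bounded_domain \<Omega> = (smoothly_bounded \<Omega> \<and> connected \<Omega>)"

definition torsion_function :: "'a::euclidean_space set \<Rightarrow> ('a \<Rightarrow> real) \<Rightarrow> bool" where
  "torsion_function \<Omega> \<Phi> = (Ck 2 \<Omega> \<Phi> \<and> continuous_on (closure \<Omega>) \<Phi> \<and>
      (\<forall>x\<in>\<Omega>. - laplacian \<Phi> x = 1) \<and> (\<forall>x\<in>frontier \<Omega>. \<Phi> x = 0))"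

definition test_fun :: "'a::euclidean_space set \<Rightarrow> ('a \<Rightarrow> real) \<Rightarrow> bool" where
  "test_fun \<Omega> \<phi> = (Cinf UNIV \<phi> \<and> (\<exists>K. compact K \<and> K \<subseteq> \<Omega> \<and> (\<forall>x. x \<notin> K \<longrightarrow> \<phi> x = 0)))"

definition L2 :: "'a::euclidean_space set \<Rightarrow> ('a \<Rightarrow> real) \<Rightarrow> bool" where
  "L2 \<Omega> f = (f \<in> borel_measurable (lebesgue_on \<Omega>) \<and> integrable (lebesgue_on \<Omega>) (\<lambda>x. (f x)\<^sup>2))"

definition ess_bdd :: "'a::euclidean_space set \<Rightarrow> ('a \<Rightarrow> real) \<Rightarrow> bool" where
  "ess_bdd \<Omega> f = (f \<in> borel_measurable (lebesgue_on \<Omega>) \<and>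
      (\<exists>C. AE x in lebesgue_on \<Omega>. \<bar>f x\<bar> \<le> C))"

text \<open>1/f in L-infinity-loc(Omega), for f \<ge> 0: f is bounded below by a positive
  constant a.e. on every compact subset of Omega.\<close>
definition inv_Linf_loc :: "'a::euclidean_space set \<Rightarrow> ('a \<Rightarrow> real) \<Rightarrow> bool" where
  "inv_Linf_loc \<Omega> f = (f \<in> borel_measurable (lebesgue_on \<Omega>) \<and>
      (\<forall>K. compact K \<and> K \<subseteq> \<Omega> \<longrightarrow> (\<exists>c>0. AE x in lebesgue_on K. c \<le> f x)))"

definition Linf_norm :: "'a::euclidean_space set \<Rightarrow> ('a \<Rightarrow> real) \<Rightarrow> ereal" where
  "Linf_norm \<Omega> f = esssup (lebesgue_on \<Omega>) (\<lambda>x. ereal \<bar>f x\<bar>)"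

definition Phi_norm :: "'a::euclidean_space set \<Rightarrow> ('a \<Rightarrow> real) \<Rightarrow> ('a \<Rightarrow> real) \<Rightarrow> ereal" where
  "Phi_norm \<Omega> \<Phi> v = esssup (lebesgue_on \<Omega>) (\<lambda>x. ereal \<bar>v x / \<Phi> x\<bar>)"

definition weak_gradient :: "'a::euclidean_space set \<Rightarrow> ('a \<Rightarrow> real) \<Rightarrow> ('a \<Rightarrow> 'a) \<Rightarrow> bool" where
  "weak_gradient \<Omega> u g = ((\<forall>K. compact K \<and> K \<subseteq> \<Omega> \<longrightarrow>
        integrable (lebesgue_on K) u \<and> (\<forall>i\<in>Basis. integrable (lebesgue_on K) (\<lambda>x. g x \<bullet> i))) \<and>
      (\<forall>\<phi>. test_fun \<Omega> \<phi> \<longrightarrow> (\<forall>i\<in>Basis.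
         integral\<^sup>L (lebesgue_on \<Omega>) (\<lambda>x. u x * pderiv i \<phi> x) =
         - integral\<^sup>L (lebesgue_on \<Omega>) (\<lambda>x. (g x \<bullet> i) * \<phi> x))))"

definition W012 :: "'a::euclidean_space set \<Rightarrow> ('a \<Rightarrow> real) \<Rightarrow> ('a \<Rightarrow> 'a) \<Rightarrow> bool" where
  "W012 \<Omega> u g = (L2 \<Omega> u \<and> g \<in> borel_measurable (lebesgue_on \<Omega>) \<and> L2 \<Omega> (\<lambda>x. norm (g x)) \<and>
      weak_gradient \<Omega> u g \<and>
      (\<exists>\<phi>s. (\<forall>k. test_fun \<Omega> (\<phi>s k)) \<and>
         (\<lambda>k. integral\<^sup>L (lebesgue_on \<Omega>) (\<lambda>x. (\<phi>s k x - u x)\<^sup>2)) \<longlonglongrightarrow> 0 \<and>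
         (\<lambda>k. integral\<^sup>L (lebesgue_on \<Omega>) (\<lambda>x. (norm (grad (\<phi>s k) x - g x))\<^sup>2)) \<longlonglongrightarrow> 0))"

definition tint :: "ereal \<Rightarrow> real set" where
  "tint T = {t. 0 < t \<and> ereal t < T}"

definition dt :: "('a::euclidean_space \<times> real \<Rightarrow> real) \<Rightarrow> 'a \<times> real \<Rightarrow> real" where
  "dt \<phi> p = frechet_derivative \<phi> (at p) (0, 1)"

definition gradx :: "('a::euclidean_space \<times> real \<Rightarrow> real) \<Rightarrow> 'a \<times> real \<Rightarrow> 'a" where
  "gradx \<phi> p = (\<Sum>i\<in>Basis. frechet_derivative \<phi> (at p) (i, 0) *\<^sub>R i)"

definition test_fun0 :: "'a::euclidean_space set \<Rightarrow> ereal \<Rightarrow> ('a \<times> real \<Rightarrow> real) \<Rightarrow> bool" where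
  "test_fun0 \<Omega> T \<phi> = (Cinf UNIV \<phi> \<and> (\<exists>K. compact K \<and> K \<subseteq> \<Omega> \<times> {t. ereal t < T} \<and>
      (\<forall>p. 0 \<le> snd p \<longrightarrow> p \<notin> K \<longrightarrow> \<phi> p = 0)))"

definition weak_solution ::
  "'a::euclidean_space set \<Rightarrow> ('a \<Rightarrow> real) \<Rightarrow> ereal \<Rightarrow> ('a \<Rightarrow> real \<Rightarrow> real) \<Rightarrow> ('a \<Rightarrow> real \<Rightarrow> 'a) \<Rightarrow> bool" where
  "weak_solution \<Omega> u0 T u Du = (
     \<comment> \<open>nonnegative, in L^infinity_loc(closure Omega x [0,T))\<close>
     (\<lambda>p. u (fst p) (snd p)) \<in> borel_measurable (lebesgue_on (\<Omega> \<times> tint T)) \<and>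
     (AE p in lebesgue_on (\<Omega> \<times> tint T). 0 \<le> u (fst p) (snd p)) \<and>
     (\<forall>T'. 0 < T' \<and> ereal T' < T \<longrightarrow>
        (\<exists>C. AE p in lebesgue_on (\<Omega> \<times> {0<..<T'}). \<bar>u (fst p) (snd p)\<bar> \<le> C)) \<and>
     \<comment> \<open>in L^2_loc([0,T); W_0^{1,2}(Omega)) with spatial gradient Du\<close>
     (\<lambda>p. Du (fst p) (snd p)) \<in> borel_measurable (lebesgue_on (\<Omega> \<times> tint T)) \<and>
     (AE t in lebesgue_on (tint T). W012 \<Omega> (\<lambda>x. u x t) (\<lambda>x. Du x t)) \<and>
     (\<forall>T'. 0 < T' \<and> ereal T' < T \<longrightarrow>
        integrable (lebesgue_on (\<Omega> \<times> {0<..<T'})) (\<lambda>p. (norm (Du (fst p) (snd p)))\<^sup>2)) \<and>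
     \<comment> \<open>u_t in L^2_loc(closure Omega x [0,T)) (weak time derivative)\<close>
     (\<exists>ut. (\<lambda>p. ut (fst p) (snd p)) \<in> borel_measurable (lebesgue_on (\<Omega> \<times> tint T)) \<and>
        (\<forall>T'. 0 < T' \<and> ereal T' < T \<longrightarrow>
          integrable (lebesgue_on (\<Omega> \<times> {0<..<T'})) (\<lambda>p. (ut (fst p) (snd p))\<^sup>2)) \<and>
        (\<forall>\<psi>. test_fun (\<Omega> \<times> tint T) \<psi> \<longrightarrow>
          integral\<^sup>L (lebesgue_on (\<Omega> \<times> tint T)) (\<lambda>p. u (fst p) (snd p) * dt \<psi> p) =
          - integral\<^sup>L (lebesgue_on (\<Omega> \<times> tint T)) (\<lambda>p. ut (fst p) (snd p) * \<psi> p))) \<and>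
     \<comment> \<open>the weak formulation; \<nabla>u\<cdot>\<nabla>(u\<phi>) = \<phi>|\<nabla>u|^2 + u \<nabla>u\<cdot>\<nabla>\<phi>\<close>
     (\<forall>\<phi>. test_fun0 \<Omega> T \<phi> \<longrightarrow>
        - integral\<^sup>L (lebesgue_on (\<Omega> \<times> tint T)) (\<lambda>p. u (fst p) (snd p) * dt \<phi> p)
        + integral\<^sup>L (lebesgue_on (\<Omega> \<times> tint T))
            (\<lambda>p. \<phi> p * (norm (Du (fst p) (snd p)))\<^sup>2 + u (fst p) (snd p) * (Du (fst p) (snd p) \<bullet> gradx \<phi> p))
        = integral\<^sup>L (lebesgue_on \<Omega>) (\<lambda>x. u0 x * \<phi> (x, 0))
        + integral\<^sup>L (lebesgue_on (tint T))
            (\<lambda>t. integral\<^sup>L (lebesgue_on \<Omega>) (\<lambda>x. u x t * \<phi> (x, t)) *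
                 integral\<^sup>L (lebesgue_on \<Omega>) (\<lambda>x. (norm (Du x t))\<^sup>2))))"

text \<open>locally positive: 1/u in L^infinity_loc(Omega x [0,T])\<close>
definition locally_positive :: "'a::euclidean_space set \<Rightarrow> ereal \<Rightarrow> ('a \<Rightarrow> real \<Rightarrow> real) \<Rightarrow> bool" where
  "locally_positive \<Omega> T u = (\<forall>K. compact K \<and> K \<subseteq> \<Omega> \<times> {t. 0 \<le> t \<and> ereal t \<le> T} \<longrightarrow>
      (\<exists>c>0. AE p in lebesgue_on (K \<inter> (\<Omega> \<times> tint T)). c \<le> u (fst p) (snd p)))"

text \<open>Representative convention: t \<mapsto> u(.,t) is the representative continuous into L^1(Omega),
  so that quantities like \<integral> u(x,t) dx make sense for every t.\<close>
definition L1_continuous_rep :: "'a::euclidean_space set \<Rightarrow> ereal \<Rightarrow> ('a \<Rightarrow> real \<Rightarrow> real) \<Rightarrow> bool" where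
  "L1_continuous_rep \<Omega> T u = ((\<forall>t\<in>tint T. integrable (lebesgue_on \<Omega>) (\<lambda>x. u x t)) \<and>
      (\<forall>s\<in>tint T. ((\<lambda>t. integral\<^sup>L (lebesgue_on \<Omega>) (\<lambda>x. \<bar>u x t - u x s\<bar>)) \<longlongrightarrow> 0) (at s)))"

section \<open>Properties supplied by the existence theorem\<close>

definition extensibility :: "'a::euclidean_space set \<Rightarrow> ereal \<Rightarrow> ('a \<Rightarrow> real \<Rightarrow> real) \<Rightarrow> bool" where
  "extensibility \<Omega> T u = (T = \<infinity> \<or>
      Limsup (at_left (real_of_ereal T)) (\<lambda>t. Linf_norm \<Omega> (\<lambda>x. u x t)) = \<infinity>)"

definition gradient_estimate ::
  "'a::euclidean_space set \<Rightarrow> ('a \<Rightarrow> real) \<Rightarrow> ('a \<Rightarrow> 'a) \<Rightarrow> ereal \<Rightarrow> ('a \<Rightarrow> real \<Rightarrow> real) \<Rightarrow> ('a \<Rightarrow> real \<Rightarrow> 'a) \<Rightarrow> bool" where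
  "gradient_estimate \<Omega> u0 Du0 T u Du = (\<forall>\<Omega>' \<phi>.
      smoothly_bounded \<Omega>' \<and> closure \<Omega>' \<subseteq> \<Omega> \<and> torsion_function \<Omega>' \<phi> \<longrightarrow>
      (\<exists>C>0. AE t in lebesgue_on (tint T).
         integral\<^sup>L (lebesgue_on \<Omega>) (\<lambda>x. (norm (Du x t))\<^sup>2) \<le>
         integral\<^sup>L (lebesgue_on \<Omega>) (\<lambda>x. (norm (Du0 x))\<^sup>2) *
         exp (1 / (2 * C) * Sup ((\<lambda>\<tau>. integral\<^sup>L (lebesgue_on \<Omega>) (\<lambda>x. u x \<tau>)) ` {0<..<t}) *
              (integral\<^sup>L (lebesgue_on \<Omega>') (\<lambda>x. \<phi> x * ln (u x t))
               - integral\<^sup>L (lebesgue_on \<Omega>') (\<lambda>x. \<phi> x * ln (u0 x))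
               + integral\<^sup>L (lebesgue_on (\<Omega>' \<times> {0<..<t})) (\<lambda>p. u (fst p) (snd p))))))"

definition Phi_estimate ::
  "'a::euclidean_space set \<Rightarrow> ('a \<Rightarrow> real) \<Rightarrow> ('a \<Rightarrow> real) \<Rightarrow> ereal \<Rightarrow> ('a \<Rightarrow> real \<Rightarrow> real) \<Rightarrow> ('a \<Rightarrow> real \<Rightarrow> 'a) \<Rightarrow> bool" where
  "Phi_estimate \<Omega> \<Phi> u0 T u Du = (AE t in lebesgue_on (tint T).
      Phi_norm \<Omega> \<Phi> (\<lambda>x. u x t) \<le>
      max (Phi_norm \<Omega> \<Phi> u0) (SUP \<tau>\<in>{0<..<t}. ereal (integral\<^sup>L (lebesgue_on \<Omega>) (\<lambda>x. (norm (Du x \<tau>))\<^sup>2))))"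

end

theory Submission
  imports Defs "HOL-Real_Asymp.Real_Asymp"
begin

text \<open>Let y(t) be the mass of u(t) and J(t) its Dirichlet energy. Testing the equation with 1 gives
  y' = (y - 1) J, so y - 1 keeps its sign, and J dominates y^2 by Poincare's inequality. If y(0) < 1 then y
  decreases, J is integrable in time, and y tends to 0; if y(0) = 1 then y = 1; if y(0) > 1 then y - 1
  satisfies a superlinear differential inequality and blows up in finite time. As long as J stays integrable,
  u stays bounded: testing with powers of a saturation of u and letting the exponent tend to infinity gives a
  maximum principle. For y(0) = 1 the integrability of J comes from the gradient estimate on a ball, where the
  torsion function is explicit.

  The constant 1 is not an admissible test function. It is approximated by F(u) with
  F(s) = s^2 / (s^2 + R) and R \<rightarrow> 0; the error term u F'(u) |grad u|^2 is dominated by |grad u|^2 and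
  tends to 0 pointwise, so no boundary regularity is needed. The function F(u) itself is the limit of F(w) for
  test functions w converging to u(t). Since w depends on t, the equation must hold at almost every time for
  all test functions simultaneously, which follows from separability.\<close>

subsection \<open>Smooth functions\<close>

lemma Ck_SucI:
  assumes "\<And>x. (f has_derivative D x) (at x)"
    and "\<And>i. i \<in> Basis \<Longrightarrow> Ck k UNIV (\<lambda>x. D x i)"
  shows "Ck (Suc k) UNIV f"
proof -
  have "pderiv i f = (\<lambda>x. D x i)" for i
    using frechet_derivative_at[OF assms(1)] by (auto simp: pderiv_def fun_eq_iff)
  moreover have "f differentiable_on UNIV"
    using assms(1) by (auto simp: differentiable_on_def differentiable_def)
  ultimately show ?thesis using assms(2) by simp
qed

lemma Ck_Suc_has_derivative:
  assumes "Ck (Suc k) UNIV f"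
  shows "(f has_derivative frechet_derivative f (at x)) (at x)"
  using assms by (auto simp: differentiable_on_def frechet_derivative_works[symmetric])

lemma Ck_Suc_pderiv: "Ck (Suc k) UNIV f \<Longrightarrow> i \<in> Basis \<Longrightarrow> Ck k UNIV (\<lambda>x. frechet_derivative f (at x) i)"
  unfolding Ck.simps pderiv_def[abs_def] by blast

lemma Ck_SucD: "Ck (Suc k) UNIV f \<Longrightarrow> Ck k UNIV f"
proof (induction k arbitrary: f)
  case 0
  then show ?case by (auto intro: differentiable_imp_continuous_on)
next
  case (Suc k)
  from Suc.prems have "f differentiable_on UNIV" "\<forall>i\<in>Basis. Ck (Suc k) UNIV (pderiv i f)" by auto
  then show ?case using Suc.IH by auto
qed

lemma Ck_subset: "Ck k UNIV f \<Longrightarrow> Ck k S f"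
  by (induction k arbitrary: f) (auto intro: continuous_on_subset differentiable_on_subset)

lemma Ck_const: "Ck k UNIV (\<lambda>x. c)"
proof (induction k arbitrary: c)
  case (Suc k)
  show ?case by (rule Ck_SucI[where D="\<lambda>x h. 0"]) (use Suc in auto)
qed simp

lemma Ck_add: "Ck k UNIV f \<Longrightarrow> Ck k UNIV g \<Longrightarrow> Ck k UNIV (\<lambda>x. f x + g x)"
proof (induction k arbitrary: f g)
  case (Suc k)
  show ?case
    by (rule Ck_SucI[OF has_derivative_add[OF Suc.prems[THEN Ck_Suc_has_derivative]]])
      (intro Suc.IH Suc.prems[THEN Ck_Suc_pderiv])
qed (auto intro: continuous_intros)

lemma Ck_mult: "Ck k UNIV f \<Longrightarrow> Ck k UNIV g \<Longrightarrow> Ck k UNIV (\<lambda>x. f x * g x)"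
proof (induction k arbitrary: f g)
  case (Suc k)
  show ?case
    by (rule Ck_SucI[OF has_derivative_mult[OF Suc.prems[THEN Ck_Suc_has_derivative]]])
      (intro Ck_add Suc.IH Suc.prems[THEN Ck_Suc_pderiv] Suc.prems[THEN Ck_SucD])
qed (auto intro: continuous_intros)

lemma Ck_cmult: "Ck k UNIV f \<Longrightarrow> Ck k UNIV (\<lambda>x. c * f x)"
  by (intro Ck_mult Ck_const)

lemma Ck_power: "Ck k UNIV f \<Longrightarrow> Ck k UNIV (\<lambda>x. f x ^ n)"
  by (induction n) (auto intro: Ck_mult Ck_const)

lemma Ck_minus: "Ck k UNIV f \<Longrightarrow> Ck k UNIV (\<lambda>x. - f x)"
  using Ck_cmult[of k f "-1"] by simp

lemma Ck_diff: "Ck k UNIV f \<Longrightarrow> Ck k UNIV g \<Longrightarrow> Ck k UNIV (\<lambda>x. f x - g x)"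
  using Ck_add[OF _ Ck_minus, of k f g] by simp

lemma Ck_sum: "finite A \<Longrightarrow> (\<And>a. a \<in> A \<Longrightarrow> Ck k UNIV (f a)) \<Longrightarrow> Ck k UNIV (\<lambda>x. \<Sum>a\<in>A. f a x)"
  by (induction A rule: finite_induct) (auto intro: Ck_add Ck_const)

lemma Ck_inverse: "Ck k UNIV f \<Longrightarrow> (\<And>x. f x \<noteq> 0) \<Longrightarrow> Ck k UNIV (\<lambda>x. inverse (f x))"
proof (induction k arbitrary: f)
  case (Suc k)
  show ?case
    by (rule Ck_SucI[OF Deriv.has_derivative_inverse[OF Suc.prems(2) Ck_Suc_has_derivative[OF Suc.prems(1)]]])
      (intro Ck_minus Ck_mult Suc.IH Suc.prems Ck_SucD[OF Suc.prems(1)] Ck_Suc_pderiv[OF Suc.prems(1)])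
qed (auto intro: continuous_intros)

lemma Ck_inner: "Ck k UNIV (\<lambda>x. x \<bullet> i)"
proof (cases k)
  case (Suc n)
  then show ?thesis
    by (simp only:) (rule Ck_SucI[where D="\<lambda>x h. h \<bullet> i"]; auto intro!: derivative_eq_intros Ck_const)
qed (auto intro: continuous_intros)

lemma Ck_fst:
  fixes f :: "'a::euclidean_space \<Rightarrow> real"
  shows "Ck k UNIV f \<Longrightarrow> Ck k UNIV (\<lambda>p::'a \<times> 'b::euclidean_space. f (fst p))"
proof (induction k arbitrary: f)
  case 0
  then show ?case by (auto intro!: continuous_on_compose2[of UNIV f] continuous_intros)
next
  case (Suc k)
  show ?case
  proof (rule Ck_SucI[OF has_derivative_compose[OF has_derivative_fst[OF has_derivative_ident] Ck_Suc_has_derivative[OF Suc.prems]]])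
    fix i :: "'a \<times> 'b" assume "i \<in> Basis"
    then have "fst i \<in> Basis \<or> fst i = 0" by (auto simp: Basis_prod_def)
    then show "Ck k UNIV (\<lambda>x::'a \<times> 'b. frechet_derivative f (at (fst x)) (fst i))"
      using Suc.IH[OF Ck_Suc_pderiv[OF Suc.prems]] linear_0[OF has_derivative_linear[OF Ck_Suc_has_derivative[OF Suc.prems]]]
      by (auto simp: Ck_const)
  qed
qed

lemma Ck_snd:
  fixes f :: "'b::euclidean_space \<Rightarrow> real"
  shows "Ck k UNIV f \<Longrightarrow> Ck k UNIV (\<lambda>p::'a::euclidean_space \<times> 'b. f (snd p))"
proof (induction k arbitrary: f)
  case 0
  then show ?case by (auto intro!: continuous_on_compose2[of UNIV f] continuous_intros)
next
  case (Suc k)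
  show ?case
  proof (rule Ck_SucI[OF has_derivative_compose[OF has_derivative_snd[OF has_derivative_ident] Ck_Suc_has_derivative[OF Suc.prems]]])
    fix i :: "'a \<times> 'b" assume "i \<in> Basis"
    then have "snd i \<in> Basis \<or> snd i = 0" by (auto simp: Basis_prod_def)
    then show "Ck k UNIV (\<lambda>x::'a \<times> 'b. frechet_derivative f (at (snd x)) (snd i))"
      using Suc.IH[OF Ck_Suc_pderiv[OF Suc.prems]] linear_0[OF has_derivative_linear[OF Ck_Suc_has_derivative[OF Suc.prems]]]
      by (auto simp: Ck_const)
  qed
qed

lemma Ck_real_SucI:
  fixes f :: "real \<Rightarrow> real"
  assumes "\<And>x. (f has_real_derivative f' x) (at x)" "Ck k UNIV f'"
  shows "Ck (Suc k) UNIV f"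
  by (rule Ck_SucI[where D="\<lambda>x h. f' x * h"])
    (use assms in \<open>auto simp: has_field_derivative_def\<close>)

lemma Ck_affine:
  fixes f :: "real \<Rightarrow> real"
  shows "Ck k UNIV f \<Longrightarrow> Ck k UNIV (\<lambda>s. f (c * s + d))"
proof (induction k arbitrary: f)
  case 0
  then show ?case by (auto intro!: continuous_on_compose2[of UNIV f] continuous_intros)
next
  case (Suc k)
  have l: "linear (frechet_derivative f (at x))" for x
    using has_derivative_linear[OF Ck_Suc_has_derivative[OF Suc.prems]] .
  have "((\<lambda>s. f (c * s + d)) has_derivative (\<lambda>h. frechet_derivative f (at (c * x + d)) (c * h))) (at x)" for x
    by (rule has_derivative_compose[OF _ Ck_Suc_has_derivative[OF Suc.prems]]) (auto intro!: derivative_eq_intros)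
  moreover have "frechet_derivative f (at x) (c * h) = c * h * frechet_derivative f (at x) 1" for x h
    using linear_scale[OF l, of x "c * h" 1] by simp
  ultimately have "((\<lambda>s. f (c * s + d)) has_derivative (\<lambda>h. c * h * frechet_derivative f (at (c * x + d)) 1)) (at x)" for x
    by simp
  then show ?case
    by (rule Ck_SucI) (use Suc.IH[OF Ck_Suc_pderiv[OF Suc.prems], of 1] in \<open>auto intro!: Ck_cmult\<close>)
qed

lemma Ck_exp_bump: "Ck k UNIV (\<lambda>x::real. if 0 < x then inverse x ^ n * exp (- inverse x) else 0)"
proof (induction k arbitrary: n)
  have der: "((\<lambda>x::real. if 0 < x then inverse x ^ n * exp (- inverse x) else 0) has_real_derivative
      (- real n) * (if 0 < x then inverse x ^ Suc n * exp (- inverse x) else 0) +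
      (if 0 < x then inverse x ^ (n + 2) * exp (- inverse x) else 0)) (at x)" for n x
  proof -
    consider "x < 0" | "x = 0" | "0 < x" by linarith
    then show ?thesis
    proof cases
      case 1
      have "((\<lambda>x::real. 0) has_real_derivative 0) (at x)" by simp
      then have "((\<lambda>x::real. if 0 < x then inverse x ^ n * exp (- inverse x) else 0) has_real_derivative 0) (at x)"
        by (rule has_field_derivative_transform_within_open[where S="{..<0}"]) (use 1 in auto)
      then show ?thesis using 1 by simp
    next
      case 2
      have "((\<lambda>x::real. inverse x ^ n * exp (- inverse x) / x) \<longlongrightarrow> 0) (at_right 0)"
        by real_asymp
      then have r: "((\<lambda>x::real. (if 0 < x then inverse x ^ n * exp (- inverse x) else 0) / x) \<longlongrightarrow> 0) (at_right 0)"
        by (rule Lim_transform_eventually) (auto simp: eventually_at_filter)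
      have l: "((\<lambda>x::real. (if 0 < x then inverse x ^ n * exp (- inverse x) else 0) / x) \<longlongrightarrow> 0) (at_left 0)"
        by (rule Lim_transform_eventually[OF tendsto_const[of 0]]) (auto simp: eventually_at_filter)
      show ?thesis using 2 filterlim_split_at[OF l r] by (simp add: has_field_derivative_iff)
    next
      case 3
      have e: "real n * inverse x ^ (n - 1) * inverse x = real n * inverse x ^ n" by (cases n) auto
      have "((\<lambda>x::real. inverse x ^ n * exp (- inverse x)) has_real_derivative
         (real n * inverse x ^ (n - 1) * - (inverse x * inverse x)) * exp (- inverse x)
           + inverse x ^ n * (exp (- inverse x) * (inverse x * inverse x))) (at x)"
        using 3 by (auto intro!: derivative_eq_intros simp: power2_eq_square)
      moreover have "(real n * inverse x ^ (n - 1) * - (inverse x * inverse x)) * exp (- inverse x)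
           + inverse x ^ n * (exp (- inverse x) * (inverse x * inverse x)) =
         - (real n * inverse x ^ (n - 1) * inverse x) * inverse x * exp (- inverse x)
           + inverse x ^ (n + 2) * exp (- inverse x)"
        by (simp add: power_add power2_eq_square)
      ultimately have "((\<lambda>x::real. inverse x ^ n * exp (- inverse x)) has_real_derivative
         (- real n) * (inverse x ^ Suc n * exp (- inverse x)) + inverse x ^ (n + 2) * exp (- inverse x)) (at x)"
        unfolding e by (simp only: power_Suc mult_ac mult_minus_left mult_minus_right)
      then have "((\<lambda>x::real. if 0 < x then inverse x ^ n * exp (- inverse x) else 0) has_real_derivative
         (- real n) * (inverse x ^ Suc n * exp (- inverse x)) + inverse x ^ (n + 2) * exp (- inverse x)) (at x)"
        by (rule has_field_derivative_transform_within_open[where S="{0<..}"]) (use 3 in auto)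
      then show ?thesis using 3 by simp
    qed
  qed
  {
    case 0
    have "continuous_on UNIV (\<lambda>x::real. if 0 < x then inverse x ^ n * exp (- inverse x) else 0)"
      by (rule DERIV_continuous_on[where s=UNIV, OF has_field_derivative_at_within[OF der]])
    then show ?case by simp
  next
    case (Suc k)
    show ?case
      by (rule Ck_real_SucI[OF der]) (intro Ck_add Ck_cmult Suc.IH)
  }
qed

definition smooth_step :: "real \<Rightarrow> real" where
  "smooth_step x = (if 0 < x then exp (- inverse x) else 0) *
     inverse ((if 0 < x then exp (- inverse x) else 0) + (if 0 < 1 - x then exp (- inverse (1 - x)) else 0))"

lemma smooth_step_0: "x \<le> 0 \<Longrightarrow> smooth_step x = 0"
  and smooth_step_1: "1 \<le> x \<Longrightarrow> smooth_step x = 1"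
  by (auto simp: smooth_step_def)

lemma smooth_step_bounds: "0 \<le> smooth_step x" "smooth_step x \<le> 1"
proof -
  have "0 \<le> a * inverse (a + b) \<and> a * inverse (a + b) \<le> 1" if "0 \<le> a" "0 \<le> b" for a b :: real
    using that by (auto simp: divide_inverse[symmetric] divide_le_eq_1)
  then show "0 \<le> smooth_step x" "smooth_step x \<le> 1"
    unfolding smooth_step_def by simp_all
qed

lemma Cinf_smooth_step: "Cinf UNIV smooth_step"
  unfolding Cinf_def
proof
  fix k
  have a: "Ck k UNIV (\<lambda>x::real. if 0 < x then exp (- inverse x) else 0)"
    using Ck_exp_bump[of k 0] by (simp only: power_0 mult_1_left)
  from Ck_affine[OF this, of "-1" 1]
  have b: "Ck k UNIV (\<lambda>x::real. if 0 < 1 - x then exp (- inverse (1 - x)) else 0)"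
    by (simp only: mult_minus1 uminus_add_conv_diff)
  have nz: "(if 0 < x then exp (- inverse x) else 0) + (if 0 < 1 - x then exp (- inverse (1 - x)) else 0) \<noteq> 0" for x :: real
    by (auto simp: add_pos_pos less_imp_neq[symmetric])
  show "Ck k UNIV smooth_step"
    unfolding smooth_step_def[abs_def]
    by (intro Ck_mult Ck_inverse Ck_add a b nz)
qed

lemma Cinf_real_derivative:
  fixes f :: "real \<Rightarrow> real"
  assumes "Cinf UNIV f"
  shows "(f has_real_derivative deriv f x) (at x)" "continuous_on UNIV (deriv f)"
proof -
  have 1: "Ck (Suc 0) UNIV f" using assms by (simp add: Cinf_def del: Ck.simps)
  have "f field_differentiable (at x)" for x
    using Ck_Suc_has_derivative[OF 1, of x] has_derivative_imp_has_field_derivative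
    by (metis (no_types, lifting) field_differentiable_def has_field_derivative_def linear_scale_real
        differentiableI real_differentiable_def)
  then show der: "(f has_real_derivative deriv f x) (at x)" for x
    using DERIV_deriv_iff_field_differentiable by blast
  have "pderiv 1 f = deriv f"
    unfolding pderiv_def frechet_derivative_at[OF der[unfolded has_field_derivative_def], symmetric]
    by simp
  then show "continuous_on UNIV (deriv f)" using 1 by simp
qed

lemma Cinf_has_derivative:
  assumes "Cinf UNIV f"
  shows "(f has_derivative (\<lambda>h. grad f x \<bullet> h)) (at x)"
proof -
  have d: "(f has_derivative frechet_derivative f (at x)) (at x)"
    using assms Ck_Suc_has_derivative[of 0 f x] by (simp add: Cinf_def del: Ck.simps)
  have "frechet_derivative f (at x) h = grad f x \<bullet> h" for h
    using Linear_Algebra.linear_componentwise[OF has_derivative_linear[OF d], of h 1]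
    by (simp add: grad_def pderiv_def inner_sum_right inner_commute mult.commute)
  then have "frechet_derivative f (at x) = (\<lambda>h. grad f x \<bullet> h)" by auto
  with d show ?thesis by simp
qed

lemma grad_unique:
  assumes "(f has_derivative (\<lambda>h. v \<bullet> h)) (at x)"
  shows "grad f x = v"
  unfolding grad_def pderiv_def frechet_derivative_at[OF assms, symmetric]
  by (rule euclidean_representation)

lemma grad_inner_Basis: "i \<in> Basis \<Longrightarrow> grad f x \<bullet> i = pderiv i f x"
  by (simp add: grad_def inner_sum_left inner_Basis if_distrib cong: if_cong)

lemma continuous_grad: "Cinf UNIV f \<Longrightarrow> continuous_on UNIV (grad f)"
proof -
  assume "Cinf UNIV f"
  then have "Ck (Suc 0) UNIV f" by (simp add: Cinf_def del: Ck.simps)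
  then show ?thesis unfolding grad_def[abs_def] by (auto intro!: continuous_intros)
qed

lemma Cinf_continuous: "Cinf UNIV f \<Longrightarrow> continuous_on UNIV f"
  unfolding Cinf_def by (metis Ck.simps(1))

lemma grad_compose:
  fixes g :: "real \<Rightarrow> real"
  assumes "Cinf UNIV f" "(g has_real_derivative g') (at (f x))"
  shows "grad (\<lambda>x. g (f x)) x = g' *\<^sub>R grad f x"
proof (rule grad_unique)
  show "((\<lambda>x. g (f x)) has_derivative (\<lambda>h. (g' *\<^sub>R grad f x) \<bullet> h)) (at x)"
    using has_derivative_compose[OF Cinf_has_derivative[OF assms(1)] assms(2)[unfolded has_field_derivative_def]]
    by simp
qed

lemma test_funD:
  assumes "test_fun \<Omega> \<psi>"
  shows "Cinf UNIV \<psi>" "continuous_on UNIV \<psi>" "continuous_on UNIV (grad \<psi>)"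
  using assms by (auto simp: test_fun_def Cinf_continuous continuous_grad)

lemma grad_eq_0_outside:
  assumes "closed K" "\<And>x. x \<notin> K \<Longrightarrow> f x = 0" "x \<notin> K"
  shows "grad f x = 0"
proof (rule grad_unique)
  have "((\<lambda>x. 0::real) has_derivative (\<lambda>h. 0 \<bullet> h)) (at x)" by simp
  then show "(f has_derivative (\<lambda>h. 0 \<bullet> h)) (at x)"
    by (rule has_derivative_transform_within_open[of _ _ _ UNIV "- K"]) (use assms in auto)
qed

lemma test_fun_bounded:
  assumes "test_fun \<Omega> \<psi>"
  obtains B where "0 < B" "\<And>x. \<bar>\<psi> x\<bar> \<le> B" "\<And>x. norm (grad \<psi> x) \<le> B"
proof -
  obtain K where K: "compact K" "\<And>x. x \<notin> K \<Longrightarrow> \<psi> x = 0"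
    using assms by (auto simp: test_fun_def)
  have "bounded (\<psi> ` K)" "bounded (grad \<psi> ` K)"
    using test_funD[OF assms] K(1)
    by (auto intro!: compact_imp_bounded compact_continuous_image intro: continuous_on_subset)
  then obtain B C where BC: "\<And>x. x \<in> K \<Longrightarrow> \<bar>\<psi> x\<bar> \<le> B" "\<And>x. x \<in> K \<Longrightarrow> norm (grad \<psi> x) \<le> C"
    by (auto simp: bounded_iff)
  show thesis
  proof (rule that[of "max 1 (max B C)"])
    show "\<bar>\<psi> x\<bar> \<le> max 1 (max B C)" for x
      by (cases "x \<in> K") (use BC K(2) in \<open>auto simp: le_max_iff_disj\<close>)
    show "norm (grad \<psi> x) \<le> max 1 (max B C)" for x
      by (cases "x \<in> K")
        (use BC grad_eq_0_outside[OF compact_imp_closed[OF K(1)] K(2)] in \<open>auto simp: le_max_iff_disj\<close>)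
  qed auto
qed

lemma test_fun_support:
  assumes "test_fun \<Omega> \<psi>" "Cinf UNIV f" "\<And>x. \<psi> x = 0 \<Longrightarrow> f x = 0"
  shows "test_fun \<Omega> f"
  using assms by (auto simp: test_fun_def)

definition sat :: "real \<Rightarrow> real \<Rightarrow> real" where
  "sat R s = s\<^sup>2 / (s\<^sup>2 + R)"

definition sat' :: "real \<Rightarrow> real \<Rightarrow> real" where
  "sat' R s = 2 * R * s / (s\<^sup>2 + R)\<^sup>2"

lemma test_fun_sat:
  assumes "test_fun \<Omega> \<psi>" "0 < R" "0 < p"
  shows "test_fun \<Omega> (\<lambda>x. sat R (\<psi> x) ^ p)"
proof (rule test_fun_support[OF assms(1)])
  have "(\<psi> x)\<^sup>2 + R \<noteq> 0" for x using assms(2) by (metis add_nonneg_pos less_irrefl zero_le_power2)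
  then have "Ck k UNIV (\<lambda>x. ((\<psi> x)\<^sup>2 * inverse ((\<psi> x)\<^sup>2 + R)) ^ p)" for k
    using test_funD(1)[OF assms(1)] unfolding Cinf_def
    by (intro Ck_power Ck_mult Ck_inverse Ck_add Ck_const) blast+
  then show "Cinf UNIV (\<lambda>x. sat R (\<psi> x) ^ p)"
    by (simp add: sat_def divide_inverse Cinf_def)
qed (use assms in \<open>auto simp: sat_def\<close>)

lemma sat_DERIV: "0 < R \<Longrightarrow> (sat R has_real_derivative sat' R s) (at s)"
proof -
  assume "0 < R"
  then have "s\<^sup>2 + R \<noteq> 0" by (metis add_nonneg_pos less_irrefl zero_le_power2)
  then have "((\<lambda>s. s\<^sup>2 / (s\<^sup>2 + R)) has_real_derivative
      ((2 * s) * (s\<^sup>2 + R) - s\<^sup>2 * (2 * s)) / ((s\<^sup>2 + R) * (s\<^sup>2 + R))) (at s)"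
    by (intro DERIV_divide) (auto intro!: derivative_eq_intros)
  moreover have "(2 * s) * (s\<^sup>2 + R) - s\<^sup>2 * (2 * s) = 2 * R * s" by (simp add: algebra_simps)
  ultimately show ?thesis unfolding sat_def[abs_def] sat'_def
    by (simp add: power2_eq_square)
qed

lemma sat_power_DERIV:
  "0 < R \<Longrightarrow> ((\<lambda>s. sat R s ^ p) has_real_derivative real p * sat R s ^ (p - 1) * sat' R s) (at s)"
  using sat_DERIV[of R s] by (auto intro!: derivative_eq_intros)

lemma sat_bounds: "0 < R \<Longrightarrow> 0 \<le> sat R s" "0 < R \<Longrightarrow> sat R s \<le> 1"
  by (auto simp: sat_def divide_le_eq_1 add_nonneg_pos)

lemma sat'_bound: "0 < R \<Longrightarrow> \<bar>sat' R s\<bar> \<le> 1 / sqrt R"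
proof -
  assume R: "0 < R"
  define q where "q = sqrt R"
  have q: "0 < q" "R = q\<^sup>2" using R by (auto simp: q_def)
  have "0 \<le> (\<bar>s\<bar> - q)\<^sup>2" by simp
  then have a: "2 * \<bar>s\<bar> * q \<le> s\<^sup>2 + q\<^sup>2" by (simp add: power2_diff)
  have b: "q\<^sup>2 \<le> s\<^sup>2 + q\<^sup>2" by simp
  have "(2 * \<bar>s\<bar> * q) * q\<^sup>2 \<le> (s\<^sup>2 + q\<^sup>2) * (s\<^sup>2 + q\<^sup>2)"
    by (rule mult_mono[OF a b]) auto
  then have "2 * q\<^sup>2 * \<bar>s\<bar> / (s\<^sup>2 + q\<^sup>2)\<^sup>2 \<le> 1 / q"
    using q by (simp add: pos_divide_le_eq pos_le_divide_eq power2_eq_square add_nonneg_pos mult_ac)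
  then show ?thesis
    using q by (simp add: sat'_def abs_mult abs_divide)
qed

lemma sat_sat': "0 < R \<Longrightarrow> s * sat' R s \<le> 2 * sat R s" "0 < R \<Longrightarrow> 0 \<le> s * sat' R s"
  "0 < R \<Longrightarrow> s * sat' R s \<le> 1"
proof -
  assume R: "0 < R"
  have pos: "0 < s\<^sup>2 + R" using R by (simp add: add_nonneg_pos)
  have "s * sat' R s = 2 * (s\<^sup>2 / (s\<^sup>2 + R)) * (R / (s\<^sup>2 + R))"
    by (simp add: sat'_def power2_eq_square)
  moreover have "0 \<le> s\<^sup>2 / (s\<^sup>2 + R)" "0 \<le> R / (s\<^sup>2 + R)" "R / (s\<^sup>2 + R) \<le> 1"
    "s\<^sup>2 / (s\<^sup>2 + R) + R / (s\<^sup>2 + R) = 1"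
    using R pos by (auto simp: divide_simps)
  moreover have "2 * a * b \<le> 1" if "a + b = 1" for a b :: real
  proof -
    have b: "b = 1 - a" using that by simp
    have "0 \<le> (2 * a - 1)\<^sup>2" by simp
    moreover have "2 * a * b = 2 * a - 2 * a\<^sup>2"
      unfolding b by (simp add: power2_eq_square algebra_simps)
    moreover have "(2 * a - 1)\<^sup>2 = 4 * a\<^sup>2 - 4 * a + 1" by (simp add: power2_eq_square algebra_simps)
    ultimately show ?thesis by linarith
  qed
  ultimately show "s * sat' R s \<le> 2 * sat R s" "0 \<le> s * sat' R s" "s * sat' R s \<le> 1"
    unfolding sat_def
    by (metis mult_left_le mult_nonneg_nonneg zero_le_numeral, metis mult_nonneg_nonneg zero_le_numeral, metis)
qed

lemma has_derivative_tensor: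
  assumes "Cinf UNIV \<psi>" "Cinf UNIV \<eta>"
  shows "((\<lambda>p. \<psi> (fst p) * \<eta> (snd p)) has_derivative
    (\<lambda>h. \<psi> (fst p) * (deriv \<eta> (snd p) * snd h) + (grad \<psi> (fst p) \<bullet> fst h) * \<eta> (snd p))) (at p)"
  by (rule has_derivative_mult[OF
        has_derivative_compose[OF has_derivative_fst[OF has_derivative_ident] Cinf_has_derivative[OF assms(1)]]
        has_derivative_compose[OF has_derivative_snd[OF has_derivative_ident]
          Cinf_real_derivative(1)[OF assms(2), unfolded has_field_derivative_def]]])

lemma dt_tensor:
  assumes "Cinf UNIV \<psi>" "Cinf UNIV \<eta>"
  shows "dt (\<lambda>p. \<psi> (fst p) * \<eta> (snd p)) p = \<psi> (fst p) * deriv \<eta> (snd p)"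
  using fun_cong[OF frechet_derivative_at[OF has_derivative_tensor[OF assms]], of p "(0, 1)"] by (simp add: dt_def)

lemma gradx_tensor:
  assumes "Cinf UNIV \<psi>" "Cinf UNIV \<eta>"
  shows "gradx (\<lambda>p. \<psi> (fst p) * \<eta> (snd p)) p = \<eta> (snd p) *\<^sub>R grad \<psi> (fst p)"
proof -
  have "frechet_derivative (\<lambda>p. \<psi> (fst p) * \<eta> (snd p)) (at p) (i, 0) = \<eta> (snd p) * (grad \<psi> (fst p) \<bullet> i)" for i
    using fun_cong[OF frechet_derivative_at[OF has_derivative_tensor[OF assms]], of p "(i, 0)"]
    by (simp add: mult.commute)
  then show ?thesis
    by (simp add: gradx_def flip: scaleR_scaleR scaleR_sum_right add: euclidean_representation)
qed

lemma Cinf_tensor: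
  assumes "Cinf UNIV \<psi>" "Cinf UNIV \<eta>"
  shows "Cinf UNIV (\<lambda>p. \<psi> (fst p) * \<eta> (snd p))"
  using assms unfolding Cinf_def by (blast intro: Ck_mult[OF Ck_fst Ck_snd])

lemma test_fun0_tensor:
  assumes "test_fun \<Omega> \<psi>" "Cinf UNIV \<eta>" "\<And>t. T' \<le> t \<Longrightarrow> \<eta> t = 0" "ereal T' < T"
  shows "test_fun0 \<Omega> T (\<lambda>p. \<psi> (fst p) * \<eta> (snd p))"
proof -
  obtain K where K: "compact K" "K \<subseteq> \<Omega>" "\<And>x. x \<notin> K \<Longrightarrow> \<psi> x = 0"
    using assms by (auto simp: test_fun_def)
  have "compact (K \<times> {0..T'})" using K(1) by (intro compact_Times) auto
  moreover have "K \<times> {0..T'} \<subseteq> \<Omega> \<times> {t. ereal t < T}"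
    using K(2) assms(4) le_less_trans[of "ereal _" "ereal T'" T] by auto
  moreover have "\<forall>p. 0 \<le> snd p \<longrightarrow> p \<notin> K \<times> {0..T'} \<longrightarrow> \<psi> (fst p) * \<eta> (snd p) = 0"
    using K(3) assms(3) by (auto simp: mem_Times_iff)
  ultimately show ?thesis
    unfolding test_fun0_def using Cinf_tensor[OF test_funD(1)[OF assms(1)] assms(2)] by blast
qed

lemma test_fun_tensor:
  fixes a b :: real
  assumes "test_fun \<Omega> \<psi>" "Cinf UNIV \<eta>" "\<And>t. t \<notin> {a..b} \<Longrightarrow> \<eta> t = 0" "{a..b} \<subseteq> I"
  shows "test_fun (\<Omega> \<times> I) (\<lambda>p. \<psi> (fst p) * \<eta> (snd p))"
proof -
  obtain K where K: "compact K" "K \<subseteq> \<Omega>" "\<And>x. x \<notin> K \<Longrightarrow> \<psi> x = 0"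
    using assms by (auto simp: test_fun_def)
  have "compact (K \<times> {a..b})" using K(1) by (intro compact_Times) auto
  moreover have "K \<times> {a..b} \<subseteq> \<Omega> \<times> I" using K(2) assms(4) by auto
  moreover have "\<forall>p. p \<notin> K \<times> {a..b} \<longrightarrow> \<psi> (fst p) * \<eta> (snd p) = 0"
    using K(3) assms(3) by (auto simp: mem_Times_iff)
  ultimately show ?thesis
    unfolding test_fun_def using Cinf_tensor[OF test_funD(1)[OF assms(1)] assms(2)] by blast
qed

lemma test_fun_coordinate_mult:
  assumes "test_fun \<Omega> \<psi>"
  shows "test_fun \<Omega> (\<lambda>x. (x \<bullet> i) * \<psi> x)"
    and "grad (\<lambda>x. (x \<bullet> i) * \<psi> x) x = \<psi> x *\<^sub>R i + (x \<bullet> i) *\<^sub>R grad \<psi> x"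
proof -
  show "test_fun \<Omega> (\<lambda>x. (x \<bullet> i) * \<psi> x)"
    by (rule test_fun_support[OF assms])
      (use test_funD(1)[OF assms] in \<open>auto simp: Cinf_def intro!: Ck_mult[OF Ck_inner]\<close>)
  show "grad (\<lambda>x. (x \<bullet> i) * \<psi> x) x = \<psi> x *\<^sub>R i + (x \<bullet> i) *\<^sub>R grad \<psi> x"
    by (rule grad_unique, rule has_derivative_eq_rhs[OF has_derivative_mult[OF
            has_derivative_inner_left[OF has_derivative_ident] Cinf_has_derivative[OF test_funD(1)[OF assms]]]])
      (auto simp: inner_commute algebra_simps)
qed

subsection \<open>Fubini's theorem for Lebesgue measure\<close>

lemma borel_measurable_lebesgue_AE_eq:
  assumes "g \<in> borel_measurable lebesgue" "AE x in lebesgue. f x = g x"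
  shows "f \<in> borel_measurable lebesgue"
proof (rule measurableI)
  fix A :: "'b set" assume "A \<in> sets borel"
  with assms(1) have "g -` A \<inter> space lebesgue \<in> sets lebesgue" by (rule measurable_sets)
  moreover have "AE x in lebesgue. x \<in> g -` A \<inter> space lebesgue \<longleftrightarrow> x \<in> f -` A \<inter> space lebesgue"
    using assms(2) by eventually_elim simp
  ultimately show "f -` A \<inter> space lebesgue \<in> sets lebesgue"
    by (intro completion.in_sets_AE[of "g -` A \<inter> space lebesgue" "f -` A \<inter> space lebesgue"] inf_le2)
qed simp

lemma integrable_lebesgue_AE_eq:
  fixes f g :: "'a::euclidean_space \<Rightarrow> real"
  assumes "integrable lebesgue g" "AE x in lebesgue. f x = g x"
  shows "integrable lebesgue f" "integral\<^sup>L lebesgue f = integral\<^sup>L lebesgue g"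
proof -
  have g: "g \<in> borel_measurable lebesgue" using assms(1) by auto
  have f: "f \<in> borel_measurable lebesgue" by (rule borel_measurable_lebesgue_AE_eq[OF g assms(2)])
  show "integrable lebesgue f" using integrable_cong_AE[OF f g assms(2)] assms(1) by simp
  show "integral\<^sup>L lebesgue f = integral\<^sup>L lebesgue g" by (rule integral_cong_AE[OF f g assms(2)])
qed

lemma AE_lebesgue_slices:
  fixes P :: "'a::euclidean_space \<times> 'b::euclidean_space \<Rightarrow> bool"
  assumes "AE p in lebesgue. P p"
  shows "AE t in lebesgue. AE x in lebesgue. P (x, t)"
proof -
  have "AE p in lborel. P p" using assms by (simp add: AE_completion_iff)
  then obtain N where N: "{p \<in> space lborel. \<not> P p} \<subseteq> N" "N \<in> sets lborel" "emeasure lborel N = 0"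
    by (rule AE_E)
  have Ns: "N \<in> sets (lborel \<Otimes>\<^sub>M lborel)" using N(2) unfolding lborel_prod .
  have "{p \<in> space (lborel \<Otimes>\<^sub>M lborel). p \<notin> N} = space (lborel \<Otimes>\<^sub>M lborel) - N" by auto
  then have Nc: "{p \<in> space (lborel \<Otimes>\<^sub>M lborel). (fst p, snd p) \<notin> N} \<in> sets (lborel \<Otimes>\<^sub>M lborel)"
    using sets.compl_sets[OF Ns] by (simp only: prod.collapse)
  have "AE p in lborel. p \<notin> N" using N by (intro AE_not_in) auto
  then have "AE p in lborel \<Otimes>\<^sub>M lborel. p \<notin> N" unfolding lborel_prod .
  then have "AE x in lborel. AE t in lborel. (x, t) \<notin> N" by (rule lborel_pair.AE_pair)
  then have "AE t in lborel. AE x in lborel. (x, t) \<notin> N"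
    by (subst (asm) lborel_pair.AE_commute[OF Nc])
  moreover have "(x, t) \<notin> N \<Longrightarrow> P (x, t)" for x t using N(1) by auto
  ultimately have "AE t in lborel. AE x in lborel. P (x, t)"
    by (auto elim!: eventually_mono)
  then show ?thesis by (simp add: AE_completion_iff)
qed

lemma lebesgue_Fubini_UNIV:
  fixes f :: "'a::euclidean_space \<times> 'b::euclidean_space \<Rightarrow> real"
  assumes "integrable lebesgue f"
  shows "AE t in lebesgue. integrable lebesgue (\<lambda>x. f (x, t))"
    and "integrable lebesgue (\<lambda>t. integral\<^sup>L lebesgue (\<lambda>x. f (x, t)))"
    and "integral\<^sup>L lebesgue f = integral\<^sup>L lebesgue (\<lambda>t. integral\<^sup>L lebesgue (\<lambda>x. f (x, t)))"
proof -
  obtain g where g: "g \<in> borel_measurable lborel" "AE p in lborel. f p = g p"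
    using completion_ex_borel_measurable_real[OF borel_measurable_integrable[OF assms]] by auto
  have ae: "AE p in lebesgue. f p = g p" using g(2) by (simp add: AE_completion_iff)
  have fm: "f \<in> borel_measurable lebesgue" using assms by auto
  have gm: "g \<in> borel_measurable lebesgue" using g(1) by (rule measurable_completion)
  have "integrable lebesgue g" using integrable_cong_AE[OF fm gm ae] assms by simp
  then have "integrable lborel g" using g(1) by (simp add: integrable_completion)
  then have gi: "integrable (lborel \<Otimes>\<^sub>M lborel) (\<lambda>(x, y). g (x, y))"
    unfolding lborel_prod by (simp add: case_prod_beta')
  have gme: "g \<in> borel_measurable (lborel \<Otimes>\<^sub>M lborel)" using g(1) unfolding lborel_prod .
  have g1: "(\<lambda>x. g (x, t)) \<in> borel_measurable lborel" for t
    by (rule measurable_compose[OF measurable_Pair2' gme]) simp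
  have g2: "(\<lambda>t. integral\<^sup>L lborel (\<lambda>x. g (x, t))) \<in> borel_measurable lborel"
    using lborel_pair.integrable_snd[OF gi] by auto
  have A: "AE t in lborel. integrable lborel (\<lambda>x. g (x, t))"
    and B: "integrable lborel (\<lambda>t. integral\<^sup>L lborel (\<lambda>x. g (x, t)))"
    and C: "integral\<^sup>L lborel (\<lambda>t. integral\<^sup>L lborel (\<lambda>x. g (x, t))) = integral\<^sup>L lborel g"
    using lborel_pair.AE_integrable_snd[OF gi] lborel_pair.integrable_snd[OF gi] lborel_pair.integral_snd[OF gi]
    unfolding lborel_prod by (auto simp: case_prod_beta')
  have A': "AE t in lebesgue. integrable lebesgue (\<lambda>x. g (x, t))"
    using A g1 by (simp add: AE_completion_iff integrable_completion)
  have gx: "integral\<^sup>L lebesgue (\<lambda>x. g (x, t)) = integral\<^sup>L lborel (\<lambda>x. g (x, t))" for t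
    using g1 by (simp add: integral_completion)
  have sl: "AE t in lebesgue. AE x in lebesgue. f (x, t) = g (x, t)"
    using AE_lebesgue_slices[OF ae] by simp
  show "AE t in lebesgue. integrable lebesgue (\<lambda>x. f (x, t))"
    using A' sl by eventually_elim (rule integrable_lebesgue_AE_eq(1))
  have eq: "AE t in lebesgue. integral\<^sup>L lebesgue (\<lambda>x. f (x, t)) = integral\<^sup>L lborel (\<lambda>x. g (x, t))"
    using A' sl by eventually_elim (simp add: integrable_lebesgue_AE_eq(2) gx)
  have B': "integrable lebesgue (\<lambda>t. integral\<^sup>L lborel (\<lambda>x. g (x, t)))"
    using B g2 by (simp add: integrable_completion)
  note * = integrable_lebesgue_AE_eq[OF B' eq]
  show "integrable lebesgue (\<lambda>t. integral\<^sup>L lebesgue (\<lambda>x. f (x, t)))" by (rule *)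
  have "integral\<^sup>L lebesgue f = integral\<^sup>L lebesgue g" by (rule integral_cong_AE[OF fm gm ae])
  also have "\<dots> = integral\<^sup>L lborel g" using g(1) by (rule integral_completion)
  also have "\<dots> = integral\<^sup>L lebesgue (\<lambda>t. integral\<^sup>L lborel (\<lambda>x. g (x, t)))"
    using g2 C by (simp add: integral_completion)
  finally show "integral\<^sup>L lebesgue f = integral\<^sup>L lebesgue (\<lambda>t. integral\<^sup>L lebesgue (\<lambda>x. f (x, t)))"
    using *(2) by simp
qed

lemma AE_lebesgue_on_slices:
  fixes P :: "'a::euclidean_space \<times> 'b::euclidean_space \<Rightarrow> bool"
  assumes "S \<in> sets borel" "I \<in> sets borel" "AE p in lebesgue_on (S \<times> I). P p"
  shows "AE t in lebesgue_on I. AE x in lebesgue_on S. P (x, t)"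
proof -
  have SI: "S \<times> I \<in> sets borel" using assms(1,2) by (rule borel_Times)
  have "AE p in lebesgue. p \<in> S \<times> I \<longrightarrow> P p"
    using assms(3) SI by (simp add: AE_restrict_space_iff)
  from AE_lebesgue_slices[OF this]
  have "AE t in lebesgue. t \<in> I \<longrightarrow> (AE x in lebesgue. x \<in> S \<longrightarrow> P (x, t))"
    by eventually_elim (auto elim: eventually_mono)
  then show ?thesis using assms(1,2) by (simp add: AE_restrict_space_iff)
qed

lemma lebesgue_on_Fubini:
  fixes f :: "'a::euclidean_space \<times> 'b::euclidean_space \<Rightarrow> real"
  assumes S: "S \<in> sets borel" and I: "I \<in> sets borel" and f: "integrable (lebesgue_on (S \<times> I)) f"
  shows "AE t in lebesgue_on I. integrable (lebesgue_on S) (\<lambda>x. f (x, t))"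
    and "integrable (lebesgue_on I) (\<lambda>t. integral\<^sup>L (lebesgue_on S) (\<lambda>x. f (x, t)))"
    and "integral\<^sup>L (lebesgue_on (S \<times> I)) f =
      integral\<^sup>L (lebesgue_on I) (\<lambda>t. integral\<^sup>L (lebesgue_on S) (\<lambda>x. f (x, t)))"
proof -
  have SI: "S \<times> I \<in> sets borel" using S I by (rule borel_Times)
  define F where "F p = indicator (S \<times> I) p * f p" for p
  have F: "integrable lebesgue F"
    using f SI by (simp add: integrable_restrict_space F_def[abs_def])
  note Fu = lebesgue_Fubini_UNIV[OF F]
  have Fx: "F (x, t) = indicator I t * (indicator S x * f (x, t))" for x t
    by (auto simp: F_def indicator_def)
  have int: "integral\<^sup>L lebesgue (\<lambda>x. F (x, t)) = indicator I t * integral\<^sup>L (lebesgue_on S) (\<lambda>x. f (x, t))" for t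
    using S by (simp add: Fx integral_restrict_space)
  have "AE t in lebesgue. t \<in> I \<longrightarrow> integrable lebesgue (\<lambda>x. indicator S x * f (x, t))"
    using Fu(1) by eventually_elim (auto simp: Fx)
  then show "AE t in lebesgue_on I. integrable (lebesgue_on S) (\<lambda>x. f (x, t))"
    using S I by (simp add: AE_restrict_space_iff integrable_restrict_space)
  show "integrable (lebesgue_on I) (\<lambda>t. integral\<^sup>L (lebesgue_on S) (\<lambda>x. f (x, t)))"
    using Fu(2) I by (simp add: int integrable_restrict_space)
  show "integral\<^sup>L (lebesgue_on (S \<times> I)) f =
      integral\<^sup>L (lebesgue_on I) (\<lambda>t. integral\<^sup>L (lebesgue_on S) (\<lambda>x. f (x, t)))"
    using Fu(3) SI I by (simp only: int) (simp add: integral_restrict_space F_def[abs_def])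
qed

subsection \<open>Integrals over subsets\<close>

lemma integrable_lebesgue_on_subset:
  fixes f :: "'a::euclidean_space \<Rightarrow> real"
  assumes "integrable (lebesgue_on A) f" "B \<subseteq> A" "B \<in> sets lebesgue" "A \<in> sets lebesgue"
  shows "integrable (lebesgue_on B) f"
proof -
  have "set_integrable lebesgue A f"
    using assms by (simp add: set_integrable_def integrable_restrict_space)
  then have "set_integrable lebesgue B f" by (rule set_integrable_subset) (use assms in auto)
  then show ?thesis using assms by (simp add: set_integrable_def integrable_restrict_space)
qed

lemma AE_lebesgue_on_subset:
  assumes "AE x in lebesgue_on A. P x" "B \<subseteq> A" "B \<in> sets lebesgue" "A \<in> sets lebesgue"
  shows "AE x in lebesgue_on B. P x"
proof -
  have "AE x in lebesgue. x \<in> A \<longrightarrow> P x" using assms by (simp add: AE_restrict_space_iff)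
  then have "AE x in lebesgue. x \<in> B \<longrightarrow> P x" by eventually_elim (use assms(2) in auto)
  then show ?thesis using assms by (simp add: AE_restrict_space_iff)
qed

lemma integral_lebesgue_on_subset:
  fixes f :: "'a::euclidean_space \<Rightarrow> real"
  assumes "B \<subseteq> A" "B \<in> sets lebesgue" "A \<in> sets lebesgue"
  shows "integral\<^sup>L (lebesgue_on B) f = integral\<^sup>L (lebesgue_on A) (\<lambda>x. indicator B x * f x)"
proof -
  have "(\<lambda>x. indicator A x *\<^sub>R (indicator B x * f x)) = (\<lambda>x. indicator B x *\<^sub>R f x)"
    using assms(1) by (intro ext) (auto simp: indicator_def)
  then show ?thesis using assms by (simp add: integral_restrict_space)
qed

lemma integral_interval_split:
  fixes f :: "real \<Rightarrow> real"
  assumes "integrable (lebesgue_on {s<..r}) f" "s \<le> t" "t \<le> r"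
  shows "integral\<^sup>L (lebesgue_on {s<..r}) f =
    integral\<^sup>L (lebesgue_on {s<..t}) f + integral\<^sup>L (lebesgue_on {t<..r}) f"
proof -
  have i: "set_integrable lebesgue {s<..r} f"
    using assms by (simp add: set_integrable_def integrable_restrict_space)
  have "{s<..r} = {s<..t} \<union> {t<..r}" using assms by auto
  moreover have "set_lebesgue_integral lebesgue ({s<..t} \<union> {t<..r}) f =
      set_lebesgue_integral lebesgue {s<..t} f + set_lebesgue_integral lebesgue {t<..r} f"
    by (rule set_integral_Un) (use assms i in \<open>auto intro!: set_integrable_subset[OF i]\<close>)
  ultimately show ?thesis
    by (simp add: set_lebesgue_integral_def integral_restrict_space)
qed

lemma AE_eq_0_if_interval_integrals_0:
  fixes h :: "real \<Rightarrow> real"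
  assumes h: "integrable (lebesgue_on {a<..<b}) h"
    and 0: "\<And>s t. a < s \<Longrightarrow> s < t \<Longrightarrow> t < b \<Longrightarrow> integral\<^sup>L (lebesgue_on {s<..t}) h = 0"
  shows "AE t in lebesgue_on {a<..<b}. h t = 0"
proof -
  define H where "H t = indicator {a<..<b} t * h t" for t
  have H: "integrable lebesgue H"
    using h by (simp add: integrable_restrict_space H_def[abs_def])
  have HI: "H integrable_on cbox c d" for c d
  proof -
    have "set_integrable lebesgue UNIV H" using H by (simp add: set_integrable_def)
    then have "set_integrable lebesgue (cbox c d) H" by (rule set_integrable_subset) auto
    then show ?thesis by (rule set_lebesgue_integral_eq_integral(1))
  qed
  obtain N where N: "negligible N" and
    lim: "\<And>x e. \<lbrakk>x \<notin> N; 0 < e\<rbrakk> \<Longrightarrow> \<exists>d>0. \<forall>h. 0 < h \<and> h < d \<longrightarrow>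
        norm (integral (cbox x (x + h *\<^sub>R One)) H /\<^sub>R h ^ DIM(real) - H x) < e"
    by (rule integrable_ccontinuous_explicit[OF HI]) (rule that)
  have "h t = 0" if t: "a < t" "t < b" "t \<notin> N" for t
  proof (rule ccontr)
    assume "h t \<noteq> 0"
    then have "0 < \<bar>h t\<bar>" by simp
    from lim[OF t(3) this] obtain d where d: "d > 0"
      "\<And>h'. 0 < h' \<Longrightarrow> h' < d \<Longrightarrow> norm (integral {t..t + h'} H /\<^sub>R h' - H t) < \<bar>h t\<bar>"
      by auto
    define k where "k = min (d / 2) ((b - t) / 2)"
    have k: "0 < k" "k < d" "t + k < b" using d(1) t by (auto simp: k_def min_def field_simps)
    have s: "set_integrable lebesgue {t..t + k} H"
      using H set_integrable_subset[of lebesgue UNIV H "{t..t+k}"] by (simp add: set_integrable_def)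
    have "integral {t..t + k} H = set_lebesgue_integral lebesgue {t..t + k} H"
      using set_lebesgue_integral_eq_integral(2)[OF s] by simp
    also have "\<dots> = set_lebesgue_integral lebesgue {t<..t + k} h"
      unfolding set_lebesgue_integral_def
    proof (rule integral_cong_AE)
      show "(\<lambda>x. indicator {t..t + k} x *\<^sub>R H x) \<in> borel_measurable lebesgue"
        using s by (simp add: set_integrable_def)
      have "(\<lambda>x. indicator {t<..t + k} x *\<^sub>R h x) = (\<lambda>x. indicator {t<..t + k} x *\<^sub>R H x)"
        using t k by (intro ext) (auto simp: H_def indicator_def)
      moreover have "(\<lambda>x. indicator {t<..t + k} x *\<^sub>R H x) \<in> borel_measurable lebesgue"
        by (intro borel_measurable_scaleR borel_measurable_integrable[OF H] borel_measurable_indicator) auto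
      ultimately show "(\<lambda>x. indicator {t<..t + k} x *\<^sub>R h x) \<in> borel_measurable lebesgue" by simp
      have "AE x in lebesgue. x \<noteq> t"
        unfolding AE_completion_iff by (rule AE_lborel_singleton)
      then show "AE x in lebesgue. indicator {t..t + k} x *\<^sub>R H x = indicator {t<..t + k} x *\<^sub>R h x"
        by eventually_elim (use t k in \<open>auto simp: H_def indicator_def\<close>)
    qed
    also have "\<dots> = integral\<^sup>L (lebesgue_on {t<..t + k}) h"
      by (simp add: set_lebesgue_integral_def integral_restrict_space)
    also have "\<dots> = 0" using 0[of t "t + k"] t k by simp
    finally have "integral {t..t + k} H = 0" .
    then show False using d(2)[OF k(1,2)] t by (simp add: H_def)
  qed
  note * = this
  have "AE t in lebesgue. t \<notin> N" using N by (simp add: AE_not_in negligible_iff_null_sets)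
  then have "AE t in lebesgue. t \<in> {a<..<b} \<longrightarrow> h t = 0"
    by eventually_elim (use * in auto)
  then show ?thesis by (simp add: AE_restrict_space_iff)
qed

subsection \<open>Weak differential equations in time\<close>

lemma Cinf_step: "Cinf UNIV (\<lambda>s. smooth_step ((s - t) * n))"
  unfolding Cinf_def
proof
  fix k
  have "Ck k UNIV (\<lambda>s. smooth_step (n * s + (- (t * n))))"
    using Cinf_smooth_step unfolding Cinf_def by (intro Ck_affine) blast
  then show "Ck k UNIV (\<lambda>s. smooth_step ((s - t) * n))" by (simp add: algebra_simps)
qed

lemma deriv_step: "((\<lambda>s. smooth_step ((s - t) * n)) has_real_derivative deriv smooth_step ((s - t) * n) * n) (at s)"
proof (rule DERIV_chain2[OF Cinf_real_derivative(1)[OF Cinf_smooth_step]])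
  show "((\<lambda>s. (s - t) * n) has_real_derivative n) (at s)"
    by (auto intro!: derivative_eq_intros)
qed

lemma deriv_smooth_step_0: "x \<notin> {0..1} \<Longrightarrow> deriv smooth_step x = 0"
proof -
  assume x: "x \<notin> {0..1}"
  have "((\<lambda>s. smooth_step x) has_real_derivative 0) (at x)" by simp
  then have "(smooth_step has_real_derivative 0) (at x)"
  proof (rule has_field_derivative_transform_within_open)
    show "open (if x < 0 then {..<0} else {1<..} :: real set)" by auto
  qed (use x in \<open>auto simp: smooth_step_0 smooth_step_1\<close>)
  then show ?thesis by (rule DERIV_imp_deriv)
qed

lemma deriv_smooth_step_bounded: obtains C where "0 < C" "\<And>x. \<bar>deriv smooth_step x\<bar> \<le> C"
proof -
  have "bounded (deriv smooth_step ` {0..1})"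
    using Cinf_real_derivative(2)[OF Cinf_smooth_step]
    by (intro compact_imp_bounded compact_continuous_image) (auto intro: continuous_on_subset)
  then obtain C where C: "\<And>x. x \<in> {0..1} \<Longrightarrow> \<bar>deriv smooth_step x\<bar> \<le> C"
    unfolding bounded_iff by (metis image_eqI real_norm_def)
  show thesis
  proof (rule that[of "max C 1"])
    show "\<bar>deriv smooth_step x\<bar> \<le> max C 1" for x
      using C[of x] deriv_smooth_step_0[of x] by (cases "x \<in> {0..1}") (auto simp: le_max_iff_disj)
  qed auto
qed

lemma deriv_step_measurable [measurable]: "(\<lambda>s. deriv smooth_step ((s - t) * n)) \<in> borel_measurable lebesgue"
proof -
  have "continuous_on UNIV (\<lambda>s. deriv smooth_step ((s - t) * n))"
    by (rule continuous_on_compose2[OF Cinf_real_derivative(2)[OF Cinf_smooth_step]]) (auto intro!: continuous_intros)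
  then show ?thesis by (simp add: borel_measurable_continuous_onI measurable_completion)
qed

lemma step_measurable [measurable]: "(\<lambda>s. smooth_step ((s - t) * n)) \<in> borel_measurable lebesgue"
  using Cinf_continuous[OF Cinf_step]
  by (simp add: borel_measurable_continuous_onI measurable_completion)

lemma deriv_step_support:
  assumes "0 < n" "s \<notin> {t..t + 1 / n}"
  shows "deriv smooth_step ((s - t) * n) = 0"
proof -
  consider "s - t < 0" | "1 / n < s - t" using assms(2) by fastforce
  then have "(s - t) * n \<notin> {0..1}"
  proof cases
    case 1
    then have "(s - t) * n < 0" using assms(1) by (rule mult_neg_pos)
    then show ?thesis by simp
  next
    case 2
    then have "1 < (s - t) * n" using assms(1) by (simp add: pos_divide_less_eq)
    then show ?thesis by simp
  qed
  then show ?thesis by (rule deriv_smooth_step_0)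
qed

lemma integral_deriv_step:
  assumes "0 < n" "t + 1 / n < T" "0 < t"
  shows "integrable (lebesgue_on {0<..<T}) (\<lambda>s. deriv smooth_step ((s - t) * n) * n)"
    and "integral\<^sup>L (lebesgue_on {0<..<T}) (\<lambda>s. deriv smooth_step ((s - t) * n) * n) = 1"
proof -
  let ?h = "\<lambda>s. deriv smooth_step ((s - t) * n) * n"
  have c: "continuous_on {t..t + 1 / n} ?h"
    by (intro continuous_intros continuous_on_compose2[OF Cinf_real_derivative(2)[OF Cinf_smooth_step]]) auto
  have ai: "set_integrable lebesgue {t..t + 1 / n} ?h"
    by (rule absolutely_integrable_continuous_real[OF c])
  have "(?h has_integral (smooth_step ((t + 1 / n - t) * n) - smooth_step ((t - t) * n))) {t..t + 1 / n}"
    using assms(1) by (intro fundamental_theorem_of_calculus)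
      (auto intro!: has_field_derivative_at_within deriv_step simp flip: has_real_derivative_iff_has_vector_derivative)
  moreover have "smooth_step ((t + 1 / n - t) * n) - smooth_step ((t - t) * n) = 1"
    using assms(1) by (simp add: smooth_step_0 smooth_step_1)
  ultimately have i: "integral {t..t + 1 / n} ?h = 1"
    using integral_unique by metis
  have z: "?h s = 0" if "s \<notin> {t..t + 1 / n}" for s
    using deriv_step_support[OF assms(1) that] by simp
  have e: "(\<lambda>s. indicator {0<..<T} s *\<^sub>R ?h s) = (\<lambda>s. indicator {t..t + 1 / n} s *\<^sub>R ?h s)"
  proof
    fix s show "indicator {0<..<T} s *\<^sub>R ?h s = indicator {t..t + 1 / n} s *\<^sub>R ?h s"
      using assms z[of s] by (cases "s \<in> {t..t + 1 / n}") auto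
  qed
  show "integrable (lebesgue_on {0<..<T}) ?h"
    unfolding integrable_restrict_space[of "{0<..<T}" lebesgue, simplified] e
    using ai unfolding set_integrable_def .
  show "integral\<^sup>L (lebesgue_on {0<..<T}) ?h = 1"
    unfolding integral_restrict_space[of "{0<..<T}" lebesgue, simplified] e
    using i set_lebesgue_integral_eq_integral(2)[OF ai] unfolding set_lebesgue_integral_def by (rule trans[rotated])
qed

lemma integrable_deriv_step_mult:
  assumes "integrable (lebesgue_on {0<..<T}) a"
  shows "integrable (lebesgue_on {0<..<T}) (\<lambda>s. a s * (deriv smooth_step ((s - t) * n) * n))"
proof -
  obtain C where C: "0 < C" "\<And>x. \<bar>deriv smooth_step x\<bar> \<le> C" using deriv_smooth_step_bounded by blast
  show ?thesis
  proof (rule Bochner_Integration.integrable_bound)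
    show "integrable (lebesgue_on {0<..<T}) (\<lambda>s. a s * (C * n))" using assms by simp
    show "(\<lambda>s. a s * (deriv smooth_step ((s - t) * n) * n)) \<in> borel_measurable (lebesgue_on {0<..<T})"
      using assms measurable_restrict_space1[OF deriv_step_measurable[of t n], of "{0<..<T}"] by measurable
    show "AE s in lebesgue_on {0<..<T}. norm (a s * (deriv smooth_step ((s - t) * n) * n)) \<le> norm (a s * (C * n))"
      using C by (intro always_eventually allI) (auto simp: abs_mult intro!: mult_mono)
  qed
qed

lemma step_delta:
  fixes a :: "real \<Rightarrow> real"
  assumes a: "integrable (lebesgue_on {0<..<T}) a" and c: "isCont a t" and t: "0 < t" "t < T"
  shows "(\<lambda>n. integral\<^sup>L (lebesgue_on {0<..<T}) (\<lambda>s. a s * (deriv smooth_step ((s - t) * real n) * real n)))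
    \<longlonglongrightarrow> a t"
proof -
  obtain C where C: "0 < C" "\<And>x. \<bar>deriv smooth_step x\<bar> \<le> C" using deriv_smooth_step_bounded by blast
  show ?thesis
  proof (rule LIMSEQ_I)
    fix r :: real assume r: "0 < r"
    define e where "e = r / (2 * C)"
    have e: "0 < e" using r C by (simp add: e_def)
    obtain d where d: "0 < d" "\<And>s. \<bar>s - t\<bar> < d \<Longrightarrow> \<bar>a s - a t\<bar> < e"
      using c e unfolding isCont_def LIM_def by (metis (no_types, opaque_lifting) abs_zero cancel_comm_monoid_add_class.diff_cancel dist_real_def)
    define m where "m = min d (T - t)"
    have m: "0 < m" using d t by (simp add: m_def)
    obtain N where N: "inverse (real (Suc N)) < m" using reals_Archimedean[OF m] by auto
    show "\<exists>no. \<forall>n\<ge>no. norm (integral\<^sup>L (lebesgue_on {0<..<T})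
         (\<lambda>s. a s * (deriv smooth_step ((s - t) * real n) * real n)) - a t) < r"
    proof (intro exI allI impI)
      fix n assume n: "Suc N \<le> n"
      have np: "0 < real n" using n by simp
      have "1 / real n \<le> inverse (real (Suc N))" using n by (simp add: field_simps)
      then have n1: "1 / real n < m" using N by simp
      let ?h = "\<lambda>s. deriv smooth_step ((s - t) * real n) * real n"
      have nT: "t + 1 / real n < T" using n1 by (simp add: m_def)
      have hi: "integrable (lebesgue_on {0<..<T}) ?h" and h1: "integral\<^sup>L (lebesgue_on {0<..<T}) ?h = 1"
        using integral_deriv_step[OF np nT t(1)] by auto
      have "integral\<^sup>L (lebesgue_on {0<..<T}) (\<lambda>s. a s * ?h s) - a t =
          integral\<^sup>L (lebesgue_on {0<..<T}) (\<lambda>s. a s * ?h s) - integral\<^sup>L (lebesgue_on {0<..<T}) (\<lambda>s. a t * ?h s)"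
        using h1 by simp
      also have "\<dots> = integral\<^sup>L (lebesgue_on {0<..<T}) (\<lambda>s. a s * ?h s - a t * ?h s)"
        by (rule Bochner_Integration.integral_diff[symmetric, OF integrable_deriv_step_mult[OF a] integrable_mult_right[OF hi]])
      finally have eq: "integral\<^sup>L (lebesgue_on {0<..<T}) (\<lambda>s. a s * ?h s) - a t =
          integral\<^sup>L (lebesgue_on {0<..<T}) (\<lambda>s. a s * ?h s - a t * ?h s)" .
      have ii: "integrable (lebesgue_on {0<..<T}) (\<lambda>s. indicator {t..t + 1 / real n} s * (e * (C * real n)))"
      proof (rule integrable_mult_left)
        have "{t..t + 1 / real n} \<subseteq> {0<..<T}" using t nT by auto
        then have "{0<..<T} \<inter> {t..t + 1 / real n} = {t..t + 1 / real n}" by blast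
        then show "integrable (lebesgue_on {0<..<T}) (indicat_real {t..t + 1 / real n})"
          by (simp add: integrable_restrict_space flip: indicator_inter_arith)
      qed
      have "\<bar>integral\<^sup>L (lebesgue_on {0<..<T}) (\<lambda>s. a s * ?h s - a t * ?h s)\<bar> \<le>
          integral\<^sup>L (lebesgue_on {0<..<T}) (\<lambda>s. indicator {t..t + 1 / real n} s * (e * (C * real n)))"
      proof (rule integral_abs_bound_integral)
        show "integrable (lebesgue_on {0<..<T}) (\<lambda>s. a s * ?h s - a t * ?h s)"
          by (intro Bochner_Integration.integrable_diff integrable_deriv_step_mult[OF a] integrable_mult_right[OF hi])
        show "integrable (lebesgue_on {0<..<T}) (\<lambda>s. indicator {t..t + 1 / real n} s * (e * (C * real n)))"
          by (rule ii)
        fix s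
        show "\<bar>a s * ?h s - a t * ?h s\<bar> \<le> indicator {t..t + 1 / real n} s * (e * (C * real n))"
        proof (cases "s \<in> {t..t + 1 / real n}")
          case True
          then have "\<bar>s - t\<bar> < d" using n1 by (auto simp: m_def)
          from d(2)[OF this] have "\<bar>a s - a t\<bar> \<le> e" by simp
          then have "\<bar>a s - a t\<bar> * (\<bar>deriv smooth_step ((s - t) * real n)\<bar> * real n) \<le> e * (C * real n)"
            using C e by (intro mult_mono) auto
          moreover have "\<bar>a s * ?h s - a t * ?h s\<bar> = \<bar>a s - a t\<bar> * (\<bar>deriv smooth_step ((s - t) * real n)\<bar> * real n)"
            by (simp add: abs_mult flip: left_diff_distrib)
          ultimately show ?thesis using True by simp
        qed (simp add: deriv_step_support[OF np])
      qed
      also have "\<dots> = integral\<^sup>L (lebesgue_on {t..t + 1 / real n}) (\<lambda>s. e * (C * real n))"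
        by (rule integral_lebesgue_on_subset[symmetric]) (use t nT in auto)
      also have "\<dots> = measure lebesgue {t..t + 1 / real n} * (e * (C * real n))"
        by (simp add: measure_restrict_space)
      also have "\<dots> = e * C" using np by simp
      also have "\<dots> < r" using r C by (simp add: e_def)
      finally show "norm (integral\<^sup>L (lebesgue_on {0<..<T}) (\<lambda>s. a s * ?h s) - a t) < r"
        by (simp add: eq)
    qed
  qed
qed

lemma step_cutoff:
  fixes b :: "real \<Rightarrow> real"
  assumes b: "integrable (lebesgue_on {0<..<T}) b" and t: "0 < t" "t < T"
  shows "integrable (lebesgue_on {0<..<T}) (\<lambda>s. b s * (1 - smooth_step ((s - t) * n)))"
    and "(\<lambda>n. integral\<^sup>L (lebesgue_on {0<..<T}) (\<lambda>s. b s * (1 - smooth_step ((s - t) * real n))))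
    \<longlonglongrightarrow> integral\<^sup>L (lebesgue_on {0<..t}) b"
proof -
  have m: "(\<lambda>s. b s * (1 - smooth_step ((s - t) * n))) \<in> borel_measurable (lebesgue_on {0<..<T})" for n
    using b measurable_restrict_space1[OF step_measurable[of t n], of "{0<..<T}"] by measurable
  have bd: "norm (b s * (1 - smooth_step ((s - t) * n))) \<le> norm (b s)" for s n
    using smooth_step_bounds[of "(s - t) * n"] by (auto simp: abs_mult intro: mult_left_le)
  show "integrable (lebesgue_on {0<..<T}) (\<lambda>s. b s * (1 - smooth_step ((s - t) * n)))"
    by (rule Bochner_Integration.integrable_bound[OF b m]) (auto simp: bd simp del: real_norm_def)
  have "(\<lambda>n. integral\<^sup>L (lebesgue_on {0<..<T}) (\<lambda>s. b s * (1 - smooth_step ((s - t) * real n))))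
    \<longlonglongrightarrow> integral\<^sup>L (lebesgue_on {0<..<T}) (\<lambda>s. indicator {0<..t} s * b s)"
  proof (rule integral_dominated_convergence[where w="\<lambda>s. norm (b s)"])
    show "(\<lambda>s. indicator {0<..t} s * b s) \<in> borel_measurable (lebesgue_on {0<..<T})"
      using b t by (intro borel_measurable_times borel_measurable_indicator)
        (auto simp: sets_restrict_space intro!: image_eqI[of _ _ "{0<..t}"])
    show "AE s in lebesgue_on {0<..<T}. (\<lambda>n. b s * (1 - smooth_step ((s - t) * real n))) \<longlonglongrightarrow> indicator {0<..t} s * b s"
    proof (rule AE_I2)
      fix s assume "s \<in> space (lebesgue_on {0<..<T})"
      then have s: "0 < s" "s < T" by auto
      show "(\<lambda>n. b s * (1 - smooth_step ((s - t) * real n))) \<longlonglongrightarrow> indicator {0<..t} s * b s"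
      proof (cases "s \<le> t")
        case True
        then have "smooth_step ((s - t) * real n) = 0" for n
          by (intro smooth_step_0) (simp add: mult_nonpos_nonneg)
        then show ?thesis using True s by simp
      next
        case False
        obtain N where N: "1 / (s - t) \<le> real N" using real_arch_simple by blast
        have "smooth_step ((s - t) * real n) = 1" if "N \<le> n" for n
        proof (rule smooth_step_1)
          have "1 / (s - t) \<le> real n" using N that by linarith
          then show "1 \<le> (s - t) * real n" using False by (simp add: field_simps)
        qed
        then have "\<forall>\<^sub>F n in sequentially. 0 = b s * (1 - smooth_step ((s - t) * real n))"
          by (auto simp: eventually_sequentially intro!: exI[of _ N])
        then show ?thesis using False by (auto intro: Lim_transform_eventually[OF tendsto_const])
      qed
    qed
  qed (use b m bd in \<open>auto simp del: real_norm_def\<close>)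
  moreover have "integral\<^sup>L (lebesgue_on {0<..<T}) (\<lambda>s. indicator {0<..t} s * b s) = integral\<^sup>L (lebesgue_on {0<..t}) b"
    using t by (subst integral_lebesgue_on_subset[of "{0<..t}" "{0<..<T}"]) auto
  ultimately show "(\<lambda>n. integral\<^sup>L (lebesgue_on {0<..<T}) (\<lambda>s. b s * (1 - smooth_step ((s - t) * real n))))
    \<longlonglongrightarrow> integral\<^sup>L (lebesgue_on {0<..t}) b" by simp
qed

lemma weak_ode_initial:
  fixes a b :: "real \<Rightarrow> real"
  assumes a: "integrable (lebesgue_on {0<..<T}) a" and b: "integrable (lebesgue_on {0<..<T}) b"
    and c: "isCont a t" and t: "0 < t" "t < T"
    and weak: "\<And>\<eta> r. Cinf UNIV \<eta> \<Longrightarrow> r < T \<Longrightarrow> (\<And>s. r \<le> s \<Longrightarrow> \<eta> s = 0) \<Longrightarrow>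
      - integral\<^sup>L (lebesgue_on {0<..<T}) (\<lambda>s. a s * deriv \<eta> s)
      + integral\<^sup>L (lebesgue_on {0<..<T}) (\<lambda>s. b s * \<eta> s) = a0 * \<eta> 0"
  shows "a t + integral\<^sup>L (lebesgue_on {0<..t}) b = a0"
proof -
  have "(\<lambda>n. integral\<^sup>L (lebesgue_on {0<..<T}) (\<lambda>s. a s * (deriv smooth_step ((s - t) * real n) * real n))
      + integral\<^sup>L (lebesgue_on {0<..<T}) (\<lambda>s. b s * (1 - smooth_step ((s - t) * real n))))
      \<longlonglongrightarrow> a t + integral\<^sup>L (lebesgue_on {0<..t}) b"
    by (intro tendsto_add step_delta[OF a c t] step_cutoff[OF b t])
  moreover have "\<forall>\<^sub>F n in sequentially. integral\<^sup>L (lebesgue_on {0<..<T}) (\<lambda>s. a s * (deriv smooth_step ((s - t) * real n) * real n))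
      + integral\<^sup>L (lebesgue_on {0<..<T}) (\<lambda>s. b s * (1 - smooth_step ((s - t) * real n))) = a0"
  proof -
    obtain N where N: "inverse (real (Suc N)) < T - t" using reals_Archimedean[of "T - t"] t by auto
    show ?thesis unfolding eventually_sequentially
    proof (intro exI[of _ "Suc N"] allI impI)
      fix n assume n: "Suc N \<le> n"
      have np: "0 < real n" using n by simp
      have "1 / real n \<le> inverse (real (Suc N))" using n by (simp add: field_simps)
      then have n1: "t + 1 / real n < T" using N by simp
      have D: "((\<lambda>s. 1 - smooth_step ((s - t) * real n)) has_real_derivative - (deriv smooth_step ((s - t) * real n) * real n)) (at s)" for s
        using DERIV_diff[OF DERIV_const deriv_step, of 1] by simp
      have C: "Cinf UNIV (\<lambda>s. 1 - smooth_step ((s - t) * real n))"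
        using Cinf_step[of t "real n"] unfolding Cinf_def by (auto intro!: Ck_diff Ck_const)
      have z: "1 - smooth_step ((s - t) * real n) = 0" if "t + 1 / real n \<le> s" for s
        using that np by (simp add: smooth_step_1 field_simps)
      have "smooth_step ((0 - t) * real n) = 0"
        using t np by (intro smooth_step_0) (simp add: mult_nonpos_nonneg)
      then show "integral\<^sup>L (lebesgue_on {0<..<T}) (\<lambda>s. a s * (deriv smooth_step ((s - t) * real n) * real n))
        + integral\<^sup>L (lebesgue_on {0<..<T}) (\<lambda>s. b s * (1 - smooth_step ((s - t) * real n))) = a0"
        using weak[OF C n1 z] by (simp add: DERIV_imp_deriv[OF D])
    qed
  qed
  ultimately have "(\<lambda>n::nat. a0) \<longlonglongrightarrow> a t + integral\<^sup>L (lebesgue_on {0<..t}) b"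
    by (rule Lim_transform_eventually)
  then show ?thesis by (simp add: LIMSEQ_const_iff)
qed

lemma weak_ode_interior:
  fixes a c :: "real \<Rightarrow> real"
  assumes a: "integrable (lebesgue_on {0<..<T}) a" and b: "integrable (lebesgue_on {0<..<T}) b"
    and c: "isCont a t" "isCont a s" and t: "0 < s" "s \<le> t" "t < T"
    and weak: "\<And>\<eta> p q. Cinf UNIV \<eta> \<Longrightarrow> 0 < p \<Longrightarrow> q < T \<Longrightarrow> (\<And>s. s \<notin> {p..q} \<Longrightarrow> \<eta> s = 0) \<Longrightarrow>
      integral\<^sup>L (lebesgue_on {0<..<T}) (\<lambda>s. a s * deriv \<eta> s)
      = - integral\<^sup>L (lebesgue_on {0<..<T}) (\<lambda>s. b s * \<eta> s)"
  shows "a t - a s = integral\<^sup>L (lebesgue_on {s<..t}) b"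
proof -
  let ?A = "\<lambda>r n. integral\<^sup>L (lebesgue_on {0<..<T}) (\<lambda>x. a x * (deriv smooth_step ((x - r) * real n) * real n))"
  let ?B = "\<lambda>r n. integral\<^sup>L (lebesgue_on {0<..<T}) (\<lambda>x. b x * (1 - smooth_step ((x - r) * real n)))"
  have s: "0 < s" "s < T" and t': "0 < t" "t < T" using t by auto
  have "(\<lambda>n. (?A t n - ?A s n) - (?B t n - ?B s n)) \<longlonglongrightarrow> (a t - a s)
     - (integral\<^sup>L (lebesgue_on {0<..t}) b - integral\<^sup>L (lebesgue_on {0<..s}) b)"
    by (intro tendsto_diff step_delta[OF a c(1) t'] step_delta[OF a c(2) s] step_cutoff[OF b t'] step_cutoff[OF b s])
  moreover have "\<forall>\<^sub>F n in sequentially. (?A t n - ?A s n) - (?B t n - ?B s n) = 0"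
  proof -
    obtain N where N: "inverse (real (Suc N)) < T - t" using reals_Archimedean[of "T - t"] t by auto
    show ?thesis unfolding eventually_sequentially
    proof (intro exI[of _ "Suc N"] allI impI)
      fix n assume n: "Suc N \<le> n"
      have np: "0 < real n" using n by simp
      have "1 / real n \<le> inverse (real (Suc N))" using n by (simp add: field_simps)
      then have n1: "t + 1 / real n < T" using N by simp
      let ?e = "\<lambda>x. smooth_step ((x - s) * real n) - smooth_step ((x - t) * real n)"
      have D: "(?e has_real_derivative deriv smooth_step ((x - s) * real n) * real n
          - deriv smooth_step ((x - t) * real n) * real n) (at x)" for x
        by (intro DERIV_diff deriv_step)
      have C: "Cinf UNIV ?e"
        using Cinf_step[of _ "real n"] unfolding Cinf_def by (auto intro!: Ck_diff)
      have z: "?e x = 0" if "x \<notin> {s..t + 1 / real n}" for x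
      proof (cases "x < s")
        case True
        then have "(x - s) * real n \<le> 0" "(x - t) * real n \<le> 0"
          using t by (auto intro: mult_nonpos_nonneg)
        then show ?thesis by (simp add: smooth_step_0)
      next
        case False
        then have "t + 1 / real n < x" "s + 1 / real n < x" using that t by auto
        then have "1 \<le> (x - s) * real n" "1 \<le> (x - t) * real n"
          using np by (auto simp: field_simps)
        then show ?thesis by (simp add: smooth_step_1)
      qed
      have "integral\<^sup>L (lebesgue_on {0<..<T}) (\<lambda>x. a x * deriv ?e x) = ?A s n - ?A t n"
        unfolding DERIV_imp_deriv[OF D] right_diff_distrib
        by (rule Bochner_Integration.integral_diff) (intro integrable_deriv_step_mult a)+
      moreover have "integral\<^sup>L (lebesgue_on {0<..<T}) (\<lambda>x. b x * ?e x) = ?B t n - ?B s n"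
      proof -
        have "b x * ?e x = b x * (1 - smooth_step ((x - t) * real n)) - b x * (1 - smooth_step ((x - s) * real n))" for x
          by (simp add: algebra_simps)
        then show ?thesis
          using Bochner_Integration.integral_diff[OF step_cutoff(1)[OF b t'] step_cutoff(1)[OF b s]] by simp
      qed
      ultimately show "(?A t n - ?A s n) - (?B t n - ?B s n) = 0"
        using weak[OF C s(1) n1 z] by simp
    qed
  qed
  ultimately have "(\<lambda>n::nat. 0) \<longlonglongrightarrow> (a t - a s)
     - (integral\<^sup>L (lebesgue_on {0<..t}) b - integral\<^sup>L (lebesgue_on {0<..s}) b)"
    by (rule Lim_transform_eventually)
  then have "(a t - a s) = integral\<^sup>L (lebesgue_on {0<..t}) b - integral\<^sup>L (lebesgue_on {0<..s}) b"
    by (simp add: LIMSEQ_const_iff)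
  moreover have "integral\<^sup>L (lebesgue_on {0<..t}) b =
     integral\<^sup>L (lebesgue_on {0<..s}) b + integral\<^sup>L (lebesgue_on {s<..t}) b"
    by (rule integral_interval_split[OF integrable_lebesgue_on_subset[OF b]]) (use t in auto)
  ultimately show ?thesis by simp
qed

subsection \<open>Separability of the space of test functions\<close>

lemma countable_uniformly_dense:
  fixes S :: "('a::metric_space \<Rightarrow> 'b::{metric_space, second_countable_topology}) set"
  assumes X: "compact X" and unif: "\<And>f. f \<in> S \<Longrightarrow> uniformly_continuous_on X f"
  obtains D where "countable D" "D \<subseteq> S" "\<And>f e. f \<in> S \<Longrightarrow> 0 < e \<Longrightarrow> \<exists>g\<in>D. \<forall>x\<in>X. dist (f x) (g x) < e"
proof -
  obtain C :: "'b set" where C: "countable C" "\<And>V. open V \<Longrightarrow> V \<noteq> {} \<Longrightarrow> \<exists>c\<in>C. c \<in> V"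
    using countable_dense_exists by metis
  have near: "\<exists>c\<in>C. dist z c < e" if "0 < e" for z e
    using C(2)[of "ball z e"] that by (force simp: dist_commute)
  have "\<exists>xs. set xs \<subseteq> X \<and> X \<subseteq> (\<Union>x\<in>set xs. ball x (1 / Suc n))" for n
  proof -
    obtain k where "finite k" "k \<subseteq> X" "X \<subseteq> (\<Union>x\<in>k. ball x (1 / Suc n))"
      by (rule compactE_image[OF X, of X "\<lambda>x. ball x (1 / Suc n)"]) auto
    then show ?thesis using finite_list[of k] by metis
  qed
  then obtain net where net: "\<And>n. set (net n) \<subseteq> X" "\<And>n. X \<subseteq> (\<Union>x\<in>set (net n). ball x (1 / Suc n))"
    by metis
  define R where "R = (\<lambda>(k, n, cs) f. f \<in> S \<and>
     (\<forall>x\<in>X. \<forall>y\<in>X. dist x y < 1 / Suc n \<longrightarrow> dist (f x) (f y) < 1 / Suc k) \<and>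
     length cs = length (net n) \<and> (\<forall>i<length cs. dist (f (net n ! i)) (cs ! i) < 1 / Suc k))"
  define codes where "codes = {c \<in> (UNIV::nat set) \<times> (UNIV::nat set) \<times> lists C. \<exists>f. R c f}"
  define rep where "rep c = (SOME f. R c f)" for c
  have rep: "R c (rep c)" if "c \<in> codes" for c
  proof -
    have "\<exists>f. R c f" using that by (simp add: codes_def)
    then show ?thesis unfolding rep_def by (rule someI_ex)
  qed
  show thesis
  proof (rule that[of "rep ` codes"])
    have "countable ((UNIV::nat set) \<times> (UNIV::nat set) \<times> lists C)"
      using C(1) by (intro countable_SIGMA countable_lists) auto
    then have "countable codes" by (rule countable_subset[rotated]) (auto simp: codes_def)
    then show "countable (rep ` codes)" by simp
    show "rep ` codes \<subseteq> S" using rep by (fastforce simp: R_def)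
    fix f and e :: real assume f: "f \<in> S" and e: "0 < e"
    have "0 < e / 4" using e by simp
    then obtain k where k: "1 / Suc k < e / 4" by (rule nat_approx_posE)
    have kp: "0 < 1 / real (Suc k)" by simp
    obtain d where d: "0 < d" "\<And>x y. x \<in> X \<Longrightarrow> y \<in> X \<Longrightarrow> dist x y < d \<Longrightarrow> dist (f x) (f y) < 1 / Suc k"
      using unif[OF f, unfolded uniformly_continuous_on_def, rule_format, OF kp] by blast
    obtain n where n: "1 / Suc n < d" using d(1) by (rule nat_approx_posE)
    obtain ch where ch: "\<And>z. ch z \<in> C \<and> dist z (ch z) < 1 / Suc k"
      using near[OF kp] by metis
    define cs where "cs = map (\<lambda>x. ch (f x)) (net n)"
    have "R (k, n, cs) f"
      using f d(2) n ch by (auto simp: R_def cs_def)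
    moreover have "cs \<in> lists C" using ch by (auto simp: cs_def)
    ultimately have c: "(k, n, cs) \<in> codes" by (auto simp: codes_def)
    define g where "g = rep (k, n, cs)"
    have Rg: "R (k, n, cs) g" using rep[OF c] by (simp add: g_def)
    have "dist (f x) (g x) < e" if x: "x \<in> X" for x
    proof -
      obtain z where z: "z \<in> set (net n)" "dist z x < 1 / Suc n"
        using net(2)[of n] x by auto
      then obtain i where i: "i < length (net n)" "net n ! i = z" by (metis in_set_conv_nth)
      have zX: "z \<in> X" using z net(1) by auto
      have 1: "dist (f z) (f x) < 1 / Suc k" using d(2)[OF zX x] z(2) n by linarith
      have 2: "dist (g z) (g x) < 1 / Suc k" using Rg zX x z(2) by (auto simp: R_def)
      have 3: "dist (f z) (cs ! i) < 1 / Suc k" using i ch[of "f z"] by (simp add: cs_def)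
      have 4: "dist (g z) (cs ! i) < 1 / Suc k" using i Rg by (auto simp: R_def)
      show ?thesis
        using dist_triangle[of "f x" "g x" "cs ! i"] dist_triangle[of "f x" "cs ! i" "f z"]
          dist_triangle[of "g x" "cs ! i" "g z"] 1 2 3 4 k
        by (simp add: dist_commute)
    qed
    then show "\<exists>g\<in>rep ` codes. \<forall>x\<in>X. dist (f x) (g x) < e"
      using c by (auto simp: g_def)
  qed
qed

lemma test_fun_countable_dense:
  fixes \<Omega> :: "'a::euclidean_space set"
  assumes "bounded \<Omega>"
  obtains D where "countable D" "\<And>\<psi>. \<psi> \<in> D \<Longrightarrow> test_fun \<Omega> \<psi>"
    "\<And>\<psi> e. test_fun \<Omega> \<psi> \<Longrightarrow> 0 < e \<Longrightarrow>
      \<exists>d\<in>D. \<forall>x\<in>\<Omega>. \<bar>\<psi> x - d x\<bar> < e \<and> norm (grad \<psi> x - grad d x) < e"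
proof -
  let ?j = "\<lambda>\<psi> x. (\<psi> x :: real, grad \<psi> x :: 'a)"
  let ?S = "?j ` {\<psi>. test_fun \<Omega> \<psi>}"
  have X: "compact (closure \<Omega>)" using assms by (simp add: compact_closure)
  have "uniformly_continuous_on (closure \<Omega>) f" if f: "f \<in> ?S" for f
  proof -
    obtain \<psi> where \<psi>: "f = ?j \<psi>" "test_fun \<Omega> \<psi>" using f by blast
    have "continuous_on UNIV f"
      unfolding \<psi>(1) by (intro continuous_on_Pair test_funD(2,3)[OF \<psi>(2)])
    then show ?thesis by (intro compact_uniformly_continuous X) (rule continuous_on_subset, auto)
  qed
  from countable_uniformly_dense[OF X this] obtain E where
    E: "countable E" "E \<subseteq> ?S" "\<And>f e. f \<in> ?S \<Longrightarrow> 0 < e \<Longrightarrow> \<exists>g\<in>E. \<forall>x\<in>closure \<Omega>. dist (f x) (g x) < e"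
    by blast
  show thesis
  proof (rule that[of "(\<lambda>g. fst \<circ> g) ` E"])
    show "countable ((\<lambda>g. fst \<circ> g) ` E)" using E(1) by simp
    show "test_fun \<Omega> \<psi>" if "\<psi> \<in> (\<lambda>g. fst \<circ> g) ` E" for \<psi>
      using that E(2) by (auto simp: comp_def)
    fix \<psi> :: "'a \<Rightarrow> real" and e :: real assume "test_fun \<Omega> \<psi>" "0 < e"
    then obtain g where g: "g \<in> E" "\<And>x. x \<in> closure \<Omega> \<Longrightarrow> dist (?j \<psi> x) (g x) < e"
      using E(3)[of "?j \<psi>" e] by blast
    then obtain d where d: "g = ?j d" using E(2) by auto
    have "\<bar>\<psi> x - d x\<bar> < e \<and> norm (grad \<psi> x - grad d x) < e" if "x \<in> \<Omega>" for x
    proof -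
      have "dist (?j \<psi> x) (?j d x) < e" using g(2)[of x] that closure_subset[of \<Omega>] by (auto simp: d)
      then show ?thesis
        using dist_fst_le[of "?j \<psi> x" "?j d x"] dist_snd_le[of "?j \<psi> x" "?j d x"]
        by (simp add: dist_norm)
    qed
    moreover have "fst \<circ> g = d" by (auto simp: d)
    ultimately show "\<exists>d\<in>(\<lambda>g. fst \<circ> g) ` E. \<forall>x\<in>\<Omega>. \<bar>\<psi> x - d x\<bar> < e \<and> norm (grad \<psi> x - grad d x) < e"
      using g(1) by blast
  qed
qed

subsection \<open>The weak formulation at almost every time\<close>

lemma continuous_measurable_lebesgue_on:
  fixes f :: "'a::euclidean_space \<Rightarrow> 'b::euclidean_space"
  shows "continuous_on UNIV f \<Longrightarrow> f \<in> borel_measurable (lebesgue_on S)"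
  by (intro measurable_restrict_space1 measurable_completion) (simp add: borel_measurable_continuous_onI)

lemma finite_measure_lebesgue_on_bounded:
  fixes S :: "'a::euclidean_space set"
  assumes "bounded S" "S \<in> sets borel"
  shows "finite_measure (lebesgue_on S)"
proof (rule finite_measureI)
  have "emeasure (lebesgue_on S) (space (lebesgue_on S)) = emeasure lborel S"
    using assms(2) by (simp add: emeasure_restrict_space)
  also have "\<dots> < \<infinity>" using emeasure_bounded_finite[OF assms(1)] .
  finally show "emeasure (lebesgue_on S) (space (lebesgue_on S)) \<noteq> \<infinity>" by simp
qed

lemma integrable_bounded_lebesgue_on:
  fixes f :: "'a::euclidean_space \<Rightarrow> real"
  assumes "bounded S" "S \<in> sets borel" "f \<in> borel_measurable (lebesgue_on S)"
    "AE x in lebesgue_on S. \<bar>f x\<bar> \<le> K"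
  shows "integrable (lebesgue_on S) f"
  using finite_measure.integrable_const_bound[OF finite_measure_lebesgue_on_bounded[OF assms(1,2)], of f K] assms(3,4)
  by simp

lemma abs_le_one_plus_square: "\<bar>r\<bar> \<le> 1 + r\<^sup>2" for r :: real
proof -
  have "0 \<le> (\<bar>r\<bar> - 1)\<^sup>2" by simp
  also have "\<dots> = r\<^sup>2 - 2 * \<bar>r\<bar> + 1" by (simp add: power2_diff)
  finally show ?thesis using zero_le_power2[of r] by linarith
qed

lemma borel_tint: "tint T \<in> sets borel"
proof -
  have "tint T = {0<..} \<inter> {t. ereal t < T}" by (auto simp: tint_def)
  moreover have "open {t. ereal t < T}"
    by (intro open_Collect_less continuous_intros continuous_on_ereal)
  ultimately show ?thesis by (auto intro!: borel_open)
qed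

lemma tint_lebesgue: "tint T \<in> sets lebesgue"
  using borel_tint[of T] by (simp add: sets_completionI_sets)

lemma interval_subset_tint: "ereal T' < T \<Longrightarrow> {0<..<T'} \<subseteq> tint T"
  by (auto simp: tint_def intro: less_trans[of "ereal _" "ereal T'" T])

locale degenerate_flow =
  fixes \<Omega> :: "'a::euclidean_space set" and u0 :: "'a \<Rightarrow> real" and T :: ereal
    and u :: "'a \<Rightarrow> real \<Rightarrow> real" and Du :: "'a \<Rightarrow> real \<Rightarrow> 'a" and ut :: "'a \<Rightarrow> real \<Rightarrow> real"
  assumes open_dom: "open \<Omega>" and bounded_dom: "bounded \<Omega>"
    and u0: "ess_bdd \<Omega> u0"
    and sol: "weak_solution \<Omega> u0 T u Du"
    and locpos: "locally_positive \<Omega> T u"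
    and rep: "L1_continuous_rep \<Omega> T u"
    and ut_meas: "(\<lambda>p. ut (fst p) (snd p)) \<in> borel_measurable (lebesgue_on (\<Omega> \<times> tint T))"
    and ut_L2: "\<And>T'. 0 < T' \<Longrightarrow> ereal T' < T \<Longrightarrow>
      integrable (lebesgue_on (\<Omega> \<times> {0<..<T'})) (\<lambda>p. (ut (fst p) (snd p))\<^sup>2)"
    and ut_weak: "\<And>\<psi>. test_fun (\<Omega> \<times> tint T) \<psi> \<Longrightarrow>
      integral\<^sup>L (lebesgue_on (\<Omega> \<times> tint T)) (\<lambda>p. u (fst p) (snd p) * dt \<psi> p) =
      - integral\<^sup>L (lebesgue_on (\<Omega> \<times> tint T)) (\<lambda>p. ut (fst p) (snd p) * \<psi> p)"
begin

definition energy :: "real \<Rightarrow> real" where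
  "energy t = integral\<^sup>L (lebesgue_on \<Omega>) (\<lambda>x. (norm (Du x t))\<^sup>2)"

definition mass :: "real \<Rightarrow> real" where
  "mass t = integral\<^sup>L (lebesgue_on \<Omega>) (\<lambda>x. u x t)"

lemma dom_borel [simp]: "\<Omega> \<in> sets borel" using open_dom by auto

lemma dom_lebesgue [simp]: "\<Omega> \<in> sets lebesgue" by (simp add: sets_completionI_sets)

lemma finite_dom: "finite_measure (lebesgue_on \<Omega>)"
  by (rule finite_measure_lebesgue_on_bounded[OF bounded_dom dom_borel])

lemma cyl_borel: "\<Omega> \<times> {0<..<T'::real} \<in> sets borel" "\<Omega> \<times> tint T \<in> sets borel"
  by (auto intro!: borel_Times borel_tint)

lemma cyl_lebesgue: "\<Omega> \<times> {0<..<T'::real} \<in> sets lebesgue" "\<Omega> \<times> tint T \<in> sets lebesgue"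
  using cyl_borel by (auto intro: sets_completionI_sets)

lemma cyl_bounded: "bounded (\<Omega> \<times> {0<..<T'::real})"
  by (intro bounded_Times bounded_dom) auto

lemma cyl_subset: "ereal T' < T \<Longrightarrow> \<Omega> \<times> {0<..<T'} \<subseteq> \<Omega> \<times> tint T"
  using interval_subset_tint by fastforce

lemma measurable_cyl:
  assumes "f \<in> borel_measurable (lebesgue_on (\<Omega> \<times> tint T))" "ereal T' < T"
  shows "f \<in> borel_measurable (lebesgue_on (\<Omega> \<times> {0<..<T'}))"
  by (rule measurable_restrict_mono[OF assms(1) cyl_subset[OF assms(2)]])

lemma u_meas: "ereal T' < T \<Longrightarrow> (\<lambda>p. u (fst p) (snd p)) \<in> borel_measurable (lebesgue_on (\<Omega> \<times> {0<..<T'}))"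
  and Du_meas: "ereal T' < T \<Longrightarrow> (\<lambda>p. Du (fst p) (snd p)) \<in> borel_measurable (lebesgue_on (\<Omega> \<times> {0<..<T'}))"
  using sol by (auto simp: weak_solution_def intro: measurable_cyl)

lemma ut_meas': "ereal T' < T \<Longrightarrow> (\<lambda>p. ut (fst p) (snd p)) \<in> borel_measurable (lebesgue_on (\<Omega> \<times> {0<..<T'}))"
  using ut_meas by (rule measurable_cyl)

lemma Du_L2: "0 < T' \<Longrightarrow> ereal T' < T \<Longrightarrow>
    integrable (lebesgue_on (\<Omega> \<times> {0<..<T'})) (\<lambda>p. (norm (Du (fst p) (snd p)))\<^sup>2)"
  using sol by (auto simp: weak_solution_def)

lemma u_bounded_cyl:
  assumes "0 < T'" "ereal T' < T"
  obtains K where "0 < K" "AE p in lebesgue_on (\<Omega> \<times> {0<..<T'}). 0 \<le> u (fst p) (snd p) \<and> u (fst p) (snd p) \<le> K"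
proof -
  have 0: "AE p in lebesgue_on (\<Omega> \<times> tint T). 0 \<le> u (fst p) (snd p)"
    using sol by (simp add: weak_solution_def)
  have 1: "AE p in lebesgue_on (\<Omega> \<times> {0<..<T'}). 0 \<le> u (fst p) (snd p)"
    by (rule AE_lebesgue_on_subset[OF 0 cyl_subset[OF assms(2)] cyl_lebesgue])
  obtain C where "AE p in lebesgue_on (\<Omega> \<times> {0<..<T'}). \<bar>u (fst p) (snd p)\<bar> \<le> C"
    using sol assms by (auto simp: weak_solution_def)
  with 1 have "AE p in lebesgue_on (\<Omega> \<times> {0<..<T'}). 0 \<le> u (fst p) (snd p) \<and> u (fst p) (snd p) \<le> max C 1"
    by eventually_elim auto
  then show thesis by (rule that[rotated]) auto
qed

lemma u_integrable_cyl:
  assumes "0 < T'" "ereal T' < T" "g \<in> borel_measurable (lebesgue_on (\<Omega> \<times> {0<..<T'}))" "\<And>p. \<bar>g p\<bar> \<le> B"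
  shows "integrable (lebesgue_on (\<Omega> \<times> {0<..<T'})) (\<lambda>p. u (fst p) (snd p) * g p)"
proof -
  obtain K where K: "0 < K" "AE p in lebesgue_on (\<Omega> \<times> {0<..<T'}). 0 \<le> u (fst p) (snd p) \<and> u (fst p) (snd p) \<le> K"
    using u_bounded_cyl[OF assms(1,2)] by blast
  show ?thesis
  proof (rule integrable_bounded_lebesgue_on[OF cyl_bounded cyl_borel(1)])
    show "(\<lambda>p. u (fst p) (snd p) * g p) \<in> borel_measurable (lebesgue_on (\<Omega> \<times> {0<..<T'}))"
      using u_meas[OF assms(2)] assms(3) by (rule borel_measurable_times)
    show "AE p in lebesgue_on (\<Omega> \<times> {0<..<T'}). \<bar>u (fst p) (snd p) * g p\<bar> \<le> K * B"
      using K(2)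
    proof eventually_elim
      case (elim p)
      then have "\<bar>u (fst p) (snd p)\<bar> * \<bar>g p\<bar> \<le> K * B"
        using assms(4)[of p] K(1) by (intro mult_mono) auto
      then show ?case by (simp add: abs_mult)
    qed
  qed
qed

lemma mult_bounded_integrable:
  fixes f g :: "'b::euclidean_space \<Rightarrow> real"
  assumes "integrable (lebesgue_on S) f" "g \<in> borel_measurable (lebesgue_on S)" "\<And>p. \<bar>g p\<bar> \<le> B"
  shows "integrable (lebesgue_on S) (\<lambda>p. f p * g p)"
proof (rule Bochner_Integration.integrable_bound)
  show "integrable (lebesgue_on S) (\<lambda>p. f p * B)" using assms(1) by simp
  show "(\<lambda>p. f p * g p) \<in> borel_measurable (lebesgue_on S)"
    using assms(1,2) by (intro borel_measurable_times) auto
  have "\<bar>f p * g p\<bar> \<le> \<bar>f p * B\<bar>" for p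
    using assms(3)[of p] unfolding abs_mult by (intro mult_left_mono) auto
  then show "AE p in lebesgue_on S. norm (f p * g p) \<le> norm (f p * B)" by simp
qed

lemma ut_integrable_cyl:
  assumes "0 < T'" "ereal T' < T"
  shows "integrable (lebesgue_on (\<Omega> \<times> {0<..<T'})) (\<lambda>p. ut (fst p) (snd p))"
proof (rule Bochner_Integration.integrable_bound[OF _ ut_meas'[OF assms(2)]])
  interpret finite_measure "lebesgue_on (\<Omega> \<times> {0<..<T'})"
    by (rule finite_measure_lebesgue_on_bounded[OF cyl_bounded cyl_borel(1)])
  show "integrable (lebesgue_on (\<Omega> \<times> {0<..<T'})) (\<lambda>p. 1 + (ut (fst p) (snd p))\<^sup>2)"
    using ut_L2[OF assms] by (intro Bochner_Integration.integrable_add) auto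
  have "norm (ut (fst p) (snd p)) \<le> norm (1 + (ut (fst p) (snd p))\<^sup>2)" for p
    using abs_le_one_plus_square[of "ut (fst p) (snd p)"] by simp
  then show "AE p in lebesgue_on (\<Omega> \<times> {0<..<T'}). norm (ut (fst p) (snd p)) \<le> norm (1 + (ut (fst p) (snd p))\<^sup>2)"
    by blast
qed

lemma uDu_integrable_cyl:
  assumes "0 < T'" "ereal T' < T" "test_fun \<Omega> \<psi>"
  shows "integrable (lebesgue_on (\<Omega> \<times> {0<..<T'}))
    (\<lambda>p. \<psi> (fst p) * (norm (Du (fst p) (snd p)))\<^sup>2 + u (fst p) (snd p) * (Du (fst p) (snd p) \<bullet> grad \<psi> (fst p)))"
proof -
  let ?M = "lebesgue_on (\<Omega> \<times> {0<..<T'})"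
  interpret finite_measure ?M
    by (rule finite_measure_lebesgue_on_bounded[OF cyl_bounded cyl_borel(1)])
  obtain B where B: "0 < B" "\<And>x. \<bar>\<psi> x\<bar> \<le> B" "\<And>x. norm (grad \<psi> x) \<le> B"
    using test_fun_bounded[OF assms(3)] by blast
  obtain K where K: "0 < K" "AE p in ?M. 0 \<le> u (fst p) (snd p) \<and> u (fst p) (snd p) \<le> K"
    using u_bounded_cyl[OF assms(1,2)] by blast
  have c1: "continuous_on UNIV (\<lambda>p::'a \<times> real. \<psi> (fst p))" "continuous_on UNIV (\<lambda>p::'a \<times> real. grad \<psi> (fst p))"
    by (auto intro!: continuous_on_compose2[OF test_funD(2)[OF assms(3)]] continuous_on_compose2[OF test_funD(3)[OF assms(3)]] continuous_intros)
  have m[measurable]: "(\<lambda>p. \<psi> (fst p)) \<in> borel_measurable ?M" "(\<lambda>p. grad \<psi> (fst p)) \<in> borel_measurable ?M"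
    "(\<lambda>p. u (fst p) (snd p)) \<in> borel_measurable ?M" "(\<lambda>p. Du (fst p) (snd p)) \<in> borel_measurable ?M"
    using c1[THEN continuous_measurable_lebesgue_on] u_meas[OF assms(2)] Du_meas[OF assms(2)] by auto
  have "integrable ?M (\<lambda>p. (norm (Du (fst p) (snd p)))\<^sup>2 * \<psi> (fst p))"
    by (rule mult_bounded_integrable[OF Du_L2[OF assms(1,2)] m(1) B(2)])
  moreover have "integrable ?M (\<lambda>p. u (fst p) (snd p) * (Du (fst p) (snd p) \<bullet> grad \<psi> (fst p)))"
  proof (rule Bochner_Integration.integrable_bound)
    show "integrable ?M (\<lambda>p. K * B * (1 + (norm (Du (fst p) (snd p)))\<^sup>2))"
      using Du_L2[OF assms(1,2)] by (intro integrable_mult_right Bochner_Integration.integrable_add) auto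
    show "(\<lambda>p. u (fst p) (snd p) * (Du (fst p) (snd p) \<bullet> grad \<psi> (fst p))) \<in> borel_measurable ?M"
      by measurable
    show "AE p in ?M. norm (u (fst p) (snd p) * (Du (fst p) (snd p) \<bullet> grad \<psi> (fst p))) \<le>
        norm (K * B * (1 + (norm (Du (fst p) (snd p)))\<^sup>2))"
      using K(2)
    proof eventually_elim
      case (elim p)
      let ?n = "norm (Du (fst p) (snd p))"
      have "\<bar>Du (fst p) (snd p) \<bullet> grad \<psi> (fst p)\<bar> \<le> ?n * norm (grad \<psi> (fst p))"
        by (rule Cauchy_Schwarz_ineq2)
      also have "\<dots> \<le> ?n * B" by (intro mult_left_mono B) auto
      also have "?n \<le> 1 + ?n\<^sup>2"
        using abs_le_one_plus_square[of ?n] by simp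
      finally have "\<bar>Du (fst p) (snd p) \<bullet> grad \<psi> (fst p)\<bar> \<le> (1 + ?n\<^sup>2) * B" using B(1) by simp
      then have "\<bar>u (fst p) (snd p)\<bar> * \<bar>Du (fst p) (snd p) \<bullet> grad \<psi> (fst p)\<bar> \<le> K * ((1 + ?n\<^sup>2) * B)"
        using elim K by (intro mult_mono) auto
      then show ?case using K B by (simp add: abs_mult mult_ac)
    qed
  qed
  ultimately show ?thesis by (simp add: mult.commute)
qed

lemma integral_cyl_restrict:
  assumes "ereal T' < T" "\<And>x t. T' \<le> t \<Longrightarrow> f (x, t) = 0"
  shows "integral\<^sup>L (lebesgue_on (\<Omega> \<times> tint T)) f = integral\<^sup>L (lebesgue_on (\<Omega> \<times> {0<..<T'})) (f :: _ \<Rightarrow> real)"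
proof -
  have "integral\<^sup>L (lebesgue_on (\<Omega> \<times> {0<..<T'})) f =
    integral\<^sup>L (lebesgue_on (\<Omega> \<times> tint T)) (\<lambda>p. indicator (\<Omega> \<times> {0<..<T'}) p * f p)"
    by (rule integral_lebesgue_on_subset[OF cyl_subset[OF assms(1)] cyl_lebesgue])
  also have "\<dots> = integral\<^sup>L (lebesgue_on (\<Omega> \<times> tint T)) f"
  proof (rule Bochner_Integration.integral_cong[OF refl])
    fix p assume "p \<in> space (lebesgue_on (\<Omega> \<times> tint T))"
    then have "p \<notin> \<Omega> \<times> {0<..<T'} \<Longrightarrow> T' \<le> snd p" by (auto simp: tint_def)
    then show "indicator (\<Omega> \<times> {0<..<T'}) p * f p = f p"
      using assms(2)[of "snd p" "fst p"] by (cases "p \<in> \<Omega> \<times> {0<..<T'}") auto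
  qed
  finally show ?thesis by simp
qed

lemma integral_tint_restrict:
  assumes "ereal T' < T" "\<And>t. T' \<le> t \<Longrightarrow> f t = 0"
  shows "integral\<^sup>L (lebesgue_on (tint T)) f = integral\<^sup>L (lebesgue_on {0<..<T'}) (f :: _ \<Rightarrow> real)"
proof -
  have "integral\<^sup>L (lebesgue_on {0<..<T'}) f = integral\<^sup>L (lebesgue_on (tint T)) (\<lambda>p. indicator {0<..<T'} p * f p)"
    by (rule integral_lebesgue_on_subset[OF interval_subset_tint[OF assms(1)]])
      (simp_all add: tint_lebesgue)
  also have "\<dots> = integral\<^sup>L (lebesgue_on (tint T)) f"
  proof (rule Bochner_Integration.integral_cong[OF refl])
    fix t assume "t \<in> space (lebesgue_on (tint T))"
    then have "t \<notin> {0<..<T'} \<Longrightarrow> T' \<le> t" by (auto simp: tint_def)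
    then show "indicator {0<..<T'} t * f t = f t"
      using assms(2)[of t] by (cases "t \<in> {0<..<T'}") auto
  qed
  finally show ?thesis by simp
qed

lemma energy_integrable:
  assumes "0 < T'" "ereal T' < T"
  shows "integrable (lebesgue_on {0<..<T'}) energy"
  using lebesgue_on_Fubini(2)[OF dom_borel _ Du_L2[OF assms]] by (simp add: energy_def[abs_def])

lemma energy_nonneg: "0 \<le> energy t" by (simp add: energy_def)

definition pairing :: "('a \<Rightarrow> real) \<Rightarrow> real \<Rightarrow> real" where
  "pairing \<psi> t = integral\<^sup>L (lebesgue_on \<Omega>) (\<lambda>x. u x t * \<psi> x)"

definition flux :: "('a \<Rightarrow> real) \<Rightarrow> real \<Rightarrow> real" where
  "flux \<psi> t = integral\<^sup>L (lebesgue_on \<Omega>) (\<lambda>x. \<psi> x * (norm (Du x t))\<^sup>2 + u x t * (Du x t \<bullet> grad \<psi> x))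
     - pairing \<psi> t * energy t"

definition ut_pairing :: "('a \<Rightarrow> real) \<Rightarrow> real \<Rightarrow> real" where
  "ut_pairing w t = integral\<^sup>L (lebesgue_on \<Omega>) (\<lambda>x. ut x t * w x)"

lemma u_integrable: "t \<in> tint T \<Longrightarrow> integrable (lebesgue_on \<Omega>) (\<lambda>x. u x t)"
  using rep by (simp add: L1_continuous_rep_def)

lemma u_L1_cont: "s \<in> tint T \<Longrightarrow> ((\<lambda>t. integral\<^sup>L (lebesgue_on \<Omega>) (\<lambda>x. \<bar>u x t - u x s\<bar>)) \<longlongrightarrow> 0) (at s)"
  using rep by (simp add: L1_continuous_rep_def)

lemma eventually_tint: "s \<in> tint T \<Longrightarrow> eventually (\<lambda>t. t \<in> tint T) (at s)"
proof -
  assume "s \<in> tint T"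
  moreover have "tint T = {0<..} \<inter> {t. ereal t < T}" by (auto simp: tint_def)
  moreover have "open {t. ereal t < T}"
    by (intro open_Collect_less continuous_intros continuous_on_ereal)
  ultimately have "open (tint T)" by (metis open_Int open_greaterThan)
  then show ?thesis using \<open>s \<in> tint T\<close> by (rule eventually_at_in_open')
qed

lemma isCont_pairing:
  assumes "w \<in> borel_measurable (lebesgue_on \<Omega>)" "\<And>x. \<bar>w x\<bar> \<le> B" "s \<in> tint T"
  shows "isCont (pairing w) s"
proof -
  have B: "0 \<le> B" using assms(2)[of undefined] by linarith
  have "((\<lambda>t. pairing w t - pairing w s) \<longlongrightarrow> 0) (at s)"
  proof (rule Lim_null_comparison)
    show "((\<lambda>t. B * integral\<^sup>L (lebesgue_on \<Omega>) (\<lambda>x. \<bar>u x t - u x s\<bar>)) \<longlongrightarrow> 0) (at s)"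
      using tendsto_mult_right_zero[OF u_L1_cont[OF assms(3)]] .
    show "\<forall>\<^sub>F t in at s. norm (pairing w t - pairing w s) \<le> B * integral\<^sup>L (lebesgue_on \<Omega>) (\<lambda>x. \<bar>u x t - u x s\<bar>)"
      using eventually_tint[OF assms(3)]
    proof eventually_elim
      case (elim t)
      note i = u_integrable[OF elim] u_integrable[OF assms(3)]
      note iw = i[THEN mult_bounded_integrable, OF assms(1,2)]
      have "pairing w t - pairing w s = integral\<^sup>L (lebesgue_on \<Omega>) (\<lambda>x. u x t * w x - u x s * w x)"
        unfolding pairing_def by (rule Bochner_Integration.integral_diff[symmetric, OF iw])
      also have "\<bar>\<dots>\<bar> \<le> integral\<^sup>L (lebesgue_on \<Omega>) (\<lambda>x. B * \<bar>u x t - u x s\<bar>)"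
      proof (rule integral_abs_bound_integral)
        show "integrable (lebesgue_on \<Omega>) (\<lambda>x. u x t * w x - u x s * w x)"
          using iw by (rule Bochner_Integration.integrable_diff)
        show "integrable (lebesgue_on \<Omega>) (\<lambda>x. B * \<bar>u x t - u x s\<bar>)" using i by auto
        show "\<bar>u x t * w x - u x s * w x\<bar> \<le> B * \<bar>u x t - u x s\<bar>" for x
        proof -
          have "u x t * w x - u x s * w x = w x * (u x t - u x s)" by (simp add: algebra_simps)
          then show ?thesis using assms(2)[of x] by (simp only: abs_mult mult_right_mono abs_ge_zero)
        qed
      qed
      also have "\<dots> = B * integral\<^sup>L (lebesgue_on \<Omega>) (\<lambda>x. \<bar>u x t - u x s\<bar>)" by simp
      finally show ?case by simp
    qed
  qed
  then show ?thesis unfolding isCont_def by (simp add: LIM_zero_iff)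
qed

lemma tensor_bounded_integrable:
  fixes T' :: real and h :: "real \<Rightarrow> real" and f :: "'a \<times> real \<Rightarrow> real"
  assumes f: "integrable (lebesgue_on (\<Omega> \<times> {0<..<T'})) f" and h: "continuous_on UNIV h" "\<And>t. T' \<le> t \<Longrightarrow> h t = 0"
  shows "integrable (lebesgue_on (\<Omega> \<times> {0<..<T'})) (\<lambda>p. f p * h (snd p))"
    and "integral\<^sup>L (lebesgue_on (\<Omega> \<times> {0<..<T'})) (\<lambda>p. f p * h (snd p)) =
      integral\<^sup>L (lebesgue_on {0<..<T'}) (\<lambda>t. integral\<^sup>L (lebesgue_on \<Omega>) (\<lambda>x. f (x, t)) * h t)"
proof -
  have "bounded (h ` {0..T'})"
    using h(1) by (intro compact_imp_bounded compact_continuous_image) (auto intro: continuous_on_subset)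
  then obtain B where B: "\<And>t. t \<in> {0..T'} \<Longrightarrow> \<bar>h t\<bar> \<le> B"
    unfolding bounded_iff by (metis image_eqI real_norm_def)
  let ?M = "lebesgue_on (\<Omega> \<times> {0<..<T'})"
  show i: "integrable ?M (\<lambda>p. f p * h (snd p))"
  proof (rule Bochner_Integration.integrable_bound)
    show "integrable ?M (\<lambda>p. f p * B)" using f by simp
    have "(\<lambda>p. h (snd p)) \<in> borel_measurable ?M"
      by (intro continuous_measurable_lebesgue_on continuous_on_compose2[OF h(1)] continuous_intros) auto
    then show "(\<lambda>p. f p * h (snd p)) \<in> borel_measurable ?M" using f by (intro borel_measurable_times) auto
    show "AE p in ?M. norm (f p * h (snd p)) \<le> norm (f p * B)"
    proof (rule AE_I2)
      fix p assume "p \<in> space ?M"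
      then have "snd p \<in> {0..T'}" by auto
      from B[OF this] show "norm (f p * h (snd p)) \<le> norm (f p * B)"
        unfolding real_norm_def abs_mult by (intro mult_left_mono) auto
    qed
  qed
  show "integral\<^sup>L ?M (\<lambda>p. f p * h (snd p)) =
      integral\<^sup>L (lebesgue_on {0<..<T'}) (\<lambda>t. integral\<^sup>L (lebesgue_on \<Omega>) (\<lambda>x. f (x, t)) * h t)"
    using lebesgue_on_Fubini(3)[OF dom_borel _ i] by simp
qed

lemma u_psi_integrable:
  assumes "0 < T'" "ereal T' < T" "test_fun \<Omega> \<psi>"
  shows "integrable (lebesgue_on (\<Omega> \<times> {0<..<T'})) (\<lambda>p. u (fst p) (snd p) * \<psi> (fst p))"
    and "integrable (lebesgue_on (\<Omega> \<times> {0<..<T'})) (\<lambda>p. ut (fst p) (snd p) * \<psi> (fst p))"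
proof -
  obtain B where B: "0 < B" "\<And>x. \<bar>\<psi> x\<bar> \<le> B" "\<And>x. norm (grad \<psi> x) \<le> B"
    using test_fun_bounded[OF assms(3)] by blast
  have m: "(\<lambda>p. \<psi> (fst p)) \<in> borel_measurable (lebesgue_on (\<Omega> \<times> {0<..<T'}))"
    by (intro continuous_measurable_lebesgue_on continuous_on_compose2[OF test_funD(2)[OF assms(3)]] continuous_intros) auto
  show "integrable (lebesgue_on (\<Omega> \<times> {0<..<T'})) (\<lambda>p. u (fst p) (snd p) * \<psi> (fst p))"
    by (rule u_integrable_cyl[OF assms(1,2) m B(2)])
  show "integrable (lebesgue_on (\<Omega> \<times> {0<..<T'})) (\<lambda>p. ut (fst p) (snd p) * \<psi> (fst p))"
    by (rule mult_bounded_integrable[OF ut_integrable_cyl[OF assms(1,2)] m B(2)])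
qed

lemma pairing_integrable:
  assumes "0 < T'" "ereal T' < T" "test_fun \<Omega> \<psi>"
  shows "integrable (lebesgue_on {0<..<T'}) (pairing \<psi>)"
    and "integrable (lebesgue_on {0<..<T'}) (ut_pairing \<psi>)"
  using lebesgue_on_Fubini(2)[OF dom_borel _ u_psi_integrable(1)[OF assms]]
    lebesgue_on_Fubini(2)[OF dom_borel _ u_psi_integrable(2)[OF assms]]
  by (auto simp: pairing_def[abs_def] ut_pairing_def[abs_def])

lemma good_time_bounds:
  assumes "0 < T'" "ereal T' < T"
  obtains K where "0 < K" "AE t in lebesgue_on {0<..<T'}. AE x in lebesgue_on \<Omega>. 0 \<le> u x t \<and> u x t \<le> K"
proof -
  obtain K where K: "0 < K" "AE p in lebesgue_on (\<Omega> \<times> {0<..<T'}). 0 \<le> u (fst p) (snd p) \<and> u (fst p) (snd p) \<le> K"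
    using u_bounded_cyl[OF assms] by blast
  from AE_lebesgue_on_slices[OF dom_borel _ K(2)] K(1) that show thesis by auto
qed

lemma pairing_bounded:
  assumes "AE x in lebesgue_on \<Omega>. 0 \<le> u x t \<and> u x t \<le> K" "t \<in> tint T"
    and w: "w \<in> borel_measurable (lebesgue_on \<Omega>)" "\<And>x. \<bar>w x\<bar> \<le> B" and K: "0 \<le> K"
  shows "\<bar>pairing w t\<bar> \<le> K * B * measure (lebesgue_on \<Omega>) (space (lebesgue_on \<Omega>))"
proof -
  interpret finite_measure "lebesgue_on \<Omega>" by (rule finite_dom)
  have i: "integrable (lebesgue_on \<Omega>) (\<lambda>x. u x t * w x)"
    by (rule mult_bounded_integrable[OF u_integrable[OF assms(2)] w])
  have "\<bar>pairing w t\<bar> \<le> integral\<^sup>L (lebesgue_on \<Omega>) (\<lambda>x. \<bar>u x t * w x\<bar>)"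
    unfolding pairing_def by (rule integral_abs_bound)
  also have "\<dots> \<le> integral\<^sup>L (lebesgue_on \<Omega>) (\<lambda>x. K * B)"
  proof (rule integral_mono_AE)
    show "AE x in lebesgue_on \<Omega>. \<bar>u x t * w x\<bar> \<le> K * B"
      using assms(1)
    proof eventually_elim
      case (elim x)
      then show ?case using w(2)[of x] K unfolding abs_mult by (intro mult_mono) auto
    qed
  qed (use i in auto)
  finally show ?thesis by (simp add: mult_ac)
qed

lemma flux_integrable:
  assumes "0 < T'" "ereal T' < T" "test_fun \<Omega> \<psi>"
  shows "integrable (lebesgue_on {0<..<T'}) (\<lambda>t. pairing \<psi> t * energy t)"
    and "integrable (lebesgue_on {0<..<T'}) (flux \<psi>)"
proof -
  obtain B where B: "0 < B" "\<And>x. \<bar>\<psi> x\<bar> \<le> B" "\<And>x. norm (grad \<psi> x) \<le> B"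
    using test_fun_bounded[OF assms(3)] by blast
  obtain K where K: "0 < K" "AE t in lebesgue_on {0<..<T'}. AE x in lebesgue_on \<Omega>. 0 \<le> u x t \<and> u x t \<le> K"
    using good_time_bounds[OF assms(1,2)] by blast
  have m: "\<psi> \<in> borel_measurable (lebesgue_on \<Omega>)"
    by (rule continuous_measurable_lebesgue_on[OF test_funD(2)[OF assms(3)]])
  define C where "C = K * B * measure (lebesgue_on \<Omega>) (space (lebesgue_on \<Omega>))"
  show 1: "integrable (lebesgue_on {0<..<T'}) (\<lambda>t. pairing \<psi> t * energy t)"
  proof (rule Bochner_Integration.integrable_bound)
    show "integrable (lebesgue_on {0<..<T'}) (\<lambda>t. C * energy t)"
      using energy_integrable[OF assms(1,2)] by simp
    show "(\<lambda>t. pairing \<psi> t * energy t) \<in> borel_measurable (lebesgue_on {0<..<T'})"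
      using energy_integrable[OF assms(1,2)] pairing_integrable(1)[OF assms] by (intro borel_measurable_times) auto
    have "AE t in lebesgue_on {0<..<T'}. t \<in> {0<..<T'}" by (rule AE_I2) auto
    with K(2) show "AE t in lebesgue_on {0<..<T'}. norm (pairing \<psi> t * energy t) \<le> norm (C * energy t)"
    proof eventually_elim
      case (elim t)
      then have "\<bar>pairing \<psi> t\<bar> \<le> C"
        unfolding C_def using interval_subset_tint[OF assms(2)] K(1) B(2)
        by (intro pairing_bounded[OF elim(1) _ m]) auto
      then have "\<bar>pairing \<psi> t\<bar> \<le> \<bar>C\<bar>" by linarith
      then show ?case unfolding real_norm_def abs_mult by (intro mult_right_mono) auto
    qed
  qed
  show "integrable (lebesgue_on {0<..<T'}) (flux \<psi>)"
    using lebesgue_on_Fubini(2)[OF dom_borel _ uDu_integrable_cyl[OF assms]] 1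
    unfolding flux_def[abs_def] by (intro Bochner_Integration.integrable_diff) auto
qed

lemma deriv_zero_beyond:
  assumes "\<And>s. r \<le> s \<Longrightarrow> \<eta> s = (0::real)" "r < s"
  shows "deriv \<eta> s = 0"
proof (rule DERIV_imp_deriv)
  have "((\<lambda>s. 0) has_real_derivative 0) (at s)" by simp
  then show "(\<eta> has_real_derivative 0) (at s)"
    by (rule has_field_derivative_transform_within_open[where S="{r<..}"]) (use assms in auto)
qed

lemma pairing_initial:
  assumes "t \<in> tint T" "test_fun \<Omega> \<psi>"
  shows "pairing \<psi> t + integral\<^sup>L (lebesgue_on {0<..t}) (flux \<psi>) = integral\<^sup>L (lebesgue_on \<Omega>) (\<lambda>x. u0 x * \<psi> x)"
proof -
  obtain T' where T': "t < T'" "ereal T' < T"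
    using assms(1) ereal_dense2[of "ereal t" T] by (auto simp: tint_def)
  have t0: "0 < t" and T'0: "0 < T'" using assms(1) T' by (auto simp: tint_def)
  obtain B where B: "0 < B" "\<And>x. \<bar>\<psi> x\<bar> \<le> B" "\<And>x. norm (grad \<psi> x) \<le> B"
    using test_fun_bounded[OF assms(2)] by blast
  have C\<psi>: "Cinf UNIV \<psi>" using test_funD[OF assms(2)] by blast
  have m: "\<psi> \<in> borel_measurable (lebesgue_on \<Omega>)"
    by (rule continuous_measurable_lebesgue_on[OF test_funD(2)[OF assms(2)]])
  show ?thesis
  proof (rule weak_ode_initial[OF pairing_integrable(1)[OF T'0 T'(2) assms(2)] flux_integrable(2)[OF T'0 T'(2) assms(2)]
        isCont_pairing[OF m B(2) assms(1)] t0 T'(1)])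
    fix \<eta> :: "real \<Rightarrow> real" and r assume \<eta>: "Cinf UNIV \<eta>" "r < T'" "\<And>s. r \<le> s \<Longrightarrow> \<eta> s = 0"
    let ?\<phi> = "\<lambda>p. \<psi> (fst p) * \<eta> (snd p)"
    have \<eta>z: "\<eta> s = 0" if "T' \<le> s" for s using \<eta>(2,3) that by simp
    have d\<eta>z: "deriv \<eta> s = 0" if "T' \<le> s" for s using deriv_zero_beyond[of r \<eta> s] \<eta>(2,3) that by simp
    have "ereal r < T" using T'(2) \<eta>(2) by (meson ereal_less_eq(3) le_less_trans less_imp_le)
    then have tf: "test_fun0 \<Omega> T ?\<phi>" by (intro test_fun0_tensor[OF assms(2) \<eta>(1,3)]) auto
    note \<eta>c = Cinf_continuous[OF \<eta>(1)] and d\<eta>c = Cinf_real_derivative(2)[OF \<eta>(1)]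
    have weak: "- integral\<^sup>L (lebesgue_on (\<Omega> \<times> tint T)) (\<lambda>p. u (fst p) (snd p) * dt ?\<phi> p)
        + integral\<^sup>L (lebesgue_on (\<Omega> \<times> tint T))
            (\<lambda>p. ?\<phi> p * (norm (Du (fst p) (snd p)))\<^sup>2 + u (fst p) (snd p) * (Du (fst p) (snd p) \<bullet> gradx ?\<phi> p))
        = integral\<^sup>L (lebesgue_on \<Omega>) (\<lambda>x. u0 x * ?\<phi> (x, 0))
        + integral\<^sup>L (lebesgue_on (tint T))
            (\<lambda>t. integral\<^sup>L (lebesgue_on \<Omega>) (\<lambda>x. u x t * ?\<phi> (x, t)) *
                 integral\<^sup>L (lebesgue_on \<Omega>) (\<lambda>x. (norm (Du x t))\<^sup>2))"
      using sol[unfolded weak_solution_def] tf by blast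
    have I1: "integral\<^sup>L (lebesgue_on (\<Omega> \<times> tint T)) (\<lambda>p. u (fst p) (snd p) * dt ?\<phi> p)
        = integral\<^sup>L (lebesgue_on {0<..<T'}) (\<lambda>t. pairing \<psi> t * deriv \<eta> t)"
    proof -
      have "integral\<^sup>L (lebesgue_on (\<Omega> \<times> tint T)) (\<lambda>p. u (fst p) (snd p) * dt ?\<phi> p) =
          integral\<^sup>L (lebesgue_on (\<Omega> \<times> {0<..<T'})) (\<lambda>p. (u (fst p) (snd p) * \<psi> (fst p)) * deriv \<eta> (snd p))"
        unfolding dt_tensor[OF C\<psi> \<eta>(1)] mult.assoc
        by (rule integral_cyl_restrict[OF T'(2)]) (simp add: d\<eta>z)
      also have "\<dots> = integral\<^sup>L (lebesgue_on {0<..<T'}) (\<lambda>t. pairing \<psi> t * deriv \<eta> t)"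
        using tensor_bounded_integrable(2)[OF u_psi_integrable(1)[OF T'0 T'(2) assms(2)] d\<eta>c d\<eta>z]
        by (simp add: pairing_def)
      finally show ?thesis .
    qed
    define G where "G = (\<lambda>t. integral\<^sup>L (lebesgue_on \<Omega>) (\<lambda>x. \<psi> x * (norm (Du x t))\<^sup>2 + u x t * (Du x t \<bullet> grad \<psi> x)))"
    have Gi: "integrable (lebesgue_on {0<..<T'}) G"
      using lebesgue_on_Fubini(2)[OF dom_borel _ uDu_integrable_cyl[OF T'0 T'(2) assms(2)]] by (simp add: G_def)
    have I2: "integral\<^sup>L (lebesgue_on (\<Omega> \<times> tint T))
            (\<lambda>p. ?\<phi> p * (norm (Du (fst p) (snd p)))\<^sup>2 + u (fst p) (snd p) * (Du (fst p) (snd p) \<bullet> gradx ?\<phi> p))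
        = integral\<^sup>L (lebesgue_on {0<..<T'}) (\<lambda>t. G t * \<eta> t)"
    proof -
      let ?f = "\<lambda>p. \<psi> (fst p) * (norm (Du (fst p) (snd p)))\<^sup>2 + u (fst p) (snd p) * (Du (fst p) (snd p) \<bullet> grad \<psi> (fst p))"
      have "(\<lambda>p. ?\<phi> p * (norm (Du (fst p) (snd p)))\<^sup>2 + u (fst p) (snd p) * (Du (fst p) (snd p) \<bullet> gradx ?\<phi> p))
          = (\<lambda>p. ?f p * \<eta> (snd p))"
        unfolding gradx_tensor[OF C\<psi> \<eta>(1)] by (rule ext) (simp add: algebra_simps)
      moreover have "integral\<^sup>L (lebesgue_on (\<Omega> \<times> tint T)) (\<lambda>p. ?f p * \<eta> (snd p)) =
          integral\<^sup>L (lebesgue_on (\<Omega> \<times> {0<..<T'})) (\<lambda>p. ?f p * \<eta> (snd p))"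
        by (rule integral_cyl_restrict[OF T'(2)]) (simp add: \<eta>z)
      ultimately show ?thesis
        using tensor_bounded_integrable(2)[OF uDu_integrable_cyl[OF T'0 T'(2) assms(2)] \<eta>c \<eta>z]
        by (simp add: G_def)
    qed
    have I4: "integral\<^sup>L (lebesgue_on (tint T))
            (\<lambda>t. integral\<^sup>L (lebesgue_on \<Omega>) (\<lambda>x. u x t * ?\<phi> (x, t)) *
                 integral\<^sup>L (lebesgue_on \<Omega>) (\<lambda>x. (norm (Du x t))\<^sup>2))
        = integral\<^sup>L (lebesgue_on {0<..<T'}) (\<lambda>t. (pairing \<psi> t * energy t) * \<eta> t)"
    proof -
      have "(\<lambda>t. integral\<^sup>L (lebesgue_on \<Omega>) (\<lambda>x. u x t * ?\<phi> (x, t)) *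
                 integral\<^sup>L (lebesgue_on \<Omega>) (\<lambda>x. (norm (Du x t))\<^sup>2)) = (\<lambda>t. (pairing \<psi> t * energy t) * \<eta> t)"
        by (rule ext) (simp add: pairing_def energy_def flip: mult.assoc)
      then show ?thesis using integral_tint_restrict[OF T'(2), of "\<lambda>t. (pairing \<psi> t * energy t) * \<eta> t"] \<eta>z by simp
    qed
    have "bounded (\<eta> ` {0..T'})"
      using \<eta>c by (intro compact_imp_bounded compact_continuous_image) (auto intro: continuous_on_subset)
    then obtain E where E: "\<And>s. s \<in> {0..T'} \<Longrightarrow> \<bar>\<eta> s\<bar> \<le> E"
      unfolding bounded_iff by (metis image_eqI real_norm_def)
    have mi: "integrable (lebesgue_on {0<..<T'}) (\<lambda>s. f s * \<eta> s)" if "integrable (lebesgue_on {0<..<T'}) f" for f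
    proof (rule Bochner_Integration.integrable_bound)
      show "integrable (lebesgue_on {0<..<T'}) (\<lambda>s. f s * E)" using that by simp
      show "(\<lambda>s. f s * \<eta> s) \<in> borel_measurable (lebesgue_on {0<..<T'})"
        using that continuous_measurable_lebesgue_on[OF \<eta>c] by (intro borel_measurable_times) auto
      show "AE s in lebesgue_on {0<..<T'}. norm (f s * \<eta> s) \<le> norm (f s * E)"
      proof (rule AE_I2)
        fix s assume "s \<in> space (lebesgue_on {0<..<T'})"
        then have "s \<in> {0..T'}" by auto
        from E[OF this] show "norm (f s * \<eta> s) \<le> norm (f s * E)"
          unfolding real_norm_def abs_mult by (intro mult_left_mono) auto
      qed
    qed
    have "integral\<^sup>L (lebesgue_on {0<..<T'}) (\<lambda>s. flux \<psi> s * \<eta> s) =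
        integral\<^sup>L (lebesgue_on {0<..<T'}) (\<lambda>s. G s * \<eta> s - (pairing \<psi> s * energy s) * \<eta> s)"
      by (simp add: flux_def G_def left_diff_distrib)
    also have "\<dots> = integral\<^sup>L (lebesgue_on {0<..<T'}) (\<lambda>s. G s * \<eta> s)
        - integral\<^sup>L (lebesgue_on {0<..<T'}) (\<lambda>s. (pairing \<psi> s * energy s) * \<eta> s)"
      by (rule Bochner_Integration.integral_diff[OF mi[OF Gi] mi[OF flux_integrable(1)[OF T'0 T'(2) assms(2)]]])
    finally show "- integral\<^sup>L (lebesgue_on {0<..<T'}) (\<lambda>s. pairing \<psi> s * deriv \<eta> s)
        + integral\<^sup>L (lebesgue_on {0<..<T'}) (\<lambda>s. flux \<psi> s * \<eta> s)
        = integral\<^sup>L (lebesgue_on \<Omega>) (\<lambda>x. u0 x * \<psi> x) * \<eta> 0"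
      using weak unfolding I1 I2 I4 by (simp flip: mult.assoc)
  qed
qed

lemma pairing_diff:
  assumes "0 < s" "s \<le> t" "ereal t < T" "test_fun \<Omega> \<psi>"
  shows "pairing \<psi> t - pairing \<psi> s = integral\<^sup>L (lebesgue_on {s<..t}) (ut_pairing \<psi>)"
proof -
  obtain T' where T': "t < T'" "ereal T' < T"
    using assms(3) ereal_dense2[of "ereal t" T] by auto
  have T'0: "0 < T'" using assms T' by auto
  have st: "s \<in> tint T" "t \<in> tint T" using assms le_less_trans[of "ereal s" "ereal t" T] by (auto simp: tint_def)
  obtain B where B: "0 < B" "\<And>x. \<bar>\<psi> x\<bar> \<le> B" "\<And>x. norm (grad \<psi> x) \<le> B"
    using test_fun_bounded[OF assms(4)] by blast
  have C\<psi>: "Cinf UNIV \<psi>" using test_funD[OF assms(4)] by blast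
  have m: "\<psi> \<in> borel_measurable (lebesgue_on \<Omega>)"
    by (rule continuous_measurable_lebesgue_on[OF test_funD(2)[OF assms(4)]])
  show ?thesis
  proof (rule weak_ode_interior[OF pairing_integrable[OF T'0 T'(2) assms(4)]
        isCont_pairing[OF m B(2) st(2)] isCont_pairing[OF m B(2) st(1)] assms(1,2) T'(1)])
    fix \<eta> :: "real \<Rightarrow> real" and p q
    assume \<eta>: "Cinf UNIV \<eta>" "0 < p" "q < T'" "\<And>s. s \<notin> {p..q} \<Longrightarrow> \<eta> s = 0"
    let ?\<phi> = "\<lambda>p. \<psi> (fst p) * \<eta> (snd p)"
    have \<eta>z: "\<eta> s = 0" if "T' \<le> s" for s using \<eta>(3,4) that by simp
    have d\<eta>z: "deriv \<eta> s = 0" if "T' \<le> s" for s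
      using deriv_zero_beyond[of "(q + T') / 2" \<eta> s] \<eta>(3,4) that by (simp add: field_simps)
    have "{p..q} \<subseteq> tint T"
      using \<eta>(2,3) T'(2) by (auto simp: tint_def intro: le_less_trans[of "ereal _" "ereal T'" T])
    then have tf: "test_fun (\<Omega> \<times> tint T) ?\<phi>" by (intro test_fun_tensor[OF assms(4) \<eta>(1,4)]) auto
    note \<eta>c = Cinf_continuous[OF \<eta>(1)] and d\<eta>c = Cinf_real_derivative(2)[OF \<eta>(1)]
    have I1: "integral\<^sup>L (lebesgue_on (\<Omega> \<times> tint T)) (\<lambda>p. u (fst p) (snd p) * dt ?\<phi> p)
        = integral\<^sup>L (lebesgue_on {0<..<T'}) (\<lambda>t. pairing \<psi> t * deriv \<eta> t)"
    proof -
      have "integral\<^sup>L (lebesgue_on (\<Omega> \<times> tint T)) (\<lambda>p. u (fst p) (snd p) * dt ?\<phi> p) =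
          integral\<^sup>L (lebesgue_on (\<Omega> \<times> {0<..<T'})) (\<lambda>p. (u (fst p) (snd p) * \<psi> (fst p)) * deriv \<eta> (snd p))"
        unfolding dt_tensor[OF C\<psi> \<eta>(1)] mult.assoc
        by (rule integral_cyl_restrict[OF T'(2)]) (simp add: d\<eta>z)
      also have "\<dots> = integral\<^sup>L (lebesgue_on {0<..<T'}) (\<lambda>t. pairing \<psi> t * deriv \<eta> t)"
        using tensor_bounded_integrable(2)[OF u_psi_integrable(1)[OF T'0 T'(2) assms(4)] d\<eta>c d\<eta>z]
        by (simp add: pairing_def)
      finally show ?thesis .
    qed
    have I2: "integral\<^sup>L (lebesgue_on (\<Omega> \<times> tint T)) (\<lambda>p. ut (fst p) (snd p) * ?\<phi> p)
        = integral\<^sup>L (lebesgue_on {0<..<T'}) (\<lambda>t. ut_pairing \<psi> t * \<eta> t)"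
    proof -
      have "integral\<^sup>L (lebesgue_on (\<Omega> \<times> tint T)) (\<lambda>p. ut (fst p) (snd p) * ?\<phi> p) =
          integral\<^sup>L (lebesgue_on (\<Omega> \<times> {0<..<T'})) (\<lambda>p. (ut (fst p) (snd p) * \<psi> (fst p)) * \<eta> (snd p))"
        unfolding mult.assoc
        by (rule integral_cyl_restrict[OF T'(2)]) (simp add: \<eta>z)
      also have "\<dots> = integral\<^sup>L (lebesgue_on {0<..<T'}) (\<lambda>t. ut_pairing \<psi> t * \<eta> t)"
        using tensor_bounded_integrable(2)[OF u_psi_integrable(2)[OF T'0 T'(2) assms(4)] \<eta>c \<eta>z]
        by (simp add: ut_pairing_def)
      finally show ?thesis .
    qed
    show "integral\<^sup>L (lebesgue_on {0<..<T'}) (\<lambda>s. pairing \<psi> s * deriv \<eta> s) =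
        - integral\<^sup>L (lebesgue_on {0<..<T'}) (\<lambda>s. ut_pairing \<psi> s * \<eta> s)"
      using ut_weak[OF tf] unfolding I1 I2 .
  qed
qed

lemma AE_ut_pairing_eq_flux:
  assumes "0 < T'" "ereal T' < T" "test_fun \<Omega> \<psi>"
  shows "AE t in lebesgue_on {0<..<T'}. ut_pairing \<psi> t = - flux \<psi> t"
proof -
  have i: "integrable (lebesgue_on {0<..<T'}) (\<lambda>t. ut_pairing \<psi> t + flux \<psi> t)"
    by (intro Bochner_Integration.integrable_add pairing_integrable flux_integrable assms)
  have "AE t in lebesgue_on {0<..<T'}. ut_pairing \<psi> t + flux \<psi> t = 0"
  proof (rule AE_eq_0_if_interval_integrals_0[OF i])
    fix s t assume st: "0 < s" "s < t" "t < T'"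
    have tT: "ereal t < T" "ereal s < T"
      using st assms(2) by (auto intro: le_less_trans[of "ereal _" "ereal T'" T])
    have sub: "integrable (lebesgue_on {p<..q}) f" if "integrable (lebesgue_on {0<..<T'}) f" "0 \<le> p" "q < T'" for f :: "real \<Rightarrow> real" and p q
      by (rule integrable_lebesgue_on_subset[OF that(1)]) (use that in auto)
    have "pairing \<psi> t + integral\<^sup>L (lebesgue_on {0<..t}) (flux \<psi>) = pairing \<psi> s + integral\<^sup>L (lebesgue_on {0<..s}) (flux \<psi>)"
      using pairing_initial[OF _ assms(3), of t] pairing_initial[OF _ assms(3), of s] tT st by (simp add: tint_def)
    moreover have "integral\<^sup>L (lebesgue_on {0<..t}) (flux \<psi>) =
        integral\<^sup>L (lebesgue_on {0<..s}) (flux \<psi>) + integral\<^sup>L (lebesgue_on {s<..t}) (flux \<psi>)"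
      by (rule integral_interval_split[OF sub[OF flux_integrable(2)[OF assms]]]) (use st in auto)
    moreover have "pairing \<psi> t - pairing \<psi> s = integral\<^sup>L (lebesgue_on {s<..t}) (ut_pairing \<psi>)"
      by (rule pairing_diff[OF _ _ _ assms(3)]) (use st tT in auto)
    ultimately show "integral\<^sup>L (lebesgue_on {s<..t}) (\<lambda>t. ut_pairing \<psi> t + flux \<psi> t) = 0"
      using Bochner_Integration.integral_add[OF sub[OF pairing_integrable(2)[OF assms]] sub[OF flux_integrable(2)[OF assms]], of s t] st
      by simp
  qed
  then show ?thesis by eventually_elim simp
qed

end

lemma Cauchy_Schwarz_integral:
  fixes f g :: "'b \<Rightarrow> real"
  assumes m: "f \<in> borel_measurable M" "g \<in> borel_measurable M"
    and i: "integrable M (\<lambda>x. (f x)\<^sup>2)" "integrable M (\<lambda>x. (g x)\<^sup>2)"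
  shows "integrable M (\<lambda>x. f x * g x)"
    and "integral\<^sup>L M (\<lambda>x. \<bar>f x * g x\<bar>) \<le> sqrt (integral\<^sup>L M (\<lambda>x. (f x)\<^sup>2)) * sqrt (integral\<^sup>L M (\<lambda>x. (g x)\<^sup>2))"
proof -
  have y: "\<bar>a * b\<bar> \<le> a\<^sup>2 + b\<^sup>2" for a b :: real
  proof -
    have "0 \<le> (\<bar>a\<bar> - \<bar>b\<bar>)\<^sup>2" by simp
    also have "\<dots> = a\<^sup>2 + b\<^sup>2 - 2 * \<bar>a * b\<bar>" by (simp add: power2_diff abs_mult)
    finally show ?thesis using abs_ge_zero[of "a * b"] by linarith
  qed
  show fg: "integrable M (\<lambda>x. f x * g x)"
  proof (rule Bochner_Integration.integrable_bound[OF Bochner_Integration.integrable_add[OF i]])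
    show "(\<lambda>x. f x * g x) \<in> borel_measurable M" using m by (rule borel_measurable_times)
    show "AE x in M. norm (f x * g x) \<le> norm ((f x)\<^sup>2 + (g x)\<^sup>2)"
      using y by (intro AE_I2) (simp add: order_trans[OF y abs_ge_self])
  qed
  let ?A = "integral\<^sup>L M (\<lambda>x. (f x)\<^sup>2)" and ?B = "integral\<^sup>L M (\<lambda>x. (g x)\<^sup>2)" and ?I = "integral\<^sup>L M (\<lambda>x. \<bar>f x * g x\<bar>)"
  have AB: "0 \<le> ?A" "0 \<le> ?B" "0 \<le> ?I" by auto
  have q: "0 \<le> c\<^sup>2 * ?A - 2 * c * ?I + ?B" for c
  proof -
    have e: "(c * \<bar>f x\<bar> - \<bar>g x\<bar>)\<^sup>2 = c\<^sup>2 * (f x)\<^sup>2 - 2 * c * \<bar>f x * g x\<bar> + (g x)\<^sup>2" for x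
      by (simp add: power2_diff power_mult_distrib abs_mult)
    have "0 \<le> integral\<^sup>L M (\<lambda>x. (c * \<bar>f x\<bar> - \<bar>g x\<bar>)\<^sup>2)" by simp
    also have "\<dots> = c\<^sup>2 * ?A - 2 * c * ?I + ?B"
      unfolding e using i fg by simp
    finally show ?thesis .
  qed
  have "?I\<^sup>2 \<le> ?A * ?B"
  proof (cases "?A = 0")
    case True
    have "?I = 0"
    proof (rule ccontr)
      assume "?I \<noteq> 0"
      then have "0 < ?I" using AB by linarith
      then show False using q[of "(?B + 1) / (2 * ?I)"] True by simp
    qed
    then show ?thesis using True by simp
  next
    case False
    then have A: "0 < ?A" using AB by linarith
    have "(?I / ?A)\<^sup>2 * ?A = ?I\<^sup>2 / ?A" "2 * (?I / ?A) * ?I = 2 * (?I\<^sup>2 / ?A)"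
      using A by (auto simp: power2_eq_square)
    then have "?I\<^sup>2 / ?A \<le> ?B" using q[of "?I / ?A"] by linarith
    then show ?thesis using A by (simp add: pos_divide_le_eq mult.commute)
  qed
  then have "\<bar>?I\<bar> \<le> sqrt (?A * ?B)" by (rule real_le_rsqrt[THEN order_trans[rotated]]) simp
  then show "?I \<le> sqrt ?A * sqrt ?B" by (simp add: real_sqrt_mult)
qed

context degenerate_flow
begin

definition good :: "real \<Rightarrow> real \<Rightarrow> bool" where
  "good K t \<longleftrightarrow> t \<in> tint T \<and> W012 \<Omega> (\<lambda>x. u x t) (\<lambda>x. Du x t) \<and>
     (AE x in lebesgue_on \<Omega>. 0 < u x t \<and> u x t \<le> K) \<and>
     integrable (lebesgue_on \<Omega>) (\<lambda>x. ut x t) \<and> integrable (lebesgue_on \<Omega>) (\<lambda>x. (ut x t)\<^sup>2) \<and>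
     (\<forall>\<psi>. test_fun \<Omega> \<psi> \<longrightarrow> ut_pairing \<psi> t = - flux \<psi> t)"

lemma AE_u_pos: "AE p in lebesgue_on (\<Omega> \<times> tint T). 0 < u (fst p) (snd p)"
proof -
  have "tint T = {0<..} \<inter> {t. ereal t < T}" by (auto simp: tint_def)
  moreover have "open {t. ereal t < T}"
    by (intro open_Collect_less continuous_intros continuous_on_ereal)
  ultimately have "open (tint T)" by (metis open_Int open_greaterThan)
  then have op: "open (\<Omega> \<times> tint T)" using open_dom by (intro open_Times)
  obtain C :: "nat \<Rightarrow> ('a \<times> real) set" where C3: "\<Union> (range C) = \<Omega> \<times> tint T"
    and C: "\<And>n. compact (C n)" "\<And>n. C n \<subseteq> \<Omega> \<times> tint T"
    by (rule open_Union_compact_subsets[OF op]) (rule that)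
  have "AE p in lebesgue. p \<in> C n \<longrightarrow> 0 < u (fst p) (snd p)" for n :: nat
  proof -
    have "C n \<subseteq> \<Omega> \<times> {t. 0 \<le> t \<and> ereal t \<le> T}" using C(2)[of n] by (fastforce simp: tint_def)
    then obtain c where c: "0 < c" "AE p in lebesgue_on (C n \<inter> (\<Omega> \<times> tint T)). c \<le> u (fst p) (snd p)"
      using locpos C(1)[of n] unfolding locally_positive_def by blast
    have s: "C n \<inter> (\<Omega> \<times> tint T) = C n" using C(2) by blast
    have "C n \<in> sets lebesgue" using C(1)[of n] by (simp add: compact_imp_closed sets_completionI_sets borel_closed)
    then have "AE p in lebesgue. p \<in> C n \<longrightarrow> c \<le> u (fst p) (snd p)"
      using c(2) by (simp add: AE_restrict_space_iff s)
    then show ?thesis by eventually_elim (use c(1) in auto)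
  qed
  then have "AE p in lebesgue. \<forall>n. p \<in> C n \<longrightarrow> 0 < u (fst p) (snd p)"
    unfolding AE_all_countable by blast
  then have "AE p in lebesgue. p \<in> \<Omega> \<times> tint T \<longrightarrow> 0 < u (fst p) (snd p)"
    by eventually_elim (use C3 in blast)
  then show ?thesis using cyl_lebesgue(2) by (simp add: AE_restrict_space_iff)
qed

lemma weak_form_integrand:
  assumes W: "W012 \<Omega> (\<lambda>x. u x t) (\<lambda>x. Du x t)"
    and b: "AE x in lebesgue_on \<Omega>. 0 \<le> u x t \<and> u x t \<le> K" and K: "0 < K"
    and ut: "integrable (lebesgue_on \<Omega>) (\<lambda>x. ut x t)" and tf: "test_fun \<Omega> \<psi>" and t: "t \<in> tint T"
  shows "integrable (lebesgue_on \<Omega>) (\<lambda>x. ut x t * \<psi> x)"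
    "integrable (lebesgue_on \<Omega>) (\<lambda>x. \<psi> x * (norm (Du x t))\<^sup>2 + u x t * (Du x t \<bullet> grad \<psi> x))"
    "integrable (lebesgue_on \<Omega>) (\<lambda>x. u x t * \<psi> x)"
proof -
  interpret finite_measure "lebesgue_on \<Omega>" by (rule finite_dom)
  obtain B where B: "0 < B" "\<And>x. \<bar>\<psi> x\<bar> \<le> B" "\<And>x. norm (grad \<psi> x) \<le> B"
    using test_fun_bounded[OF tf] by blast
  have m[measurable]: "\<psi> \<in> borel_measurable (lebesgue_on \<Omega>)" "grad \<psi> \<in> borel_measurable (lebesgue_on \<Omega>)"
    using continuous_measurable_lebesgue_on[OF test_funD(2)[OF tf]] continuous_measurable_lebesgue_on[OF test_funD(3)[OF tf]] by auto
  have [measurable]: "(\<lambda>x. u x t) \<in> borel_measurable (lebesgue_on \<Omega>)" "(\<lambda>x. Du x t) \<in> borel_measurable (lebesgue_on \<Omega>)"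
    and D2: "integrable (lebesgue_on \<Omega>) (\<lambda>x. (norm (Du x t))\<^sup>2)"
    using W by (auto simp: W012_def L2_def)
  show "integrable (lebesgue_on \<Omega>) (\<lambda>x. ut x t * \<psi> x)" by (rule mult_bounded_integrable[OF ut m(1) B(2)])
  show "integrable (lebesgue_on \<Omega>) (\<lambda>x. u x t * \<psi> x)" by (rule mult_bounded_integrable[OF u_integrable[OF t] m(1) B(2)])
  have "integrable (lebesgue_on \<Omega>) (\<lambda>x. (norm (Du x t))\<^sup>2 * \<psi> x)"
    by (rule mult_bounded_integrable[OF D2 m(1) B(2)])
  moreover have "integrable (lebesgue_on \<Omega>) (\<lambda>x. u x t * (Du x t \<bullet> grad \<psi> x))"
  proof (rule Bochner_Integration.integrable_bound)
    show "integrable (lebesgue_on \<Omega>) (\<lambda>x. K * B * (1 + (norm (Du x t))\<^sup>2))"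
      using D2 by (intro integrable_mult_right Bochner_Integration.integrable_add) auto
    show "AE x in lebesgue_on \<Omega>. norm (u x t * (Du x t \<bullet> grad \<psi> x)) \<le> norm (K * B * (1 + (norm (Du x t))\<^sup>2))"
      using b
    proof eventually_elim
      case (elim x)
      let ?n = "norm (Du x t)"
      have "\<bar>Du x t \<bullet> grad \<psi> x\<bar> \<le> ?n * norm (grad \<psi> x)" by (rule Cauchy_Schwarz_ineq2)
      also have "\<dots> \<le> ?n * B" by (intro mult_left_mono B) auto
      also have "?n \<le> 1 + ?n\<^sup>2" using abs_le_one_plus_square[of ?n] by simp
      finally have "\<bar>Du x t \<bullet> grad \<psi> x\<bar> \<le> (1 + ?n\<^sup>2) * B" using B(1) by simp
      then have "\<bar>u x t\<bar> * \<bar>Du x t \<bullet> grad \<psi> x\<bar> \<le> K * ((1 + ?n\<^sup>2) * B)"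
        using elim K by (intro mult_mono) auto
      then show ?case using K B by (simp add: abs_mult mult_ac)
    qed
  qed measurable
  ultimately show "integrable (lebesgue_on \<Omega>) (\<lambda>x. \<psi> x * (norm (Du x t))\<^sup>2 + u x t * (Du x t \<bullet> grad \<psi> x))"
    by (simp add: mult.commute)
qed

lemma weak_form_dense:
  assumes W: "W012 \<Omega> (\<lambda>x. u x t) (\<lambda>x. Du x t)"
    and b: "AE x in lebesgue_on \<Omega>. 0 \<le> u x t \<and> u x t \<le> K" and K: "0 < K"
    and ut: "integrable (lebesgue_on \<Omega>) (\<lambda>x. ut x t)" and t: "t \<in> tint T"
    and tf: "test_fun \<Omega> \<psi>"
    and D: "\<And>e. 0 < e \<Longrightarrow> \<exists>d. test_fun \<Omega> d \<and> ut_pairing d t = - flux d t \<and>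
       (\<forall>x\<in>\<Omega>. \<bar>\<psi> x - d x\<bar> < e \<and> norm (grad \<psi> x - grad d x) < e)"
  shows "ut_pairing \<psi> t = - flux \<psi> t"
proof -
  interpret finite_measure "lebesgue_on \<Omega>" by (rule finite_dom)
  let ?L = "\<lambda>\<psi> x. ut x t * \<psi> x + (\<psi> x * (norm (Du x t))\<^sup>2 + u x t * (Du x t \<bullet> grad \<psi> x)) - u x t * \<psi> x * energy t"
  have Li: "integrable (lebesgue_on \<Omega>) (?L \<psi>)" if "test_fun \<Omega> \<psi>" for \<psi>
    by (rule Bochner_Integration.integrable_diff[OF Bochner_Integration.integrable_add[OF
          weak_form_integrand(1,2)[OF W b K ut that t]]
        integrable_mult_left[OF weak_form_integrand(3)[OF W b K ut that t]]])
  have Leq: "integral\<^sup>L (lebesgue_on \<Omega>) (?L \<psi>) = ut_pairing \<psi> t + flux \<psi> t" if "test_fun \<Omega> \<psi>" for \<psi>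
    unfolding Bochner_Integration.integral_diff[OF Bochner_Integration.integrable_add[OF
          weak_form_integrand(1,2)[OF W b K ut that t]]
        integrable_mult_left[OF weak_form_integrand(3)[OF W b K ut that t]]]
      Bochner_Integration.integral_add[OF weak_form_integrand(1,2)[OF W b K ut that t]]
    by (simp add: ut_pairing_def flux_def pairing_def)
  have D2: "integrable (lebesgue_on \<Omega>) (\<lambda>x. (norm (Du x t))\<^sup>2)" using W by (auto simp: W012_def L2_def)
  let ?w = "\<lambda>x. \<bar>ut x t\<bar> + (norm (Du x t))\<^sup>2 + K * (1 + (norm (Du x t))\<^sup>2) + K * energy t"
  define C where "C = integral\<^sup>L (lebesgue_on \<Omega>) ?w"
  have wi: "integrable (lebesgue_on \<Omega>) ?w"
    using ut D2 by (intro Bochner_Integration.integrable_add integrable_mult_right) auto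
  have C: "0 \<le> C" unfolding C_def using K energy_nonneg by (intro Bochner_Integration.integral_nonneg) auto
  have bd: "\<bar>ut_pairing \<psi> t + flux \<psi> t\<bar> \<le> e * C" if e: "0 < e" for e
  proof -
    obtain d where d: "test_fun \<Omega> d" "ut_pairing d t = - flux d t"
      "\<And>x. x \<in> \<Omega> \<Longrightarrow> \<bar>\<psi> x - d x\<bar> < e" "\<And>x. x \<in> \<Omega> \<Longrightarrow> norm (grad \<psi> x - grad d x) < e"
      using D[OF e] by blast
    have "ut_pairing \<psi> t + flux \<psi> t = integral\<^sup>L (lebesgue_on \<Omega>) (?L \<psi>) - integral\<^sup>L (lebesgue_on \<Omega>) (?L d)"
      using Leq[OF tf] Leq[OF d(1)] d(2) by simp
    then have eq: "ut_pairing \<psi> t + flux \<psi> t = integral\<^sup>L (lebesgue_on \<Omega>) (\<lambda>x. ?L \<psi> x - ?L d x)"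
      unfolding Bochner_Integration.integral_diff[OF Li[OF tf] Li[OF d(1)]] .
    have "\<bar>ut_pairing \<psi> t + flux \<psi> t\<bar> \<le> integral\<^sup>L (lebesgue_on \<Omega>) (\<lambda>x. \<bar>?L \<psi> x - ?L d x\<bar>)"
      unfolding eq by (rule integral_abs_bound)
    also have "\<dots> \<le> integral\<^sup>L (lebesgue_on \<Omega>) (\<lambda>x. e * ?w x)"
    proof (rule integral_mono_AE)
      show "integrable (lebesgue_on \<Omega>) (\<lambda>x. \<bar>?L \<psi> x - ?L d x\<bar>)"
        by (rule integrable_abs[OF Bochner_Integration.integrable_diff[OF Li[OF tf] Li[OF d(1)]]])
      show "integrable (lebesgue_on \<Omega>) (\<lambda>x. e * ?w x)" using wi by (rule integrable_mult_right)
      have "AE x in lebesgue_on \<Omega>. x \<in> \<Omega>" by (rule AE_I2) auto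
      with b show "AE x in lebesgue_on \<Omega>. \<bar>?L \<psi> x - ?L d x\<bar> \<le> e * ?w x"
      proof eventually_elim
        case (elim x)
        let ?n = "norm (Du x t)" and ?a = "\<psi> x - d x" and ?v = "grad \<psi> x - grad d x"
        have a: "\<bar>?a\<bar> \<le> e" "norm ?v \<le> e" using d(3,4)[of x] elim(2) by auto
        have "\<bar>Du x t \<bullet> ?v\<bar> \<le> ?n * norm ?v" by (rule Cauchy_Schwarz_ineq2)
        also have "\<dots> \<le> (1 + ?n\<^sup>2) * e"
          using abs_le_one_plus_square[of ?n] by (intro mult_mono a) auto
        finally have v: "\<bar>Du x t \<bullet> ?v\<bar> \<le> (1 + ?n\<^sup>2) * e" .
        have eq: "?L \<psi> x - ?L d x = ut x t * ?a + ?n\<^sup>2 * ?a + u x t * (Du x t \<bullet> ?v) - u x t * ?a * energy t"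
          by (simp add: algebra_simps inner_diff_right)
        have "\<bar>?L \<psi> x - ?L d x\<bar> \<le> \<bar>ut x t * ?a\<bar> + \<bar>?n\<^sup>2 * ?a\<bar> + \<bar>u x t * (Du x t \<bullet> ?v)\<bar> + \<bar>u x t * ?a * energy t\<bar>"
          unfolding eq by linarith
        also have "\<dots> \<le> \<bar>ut x t\<bar> * e + ?n\<^sup>2 * e + K * ((1 + ?n\<^sup>2) * e) + K * e * energy t"
          unfolding abs_mult using a v elim(1) K e energy_nonneg[of t]
          by (intro add_mono mult_mono) auto
        also have "\<dots> = e * ?w x" by (simp add: algebra_simps)
        finally show ?case .
      qed
    qed
    also have "\<dots> = e * C" unfolding C_def by simp
    finally show ?thesis .
  qed
  have "\<bar>ut_pairing \<psi> t + flux \<psi> t\<bar> \<le> 0 + e" if "0 < e" for e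
  proof -
    have "\<bar>ut_pairing \<psi> t + flux \<psi> t\<bar> \<le> (e / (C + 1)) * C" using bd[of "e / (C + 1)"] that C by simp
    also have "\<dots> \<le> e" using that C by (simp add: field_simps)
    finally show ?thesis by simp
  qed
  then have "\<bar>ut_pairing \<psi> t + flux \<psi> t\<bar> \<le> 0" by (rule field_le_epsilon)
  then show ?thesis by simp
qed

lemma AE_good:
  assumes "0 < T'" "ereal T' < T"
  obtains K where "0 < K" "AE t in lebesgue_on {0<..<T'}. good K t"
proof -
  obtain K where K: "0 < K" "AE t in lebesgue_on {0<..<T'}. AE x in lebesgue_on \<Omega>. 0 \<le> u x t \<and> u x t \<le> K"
    using good_time_bounds[OF assms] by blast
  obtain D where D: "countable D" "\<And>\<psi>. \<psi> \<in> D \<Longrightarrow> test_fun \<Omega> \<psi>"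
    "\<And>\<psi> e. test_fun \<Omega> \<psi> \<Longrightarrow> 0 < e \<Longrightarrow>
      \<exists>d\<in>D. \<forall>x\<in>\<Omega>. \<bar>\<psi> x - d x\<bar> < e \<and> norm (grad \<psi> x - grad d x) < e"
    using test_fun_countable_dense[OF bounded_dom] by blast
  have sub: "{0<..<T'} \<subseteq> tint T" by (rule interval_subset_tint[OF assms(2)])
  have "AE t in lebesgue_on {0<..<T'}. t \<in> {0<..<T'}" by (rule AE_I2) auto
  moreover have "AE t in lebesgue_on {0<..<T'}. \<forall>d\<in>D. ut_pairing d t = - flux d t"
    using D(1,2) AE_ut_pairing_eq_flux[OF assms] by (simp add: AE_ball_countable)
  moreover have "AE t in lebesgue_on {0<..<T'}. W012 \<Omega> (\<lambda>x. u x t) (\<lambda>x. Du x t)"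
    by (rule AE_lebesgue_on_subset[OF _ sub]) (use sol in \<open>auto simp: weak_solution_def tint_lebesgue\<close>)
  moreover have "AE t in lebesgue_on {0<..<T'}. integrable (lebesgue_on \<Omega>) (\<lambda>x. ut x t)"
    using lebesgue_on_Fubini(1)[OF dom_borel _ ut_integrable_cyl[OF assms]] by simp
  moreover have "AE t in lebesgue_on {0<..<T'}. integrable (lebesgue_on \<Omega>) (\<lambda>x. (ut x t)\<^sup>2)"
    using lebesgue_on_Fubini(1)[OF dom_borel _ ut_L2[OF assms]] by simp
  moreover have "AE t in lebesgue_on {0<..<T'}. AE x in lebesgue_on \<Omega>. 0 < u x t"
    using AE_lebesgue_on_slices[OF dom_borel _ AE_lebesgue_on_subset[OF AE_u_pos cyl_subset[OF assms(2)] cyl_lebesgue]]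
    by simp
  ultimately have "AE t in lebesgue_on {0<..<T'}. good K t"
    using K(2)
  proof eventually_elim
    case (elim t)
    have tt: "t \<in> tint T" using elim(1) sub by auto
    have "AE x in lebesgue_on \<Omega>. 0 < u x t \<and> u x t \<le> K"
      using elim(6,7) by eventually_elim auto
    moreover have "ut_pairing \<psi> t = - flux \<psi> t" if \<psi>: "test_fun \<Omega> \<psi>" for \<psi>
    proof (rule weak_form_dense[OF elim(3,7) K(1) elim(4) tt \<psi>])
      fix e :: real assume "0 < e"
      from D(3)[OF \<psi> this] D(2) elim(2)
      show "\<exists>d. test_fun \<Omega> d \<and> ut_pairing d t = - flux d t \<and>
        (\<forall>x\<in>\<Omega>. \<bar>\<psi> x - d x\<bar> < e \<and> norm (grad \<psi> x - grad d x) < e)" by blast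
    qed
    ultimately show ?case using elim(3-5) tt by (simp add: good_def)
  qed
  with K(1) show thesis by (rule that)
qed

end

definition sat_deriv :: "real \<Rightarrow> nat \<Rightarrow> real \<Rightarrow> real" where
  "sat_deriv R p s = real p * sat R s ^ (p - 1) * sat' R s"

lemma sat_deriv_DERIV: "0 < R \<Longrightarrow> ((\<lambda>s. sat R s ^ p) has_real_derivative sat_deriv R p s) (at s)"
  unfolding sat_deriv_def by (rule sat_power_DERIV)

lemma continuous_sat: "0 < R \<Longrightarrow> continuous_on UNIV (\<lambda>s. sat R s ^ p)"
  by (rule DERIV_continuous_on[where s=UNIV, OF has_field_derivative_at_within[OF sat_deriv_DERIV]])

lemma continuous_sat_deriv: "0 < R \<Longrightarrow> continuous_on UNIV (sat_deriv R p)"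
proof -
  assume R: "0 < R"
  have nz: "s\<^sup>2 + R \<noteq> 0" for s :: real using R by (metis add_nonneg_pos less_irrefl zero_le_power2)
  have "continuous_on UNIV (sat' R)"
    unfolding sat'_def[abs_def] using nz by (intro continuous_intros) auto
  then show ?thesis unfolding sat_deriv_def[abs_def] 
    by (intro continuous_on_mult continuous_on_const continuous_sat[OF R])
qed

lemma sat_power_bounds: "0 < R \<Longrightarrow> 0 \<le> sat R s ^ p" "0 < R \<Longrightarrow> sat R s ^ p \<le> 1"
  using sat_bounds by (auto intro: power_le_one)

lemma sat_deriv_bound: "0 < R \<Longrightarrow> \<bar>sat_deriv R p s\<bar> \<le> real p / sqrt R"
proof -
  assume R: "0 < R"
  have "real p * (\<bar>sat R s ^ (p - 1)\<bar> * \<bar>sat' R s\<bar>) \<le> real p * (1 * (1 / sqrt R))"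
    using sat_power_bounds[OF R, of s "p - 1"] sat'_bound[OF R, of s] by (intro mult_left_mono mult_mono) auto
  then show ?thesis by (simp add: sat_deriv_def abs_mult mult.assoc)
qed

lemma sat_deriv_mult_nonneg: "0 < R \<Longrightarrow> 0 \<le> s * sat_deriv R p s"
proof -
  assume R: "0 < R"
  have "s * sat_deriv R p s = real p * sat R s ^ (p - 1) * (s * sat' R s)" by (simp add: sat_deriv_def)
  also have "0 \<le> \<dots>" 
    by (rule mult_nonneg_nonneg[OF mult_nonneg_nonneg[OF _ sat_power_bounds(1)[OF R]] sat_sat'(2)[OF R]]) simp
  finally show ?thesis .
qed

lemma continuous_compose_measurable:
  fixes g :: "real \<Rightarrow> real"
  assumes "continuous_on UNIV g" "f \<in> borel_measurable M"
  shows "(\<lambda>x. g (f x)) \<in> borel_measurable M"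
  by (rule measurable_compose[OF assms(2) borel_measurable_continuous_onI[OF assms(1)]])

context degenerate_flow
begin

lemma goodD:
  assumes "good K t"
  shows "t \<in> tint T" "W012 \<Omega> (\<lambda>x. u x t) (\<lambda>x. Du x t)"
    "AE x in lebesgue_on \<Omega>. 0 < u x t \<and> u x t \<le> K"
    "integrable (lebesgue_on \<Omega>) (\<lambda>x. ut x t)" "integrable (lebesgue_on \<Omega>) (\<lambda>x. (ut x t)\<^sup>2)"
    "\<And>\<psi>. test_fun \<Omega> \<psi> \<Longrightarrow> ut_pairing \<psi> t = - flux \<psi> t"
    "(\<lambda>x. u x t) \<in> borel_measurable (lebesgue_on \<Omega>)" "(\<lambda>x. Du x t) \<in> borel_measurable (lebesgue_on \<Omega>)"
    "integrable (lebesgue_on \<Omega>) (\<lambda>x. (norm (Du x t))\<^sup>2)" "integrable (lebesgue_on \<Omega>) (\<lambda>x. (u x t)\<^sup>2)"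
  using assms by (auto simp: good_def W012_def L2_def)

lemma AE_convergent_test_functions:
  assumes "good K t"
  obtains w where "\<And>n. test_fun \<Omega> (w n)" "AE x in lebesgue_on \<Omega>. (\<lambda>n. w n x) \<longlonglongrightarrow> u x t"
    "\<And>n. integrable (lebesgue_on \<Omega>) (\<lambda>x. (norm (grad (w n) x - Du x t))\<^sup>2)"
    "(\<lambda>n. integral\<^sup>L (lebesgue_on \<Omega>) (\<lambda>x. (norm (grad (w n) x - Du x t))\<^sup>2)) \<longlonglongrightarrow> 0"
    "\<And>n. integrable (lebesgue_on \<Omega>) (\<lambda>x. (w n x - u x t)\<^sup>2)"
    "(\<lambda>n. integral\<^sup>L (lebesgue_on \<Omega>) (\<lambda>x. (w n x - u x t)\<^sup>2)) \<longlonglongrightarrow> 0"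
proof -
  interpret finite_measure "lebesgue_on \<Omega>" by (rule finite_dom)
  note g = goodD[OF assms]
  note [measurable] = g(7,8)
  obtain \<phi> where \<phi>: "\<And>k. test_fun \<Omega> (\<phi> k)"
    and l1: "(\<lambda>k. integral\<^sup>L (lebesgue_on \<Omega>) (\<lambda>x. (\<phi> k x - u x t)\<^sup>2)) \<longlonglongrightarrow> 0"
    and l2: "(\<lambda>k. integral\<^sup>L (lebesgue_on \<Omega>) (\<lambda>x. (norm (grad (\<phi> k) x - Du x t))\<^sup>2)) \<longlonglongrightarrow> 0"
    using g(2) unfolding W012_def by blast
  have sq: "(a + b)\<^sup>2 \<le> 2 * a\<^sup>2 + 2 * b\<^sup>2" for a b :: real
    using sum_squares_bound[of a b] by (simp add: power2_sum)
  have i1: "integrable (lebesgue_on \<Omega>) (\<lambda>x. (\<phi> k x - u x t)\<^sup>2)" for k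
  proof -
    obtain B where B: "0 < B" "\<And>x. \<bar>\<phi> k x\<bar> \<le> B" "\<And>x. norm (grad (\<phi> k) x) \<le> B"
      using test_fun_bounded[OF \<phi>[of k]] by blast
    have [measurable]: "\<phi> k \<in> borel_measurable (lebesgue_on \<Omega>)"
      by (rule continuous_measurable_lebesgue_on[OF test_funD(2)[OF \<phi>]])
    show ?thesis
    proof (rule Bochner_Integration.integrable_bound)
      show "integrable (lebesgue_on \<Omega>) (\<lambda>x. 2 * B\<^sup>2 + 2 * (u x t)\<^sup>2)"
        using g(10) by (intro Bochner_Integration.integrable_add integrable_mult_right) auto
      have "(\<phi> k x - u x t)\<^sup>2 \<le> 2 * B\<^sup>2 + 2 * (u x t)\<^sup>2" for x
      proof -
        have "(\<phi> k x - u x t)\<^sup>2 \<le> 2 * (\<phi> k x)\<^sup>2 + 2 * (u x t)\<^sup>2" using sq[of "\<phi> k x" "- u x t"] by simp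
        moreover have "(\<phi> k x)\<^sup>2 \<le> B\<^sup>2" using B(2)[of x] by (metis abs_ge_zero power2_abs power_mono)
        ultimately show ?thesis by linarith
      qed
      then show "AE x in lebesgue_on \<Omega>. norm ((\<phi> k x - u x t)\<^sup>2) \<le> norm (2 * B\<^sup>2 + 2 * (u x t)\<^sup>2)" by simp
    qed measurable
  qed
  have i2: "integrable (lebesgue_on \<Omega>) (\<lambda>x. (norm (grad (\<phi> k) x - Du x t))\<^sup>2)" for k
  proof -
    obtain B where B: "0 < B" "\<And>x. \<bar>\<phi> k x\<bar> \<le> B" "\<And>x. norm (grad (\<phi> k) x) \<le> B"
      using test_fun_bounded[OF \<phi>[of k]] by blast
    have [measurable]: "grad (\<phi> k) \<in> borel_measurable (lebesgue_on \<Omega>)"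
      by (rule continuous_measurable_lebesgue_on[OF test_funD(3)[OF \<phi>]])
    show ?thesis
    proof (rule Bochner_Integration.integrable_bound)
      show "integrable (lebesgue_on \<Omega>) (\<lambda>x. 2 * B\<^sup>2 + 2 * (norm (Du x t))\<^sup>2)"
        using g(9) by (intro Bochner_Integration.integrable_add integrable_mult_right) auto
      have "(norm (grad (\<phi> k) x - Du x t))\<^sup>2 \<le> 2 * B\<^sup>2 + 2 * (norm (Du x t))\<^sup>2" for x
      proof -
        have "(norm (grad (\<phi> k) x - Du x t))\<^sup>2 \<le> (B + norm (Du x t))\<^sup>2"
          using norm_triangle_ineq4[of "grad (\<phi> k) x" "Du x t"] B(3)[of x] by (intro power_mono) auto
        then show ?thesis using sq[of B "norm (Du x t)"] by linarith
      qed
      then show "AE x in lebesgue_on \<Omega>. norm ((norm (grad (\<phi> k) x - Du x t))\<^sup>2) \<le> norm (2 * B\<^sup>2 + 2 * (norm (Du x t))\<^sup>2)"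
        by simp
    qed measurable
  qed
  have "(\<lambda>k. integral\<^sup>L (lebesgue_on \<Omega>) (\<lambda>x. norm ((\<phi> k x - u x t)\<^sup>2))) \<longlonglongrightarrow> 0" using l1 by simp
  from tendsto_L1_AE_subseq[OF i1 this] obtain r :: "nat \<Rightarrow> nat" where r: "strict_mono r"
    "AE x in lebesgue_on \<Omega>. (\<lambda>n. (\<phi> (r n) x - u x t)\<^sup>2) \<longlonglongrightarrow> 0" by blast
  have "AE x in lebesgue_on \<Omega>. (\<lambda>n. \<phi> (r n) x) \<longlonglongrightarrow> u x t"
    using r(2)
  proof eventually_elim
    case (elim x)
    have "(\<lambda>n. sqrt ((\<phi> (r n) x - u x t)\<^sup>2)) \<longlonglongrightarrow> sqrt 0" using elim by (rule tendsto_real_sqrt)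
    then have "(\<lambda>n. \<bar>\<phi> (r n) x - u x t\<bar>) \<longlonglongrightarrow> 0" by simp
    then have "(\<lambda>n. \<phi> (r n) x - u x t) \<longlonglongrightarrow> 0" by (rule tendsto_rabs_zero_cancel)
    then show ?case by (rule LIM_zero_cancel)
  qed
  then show thesis
    by (rule that[where w="\<lambda>n. \<phi> (r n)", OF \<phi> _ i2 LIMSEQ_subseq_LIMSEQ[OF l2 r(1), unfolded comp_def]
          i1 LIMSEQ_subseq_LIMSEQ[OF l1 r(1), unfolded comp_def]])
qed

lemma test_with_sat:
  assumes gd: "good K t" and K: "0 < K" and R: "0 < R" and p: "0 < p"
  shows "integral\<^sup>L (lebesgue_on \<Omega>) (\<lambda>x. ut x t * sat R (u x t) ^ p)
    + integral\<^sup>L (lebesgue_on \<Omega>) (\<lambda>x. (sat R (u x t) ^ p + u x t * sat_deriv R p (u x t)) * (norm (Du x t))\<^sup>2)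
    = energy t * integral\<^sup>L (lebesgue_on \<Omega>) (\<lambda>x. u x t * sat R (u x t) ^ p)"
proof -
  let ?M = "lebesgue_on \<Omega>"
  interpret finite_measure ?M by (rule finite_dom)
  note g = goodD[OF gd]
  note [measurable] = g(7,8) borel_measurable_integrable[OF g(4)]
  obtain w where w: "\<And>n. test_fun \<Omega> (w n)" "AE x in ?M. (\<lambda>n. w n x) \<longlonglongrightarrow> u x t"
    and e: "\<And>n. integrable ?M (\<lambda>x. (norm (grad (w n) x - Du x t))\<^sup>2)"
    "(\<lambda>n. integral\<^sup>L ?M (\<lambda>x. (norm (grad (w n) x - Du x t))\<^sup>2)) \<longlonglongrightarrow> 0"
    by (rule AE_convergent_test_functions[OF gd]) blast
  have [measurable]: "w n \<in> borel_measurable ?M" "grad (w n) \<in> borel_measurable ?M" for n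
    using continuous_measurable_lebesgue_on[OF test_funD(2)[OF w(1)]]
      continuous_measurable_lebesgue_on[OF test_funD(3)[OF w(1)]] by auto
  let ?G = "\<lambda>s. sat R s ^ p" and ?G' = "sat_deriv R p"
  define C where "C = real p / sqrt R"
  have C: "0 \<le> C" "\<And>s. \<bar>?G' s\<bar> \<le> C" using R sat_deriv_bound[OF R] by (auto simp: C_def)
  have Gb: "\<bar>?G s\<bar> \<le> 1" for s using sat_power_bounds[OF R, of s p] by auto
  have [measurable]: "(\<lambda>x. ?G (f x)) \<in> borel_measurable ?M" "(\<lambda>x. ?G' (f x)) \<in> borel_measurable ?M"
    if "f \<in> borel_measurable ?M" for f
    using continuous_compose_measurable[OF continuous_sat[OF R] that]
      continuous_compose_measurable[OF continuous_sat_deriv[OF R] that] by auto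
  have Gl: "AE x in ?M. (\<lambda>n. ?G (w n x)) \<longlonglongrightarrow> ?G (u x t) \<and> (\<lambda>n. ?G' (w n x)) \<longlonglongrightarrow> ?G' (u x t)"
    using w(2)
  proof eventually_elim
    case (elim x)
    show ?case
      using continuous_on_tendsto_compose[OF continuous_sat[OF R, of p] elim]
        continuous_on_tendsto_compose[OF continuous_sat_deriv[OF R, of p] elim] by simp
  qed
  have tf: "test_fun \<Omega> (\<lambda>x. ?G (w n x))" for n by (rule test_fun_sat[OF w(1) R p])
  have gr: "grad (\<lambda>x. ?G (w n x)) x = ?G' (w n x) *\<^sub>R grad (w n) x" for n x
    by (rule grad_compose[OF test_funD(1)[OF w(1)] sat_deriv_DERIV[OF R]])
  have ub: "AE x in ?M. 0 \<le> u x t \<and> u x t \<le> K" using g(3) by eventually_elim auto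
  let ?B = "\<lambda>n x. u x t * ?G' (w n x) * (Du x t \<bullet> (grad (w n) x - Du x t))"
  let ?A = "\<lambda>n x. (?G (w n x) + u x t * ?G' (w n x)) * (norm (Du x t))\<^sup>2"
  have L1: "(\<lambda>n. integral\<^sup>L ?M (\<lambda>x. ut x t * ?G (w n x))) \<longlonglongrightarrow> integral\<^sup>L ?M (\<lambda>x. ut x t * ?G (u x t))"
  proof (rule integral_dominated_convergence[where w="\<lambda>x. \<bar>ut x t\<bar>"])
    show "AE x in ?M. (\<lambda>n. ut x t * ?G (w n x)) \<longlonglongrightarrow> ut x t * ?G (u x t)"
      using Gl by eventually_elim (auto intro: tendsto_intros)
    show "AE x in ?M. norm (ut x t * ?G (w n x)) \<le> \<bar>ut x t\<bar>" for n
      using Gb by (auto simp: abs_mult intro!: mult_left_le)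
  qed (use g(4) in auto)
  have L3: "(\<lambda>n. integral\<^sup>L ?M (\<lambda>x. u x t * ?G (w n x))) \<longlonglongrightarrow> integral\<^sup>L ?M (\<lambda>x. u x t * ?G (u x t))"
  proof (rule integral_dominated_convergence[where w="\<lambda>x. \<bar>u x t\<bar>"])
    show "AE x in ?M. (\<lambda>n. u x t * ?G (w n x)) \<longlonglongrightarrow> u x t * ?G (u x t)"
      using Gl by eventually_elim (auto intro: tendsto_intros)
    show "AE x in ?M. norm (u x t * ?G (w n x)) \<le> \<bar>u x t\<bar>" for n
      using Gb by (auto simp: abs_mult intro!: mult_left_le)
  qed (use u_integrable[OF g(1)] in auto)
  have Abd: "AE x in ?M. norm (?A n x) \<le> (1 + K * C) * (norm (Du x t))\<^sup>2" for n
    using ub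
  proof eventually_elim
    case (elim x)
    have "\<bar>?G (w n x) + u x t * ?G' (w n x)\<bar> \<le> \<bar>?G (w n x)\<bar> + \<bar>u x t\<bar> * \<bar>?G' (w n x)\<bar>"
      unfolding abs_mult[symmetric] by (rule abs_triangle_ineq)
    also have "\<dots> \<le> 1 + K * C" using elim Gb[of "w n x"] C(2)[of "w n x"] K by (intro add_mono mult_mono) auto
    finally show ?case by (simp add: abs_mult mult_right_mono)
  qed
  have L2: "(\<lambda>n. integral\<^sup>L ?M (?A n)) \<longlonglongrightarrow> integral\<^sup>L ?M (\<lambda>x. (?G (u x t) + u x t * ?G' (u x t)) * (norm (Du x t))\<^sup>2)"
  proof (rule integral_dominated_convergence[where w="\<lambda>x. (1 + K * C) * (norm (Du x t))\<^sup>2"])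
    show "AE x in ?M. (\<lambda>n. ?A n x) \<longlonglongrightarrow> (?G (u x t) + u x t * ?G' (u x t)) * (norm (Du x t))\<^sup>2"
      using Gl by eventually_elim (auto intro!: tendsto_intros)
    show "integrable ?M (\<lambda>x. (1 + K * C) * (norm (Du x t))\<^sup>2)" using g(9) by simp
    show "AE x in ?M. norm (?A n x) \<le> (1 + K * C) * (norm (Du x t))\<^sup>2" for n by (rule Abd)
  qed measurable
  have Ai: "integrable ?M (?A n)" for n
  proof (rule Bochner_Integration.integrable_bound)
    show "integrable ?M (\<lambda>x. (1 + K * C) * (norm (Du x t))\<^sup>2)" using g(9) by simp
    show "AE x in ?M. norm (?A n x) \<le> norm ((1 + K * C) * (norm (Du x t))\<^sup>2)"
      using Abd[of n] by eventually_elim (use K C in auto)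
  qed measurable
  define F where "F n = integral\<^sup>L ?M (\<lambda>x. (norm (grad (w n) x - Du x t))\<^sup>2)" for n
  have CS: "integrable ?M (\<lambda>x. norm (Du x t) * norm (grad (w n) x - Du x t))"
    "integral\<^sup>L ?M (\<lambda>x. \<bar>norm (Du x t) * norm (grad (w n) x - Du x t)\<bar>) \<le> sqrt (energy t) * sqrt (F n)" for n
    using Cauchy_Schwarz_integral[OF _ _ g(9) e(1)[of n]] unfolding energy_def F_def by auto
  have Bbd: "AE x in ?M. \<bar>?B n x\<bar> \<le> K * C * (norm (Du x t) * norm (grad (w n) x - Du x t))" for n
    using ub
  proof eventually_elim
    case (elim x)
    have "\<bar>u x t\<bar> * \<bar>?G' (w n x)\<bar> * \<bar>Du x t \<bullet> (grad (w n) x - Du x t)\<bar> \<le> K * C * (norm (Du x t) * norm (grad (w n) x - Du x t))"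
      using elim C K by (intro mult_mono Cauchy_Schwarz_ineq2) auto
    then show ?case by (simp add: abs_mult)
  qed
  have Bi: "integrable ?M (?B n)" for n
  proof (rule Bochner_Integration.integrable_bound)
    show "integrable ?M (\<lambda>x. K * C * (norm (Du x t) * norm (grad (w n) x - Du x t)))" using CS(1) by simp
    show "AE x in ?M. norm (?B n x) \<le> norm (K * C * (norm (Du x t) * norm (grad (w n) x - Du x t)))"
      using Bbd[of n] by eventually_elim (use K C in auto)
  qed measurable
  have L4: "(\<lambda>n. integral\<^sup>L ?M (?B n)) \<longlonglongrightarrow> 0"
  proof (rule Lim_null_comparison)
    show "\<forall>\<^sub>F n in sequentially. norm (integral\<^sup>L ?M (?B n)) \<le> K * C * (sqrt (energy t) * sqrt (F n))"
    proof (rule always_eventually, rule allI)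
      fix n
      have "\<bar>integral\<^sup>L ?M (?B n)\<bar> \<le> integral\<^sup>L ?M (\<lambda>x. \<bar>?B n x\<bar>)" by (rule integral_abs_bound)
      also have "\<dots> \<le> integral\<^sup>L ?M (\<lambda>x. K * C * (norm (Du x t) * norm (grad (w n) x - Du x t)))"
        by (rule integral_mono_AE[OF integrable_abs[OF Bi] integrable_mult_right[OF CS(1)] Bbd])
      also have "\<dots> \<le> K * C * (sqrt (energy t) * sqrt (F n))"
        using CS(2)[of n] K C by (simp add: mult_left_mono)
      finally show "norm (integral\<^sup>L ?M (?B n)) \<le> K * C * (sqrt (energy t) * sqrt (F n))" by simp
    qed
    have "F \<longlonglongrightarrow> 0" using e(2) by (simp add: F_def[abs_def])
    then have "(\<lambda>n. K * C * (sqrt (energy t) * sqrt (F n))) \<longlonglongrightarrow> K * C * (sqrt (energy t) * sqrt 0)"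
      by (intro tendsto_intros)
    then show "(\<lambda>n. K * C * (sqrt (energy t) * sqrt (F n))) \<longlonglongrightarrow> 0" by simp
  qed
  have eq: "integral\<^sup>L ?M (\<lambda>x. ut x t * ?G (w n x)) + (integral\<^sup>L ?M (?A n) + integral\<^sup>L ?M (?B n))
      - integral\<^sup>L ?M (\<lambda>x. u x t * ?G (w n x)) * energy t = 0" for n
  proof -
    have "integral\<^sup>L ?M (?A n) + integral\<^sup>L ?M (?B n) = integral\<^sup>L ?M (\<lambda>x. ?A n x + ?B n x)"
      by (rule Bochner_Integration.integral_add[symmetric, OF Ai Bi])
    also have "(\<lambda>x. ?A n x + ?B n x) =
        (\<lambda>x. ?G (w n x) * (norm (Du x t))\<^sup>2 + u x t * (Du x t \<bullet> grad (\<lambda>x. ?G (w n x)) x))"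
      unfolding gr by (rule ext) (simp add: inner_diff_right power2_norm_eq_inner algebra_simps)
    finally show ?thesis
      using g(6)[OF tf[of n]] by (simp add: ut_pairing_def flux_def pairing_def)
  qed
  have "(\<lambda>n. integral\<^sup>L ?M (\<lambda>x. ut x t * ?G (w n x)) + (integral\<^sup>L ?M (?A n) + integral\<^sup>L ?M (?B n))
      - integral\<^sup>L ?M (\<lambda>x. u x t * ?G (w n x)) * energy t) \<longlonglongrightarrow>
      integral\<^sup>L ?M (\<lambda>x. ut x t * ?G (u x t)) +
      (integral\<^sup>L ?M (\<lambda>x. (?G (u x t) + u x t * ?G' (u x t)) * (norm (Du x t))\<^sup>2) + 0)
      - integral\<^sup>L ?M (\<lambda>x. u x t * ?G (u x t)) * energy t"
    by (intro tendsto_diff tendsto_add tendsto_mult L1 L2 L3 L4 tendsto_const)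
  then have "(\<lambda>n::nat. 0::real) \<longlonglongrightarrow>
      integral\<^sup>L ?M (\<lambda>x. ut x t * ?G (u x t)) +
      (integral\<^sup>L ?M (\<lambda>x. (?G (u x t) + u x t * ?G' (u x t)) * (norm (Du x t))\<^sup>2) + 0)
      - integral\<^sup>L ?M (\<lambda>x. u x t * ?G (u x t)) * energy t"
    unfolding eq .
  then show ?thesis by (simp add: LIMSEQ_const_iff algebra_simps)
qed

lemma test_with_sat_le:
  assumes gd: "good K t" and K: "0 < K" and R: "0 < R" and p: "0 < p"
  shows "integral\<^sup>L (lebesgue_on \<Omega>) (\<lambda>x. ut x t * sat R (u x t) ^ p)
    \<le> energy t * integral\<^sup>L (lebesgue_on \<Omega>) (\<lambda>x. u x t * sat R (u x t) ^ p)"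
proof -
  have "0 \<le> integral\<^sup>L (lebesgue_on \<Omega>) (\<lambda>x. (sat R (u x t) ^ p + u x t * sat_deriv R p (u x t)) * (norm (Du x t))\<^sup>2)"
    by (intro Bochner_Integration.integral_nonneg mult_nonneg_nonneg add_nonneg_nonneg
        sat_power_bounds(1)[OF R] sat_deriv_mult_nonneg[OF R]) auto
  then show ?thesis using test_with_sat[OF assms] by linarith
qed

lemma sat_tendsto_1:
  assumes "0 < s"
  shows "(\<lambda>n. sat (1 / Suc n) s) \<longlonglongrightarrow> 1" "(\<lambda>n. s * sat' (1 / Suc n) s) \<longlonglongrightarrow> 0"
proof -
  have z: "(\<lambda>n. 1 / real (Suc n)) \<longlonglongrightarrow> 0" using LIMSEQ_Suc[OF lim_1_over_n] by simp
  have "(\<lambda>n. s\<^sup>2 / (s\<^sup>2 + 1 / Suc n)) \<longlonglongrightarrow> s\<^sup>2 / (s\<^sup>2 + 0)"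
    using assms by (intro tendsto_intros z) auto
  then show "(\<lambda>n. sat (1 / Suc n) s) \<longlonglongrightarrow> 1" using assms by (simp add: sat_def)
  have "(\<lambda>n. s * (2 * (1 / Suc n) * s / (s\<^sup>2 + 1 / Suc n)\<^sup>2)) \<longlonglongrightarrow> s * (2 * 0 * s / (s\<^sup>2 + 0)\<^sup>2)"
    using assms by (intro tendsto_intros z) auto
  then show "(\<lambda>n. s * sat' (1 / Suc n) s) \<longlonglongrightarrow> 0" by (simp add: sat'_def)
qed

lemma integral_ut:
  assumes gd: "good K t" and K: "0 < K"
  shows "integral\<^sup>L (lebesgue_on \<Omega>) (\<lambda>x. ut x t) = (mass t - 1) * energy t"
proof -
  let ?M = "lebesgue_on \<Omega>"
  note g = goodD[OF gd]
  note [measurable] = g(7,8) borel_measurable_integrable[OF g(4)]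
  define R where "R n = 1 / real (Suc n)" for n
  have R: "0 < R n" for n by (simp add: R_def)
  have sd: "sat_deriv r 1 s = sat' r s" for r s by (simp add: sat_deriv_def)
  have sb: "0 \<le> sat (R n) s" "sat (R n) s \<le> 1" for n s using sat_bounds[OF R] by auto
  have [measurable]: "(\<lambda>x. sat (R n) (u x t)) \<in> borel_measurable ?M" "(\<lambda>x. sat' (R n) (u x t)) \<in> borel_measurable ?M" for n
    using continuous_compose_measurable[OF continuous_sat[OF R, of n 1] g(7)]
      continuous_compose_measurable[OF continuous_sat_deriv[OF R, of n 1] g(7)]
    unfolding sd power_one_right by blast+
  have l: "AE x in ?M. (\<lambda>n. sat (R n) (u x t)) \<longlonglongrightarrow> 1 \<and> (\<lambda>n. u x t * sat' (R n) (u x t)) \<longlonglongrightarrow> 0"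
    using g(3) unfolding R_def by eventually_elim (intro conjI sat_tendsto_1; simp)
  have L1: "(\<lambda>n. integral\<^sup>L ?M (\<lambda>x. ut x t * sat (R n) (u x t) ^ 1)) \<longlonglongrightarrow> integral\<^sup>L ?M (\<lambda>x. ut x t)"
  proof (rule integral_dominated_convergence[where w="\<lambda>x. \<bar>ut x t\<bar>"])
    show "AE x in ?M. (\<lambda>n. ut x t * sat (R n) (u x t) ^ 1) \<longlonglongrightarrow> ut x t"
      using l
    proof eventually_elim
      case (elim x)
      then have "(\<lambda>n. ut x t * sat (R n) (u x t)) \<longlonglongrightarrow> ut x t * 1" by (intro tendsto_mult tendsto_const) auto
      then show ?case by simp
    qed
    show "AE x in ?M. norm (ut x t * sat (R n) (u x t) ^ 1) \<le> \<bar>ut x t\<bar>" for n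
      using sb by (auto simp: abs_mult intro!: mult_left_le)
  qed (use g(4) in auto)
  have L3: "(\<lambda>n. integral\<^sup>L ?M (\<lambda>x. u x t * sat (R n) (u x t) ^ 1)) \<longlonglongrightarrow> integral\<^sup>L ?M (\<lambda>x. u x t)"
  proof (rule integral_dominated_convergence[where w="\<lambda>x. \<bar>u x t\<bar>"])
    show "AE x in ?M. (\<lambda>n. u x t * sat (R n) (u x t) ^ 1) \<longlonglongrightarrow> u x t"
      using l
    proof eventually_elim
      case (elim x)
      then have "(\<lambda>n. u x t * sat (R n) (u x t)) \<longlonglongrightarrow> u x t * 1" by (intro tendsto_mult tendsto_const) auto
      then show ?case by simp
    qed
    show "AE x in ?M. norm (u x t * sat (R n) (u x t) ^ 1) \<le> \<bar>u x t\<bar>" for n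
      using sb by (auto simp: abs_mult intro!: mult_left_le)
  qed (use u_integrable[OF g(1)] in auto)
  have L2: "(\<lambda>n. integral\<^sup>L ?M (\<lambda>x. (sat (R n) (u x t) ^ 1 + u x t * sat_deriv (R n) 1 (u x t)) * (norm (Du x t))\<^sup>2))
      \<longlonglongrightarrow> integral\<^sup>L ?M (\<lambda>x. (norm (Du x t))\<^sup>2)"
    unfolding sd power_one_right
  proof (rule integral_dominated_convergence[where w="\<lambda>x. 2 * (norm (Du x t))\<^sup>2"])
    show "AE x in ?M. (\<lambda>n. (sat (R n) (u x t) + u x t * sat' (R n) (u x t)) * (norm (Du x t))\<^sup>2) \<longlonglongrightarrow> (norm (Du x t))\<^sup>2"
      using l
    proof eventually_elim
      case (elim x)
      then have "(\<lambda>n. (sat (R n) (u x t) + u x t * sat' (R n) (u x t)) * (norm (Du x t))\<^sup>2) \<longlonglongrightarrow> (1 + 0) * (norm (Du x t))\<^sup>2"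
        by (intro tendsto_mult tendsto_add tendsto_const) auto
      then show ?case by simp
    qed
    have "\<bar>sat (R n) (u x t) + u x t * sat' (R n) (u x t)\<bar> \<le> 2" for x n
      using sb[of n "u x t"] sat_sat'(2,3)[OF R, of "u x t" n] by linarith
    then show "AE x in ?M. norm ((sat (R n) (u x t) + u x t * sat' (R n) (u x t)) * (norm (Du x t))\<^sup>2) \<le> 2 * (norm (Du x t))\<^sup>2" for n
      by (auto simp: abs_mult intro!: mult_right_mono)
  qed (use g(9) in auto)
  have "(\<lambda>n. integral\<^sup>L ?M (\<lambda>x. ut x t * sat (R n) (u x t) ^ 1)
      + integral\<^sup>L ?M (\<lambda>x. (sat (R n) (u x t) ^ 1 + u x t * sat_deriv (R n) 1 (u x t)) * (norm (Du x t))\<^sup>2))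
      \<longlonglongrightarrow> integral\<^sup>L ?M (\<lambda>x. ut x t) + integral\<^sup>L ?M (\<lambda>x. (norm (Du x t))\<^sup>2)"
    by (intro tendsto_add L1 L2)
  moreover have "(\<lambda>n. energy t * integral\<^sup>L ?M (\<lambda>x. u x t * sat (R n) (u x t) ^ 1)) \<longlonglongrightarrow> energy t * mass t"
    unfolding mass_def by (intro tendsto_mult tendsto_const L3)
  ultimately have "integral\<^sup>L ?M (\<lambda>x. ut x t) + integral\<^sup>L ?M (\<lambda>x. (norm (Du x t))\<^sup>2) = energy t * mass t"
    unfolding test_with_sat[OF gd K R zero_less_one] by (rule LIMSEQ_unique)
  then show ?thesis by (simp add: energy_def algebra_simps)
qed

lemma poincare:
  obtains C where "0 < C" "\<And>K t. good K t \<Longrightarrow> (mass t)\<^sup>2 \<le> C * energy t"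
proof -
  let ?M = "lebesgue_on \<Omega>"
  interpret finite_measure ?M by (rule finite_dom)
  obtain r where r: "0 < r" "\<And>x. x \<in> \<Omega> \<Longrightarrow> norm x \<le> r"
    using bounded_dom by (auto simp: bounded_pos)
  obtain i :: 'a where i: "i \<in> Basis" using nonempty_Basis by blast
  have xi: "\<bar>x \<bullet> i\<bar> \<le> r" if "x \<in> \<Omega>" for x
    using Basis_le_norm[OF i, of x] r(2)[OF that] by linarith
  let ?m = "measure ?M (space ?M)"
  have bound: "(mass t)\<^sup>2 \<le> (?m + 1) * (4 * r\<^sup>2) * energy t" if gd: "good K t" for K t
  proof -
    note g = goodD[OF gd]
    note [measurable] = g(7,8)
    have [measurable]: "(\<lambda>x. x \<bullet> i) \<in> borel_measurable ?M"
      by (intro continuous_measurable_lebesgue_on continuous_intros)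
    obtain w where w: "\<And>n. test_fun \<Omega> (w n)"
      and e: "\<And>n. integrable ?M (\<lambda>x. (norm (grad (w n) x - Du x t))\<^sup>2)"
      "(\<lambda>n. integral\<^sup>L ?M (\<lambda>x. (norm (grad (w n) x - Du x t))\<^sup>2)) \<longlonglongrightarrow> 0"
      and d: "\<And>n. integrable ?M (\<lambda>x. (w n x - u x t)\<^sup>2)"
      "(\<lambda>n. integral\<^sup>L ?M (\<lambda>x. (w n x - u x t)\<^sup>2)) \<longlonglongrightarrow> 0"
      by (rule AE_convergent_test_functions[OF gd]) blast
    have [measurable]: "w n \<in> borel_measurable ?M" "grad (w n) \<in> borel_measurable ?M" for n
      using continuous_measurable_lebesgue_on[OF test_funD(2)[OF w(1)]]
        continuous_measurable_lebesgue_on[OF test_funD(3)[OF w(1)]] by auto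
    define U where "U = integral\<^sup>L ?M (\<lambda>x. (u x t)\<^sup>2)"
    define E where "E n = integral\<^sup>L ?M (\<lambda>x. (w n x - u x t)\<^sup>2)" for n
    define F where "F n = integral\<^sup>L ?M (\<lambda>x. (norm (grad (w n) x - Du x t))\<^sup>2)" for n
    have wg: "weak_gradient \<Omega> (\<lambda>x. u x t) (\<lambda>x. Du x t)" using g(2) by (simp add: W012_def)
    have est: "integrable ?M (\<lambda>x. f x * h x) \<and> \<bar>integral\<^sup>L ?M (\<lambda>x. f x * h x)\<bar> \<le> B * (sqrt (integral\<^sup>L ?M (\<lambda>x. (a x)\<^sup>2)) * sqrt (integral\<^sup>L ?M (\<lambda>x. (b x)\<^sup>2)))"
      if m: "a \<in> borel_measurable ?M" "b \<in> borel_measurable ?M" "(\<lambda>x. f x * h x) \<in> borel_measurable ?M"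
        and ii: "integrable ?M (\<lambda>x. (a x)\<^sup>2)" "integrable ?M (\<lambda>x. (b x)\<^sup>2)" and B: "0 \<le> B"
        and le: "\<And>x. x \<in> \<Omega> \<Longrightarrow> \<bar>f x * h x\<bar> \<le> B * \<bar>a x * b x\<bar>" for f h a b :: "'a \<Rightarrow> real" and B
    proof -
      note cs = Cauchy_Schwarz_integral[OF m(1,2) ii]
      have bi: "integrable ?M (\<lambda>x. B * \<bar>a x * b x\<bar>)" by (intro integrable_mult_right integrable_abs cs(1))
      have fi: "integrable ?M (\<lambda>x. f x * h x)"
        by (rule Bochner_Integration.integrable_bound[OF bi m(3)]) (use le B in \<open>auto intro!: AE_I2 simp: abs_mult\<close>)
      have "\<bar>integral\<^sup>L ?M (\<lambda>x. f x * h x)\<bar> \<le> integral\<^sup>L ?M (\<lambda>x. B * \<bar>a x * b x\<bar>)"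
        by (rule integral_abs_bound_integral[OF fi bi]) (use le in auto)
      also have "\<dots> = B * integral\<^sup>L ?M (\<lambda>x. \<bar>a x * b x\<bar>)" by simp
      also have "\<dots> \<le> B * (sqrt (integral\<^sup>L ?M (\<lambda>x. (a x)\<^sup>2)) * sqrt (integral\<^sup>L ?M (\<lambda>x. (b x)\<^sup>2)))"
        by (rule mult_left_mono[OF cs(2) B])
      finally show ?thesis using fi by blast
    qed
    have P1: "integrable ?M (\<lambda>x. u x t * (w n x - u x t)) \<and>
        \<bar>integral\<^sup>L ?M (\<lambda>x. u x t * (w n x - u x t))\<bar> \<le> 1 * (sqrt U * sqrt (E n))" for n
      unfolding U_def E_def by (rule est[OF _ _ _ g(10) d(1)]) auto
    have P2: "integrable ?M (\<lambda>x. u x t * ((x \<bullet> i) * ((grad (w n) x - Du x t) \<bullet> i))) \<and>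
        \<bar>integral\<^sup>L ?M (\<lambda>x. u x t * ((x \<bullet> i) * ((grad (w n) x - Du x t) \<bullet> i)))\<bar> \<le> r * (sqrt U * sqrt (F n))" for n
      unfolding U_def F_def
    proof (rule est[OF _ _ _ g(10) e(1)])
      fix x assume x: "x \<in> \<Omega>"
      have "\<bar>u x t\<bar> * (\<bar>x \<bullet> i\<bar> * \<bar>(grad (w n) x - Du x t) \<bullet> i\<bar>) \<le> \<bar>u x t\<bar> * (r * norm (grad (w n) x - Du x t))"
        using xi[OF x] Basis_le_norm[OF i] r(1) by (intro mult_left_mono mult_mono) auto
      then show "\<bar>u x t * ((x \<bullet> i) * ((grad (w n) x - Du x t) \<bullet> i))\<bar> \<le> r * \<bar>u x t * norm (grad (w n) x - Du x t)\<bar>"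
        by (simp add: abs_mult mult_ac)
    qed (use r in auto)
    have P3: "integrable ?M (\<lambda>x. (Du x t \<bullet> i) * ((x \<bullet> i) * (w n x - u x t))) \<and>
        \<bar>integral\<^sup>L ?M (\<lambda>x. (Du x t \<bullet> i) * ((x \<bullet> i) * (w n x - u x t)))\<bar> \<le> r * (sqrt (energy t) * sqrt (E n))" for n
      unfolding energy_def E_def
    proof (rule est[OF _ _ _ g(9) d(1)])
      fix x assume x: "x \<in> \<Omega>"
      have "\<bar>Du x t \<bullet> i\<bar> * (\<bar>x \<bullet> i\<bar> * \<bar>w n x - u x t\<bar>) \<le> norm (Du x t) * (r * \<bar>w n x - u x t\<bar>)"
        using xi[OF x] Basis_le_norm[OF i] r(1) by (intro mult_mono) auto
      then show "\<bar>(Du x t \<bullet> i) * ((x \<bullet> i) * (w n x - u x t))\<bar> \<le> r * \<bar>norm (Du x t) * (w n x - u x t)\<bar>"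
        by (simp add: abs_mult mult_ac)
    qed (use r in auto)
    have P4: "integrable ?M (\<lambda>x. u x t * ((x \<bullet> i) * (Du x t \<bullet> i))) \<and>
        \<bar>integral\<^sup>L ?M (\<lambda>x. u x t * ((x \<bullet> i) * (Du x t \<bullet> i)))\<bar> \<le> r * (sqrt U * sqrt (energy t))"
      unfolding energy_def U_def
    proof (rule est[OF _ _ _ g(10) g(9)])
      fix x assume x: "x \<in> \<Omega>"
      have "\<bar>u x t\<bar> * (\<bar>x \<bullet> i\<bar> * \<bar>Du x t \<bullet> i\<bar>) \<le> \<bar>u x t\<bar> * (r * norm (Du x t))"
        using xi[OF x] Basis_le_norm[OF i] r(1) by (intro mult_left_mono mult_mono) auto
      then show "\<bar>u x t * ((x \<bullet> i) * (Du x t \<bullet> i))\<bar> \<le> r * \<bar>u x t * norm (Du x t)\<bar>"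
        by (simp add: abs_mult mult_ac)
    qed (use r in auto)
    define Q where "Q = integral\<^sup>L ?M (\<lambda>x. u x t * ((x \<bullet> i) * (Du x t \<bullet> i)))"
    have key: "U + 2 * Q = - (integral\<^sup>L ?M (\<lambda>x. u x t * (w n x - u x t))
        + integral\<^sup>L ?M (\<lambda>x. u x t * ((x \<bullet> i) * ((grad (w n) x - Du x t) \<bullet> i)))
        + integral\<^sup>L ?M (\<lambda>x. (Du x t \<bullet> i) * ((x \<bullet> i) * (w n x - u x t))))" for n
    proof -
      have wk: "integral\<^sup>L ?M (\<lambda>x. u x t * pderiv i (\<lambda>x. (x \<bullet> i) * w n x) x) =
          - integral\<^sup>L ?M (\<lambda>x. (Du x t \<bullet> i) * ((x \<bullet> i) * w n x))"
        using wg test_fun_coordinate_mult(1)[OF w(1), of i n] i unfolding weak_gradient_def by blast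
      have pd: "pderiv i (\<lambda>x. (x \<bullet> i) * w n x) x = w n x + (x \<bullet> i) * (grad (w n) x \<bullet> i)" for x
        using grad_inner_Basis[OF i, of "\<lambda>x. (x \<bullet> i) * w n x" x] i
        by (simp add: test_fun_coordinate_mult(2)[OF w(1)] inner_add_left)
      have "(\<lambda>x. u x t * pderiv i (\<lambda>x. (x \<bullet> i) * w n x) x) =
          (\<lambda>x. (u x t * (w n x - u x t) + u x t * ((x \<bullet> i) * ((grad (w n) x - Du x t) \<bullet> i)))
             + ((u x t)\<^sup>2 + u x t * ((x \<bullet> i) * (Du x t \<bullet> i))))"
        unfolding pd by (rule ext) (simp add: algebra_simps inner_diff_left power2_eq_square)
      moreover have "(\<lambda>x. (Du x t \<bullet> i) * ((x \<bullet> i) * w n x)) =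
          (\<lambda>x. (Du x t \<bullet> i) * ((x \<bullet> i) * (w n x - u x t)) + u x t * ((x \<bullet> i) * (Du x t \<bullet> i)))"
        by (rule ext) (simp add: algebra_simps)
      ultimately show ?thesis
        using wk P1[of n] P2[of n] P3[of n] P4 g(10) by (simp add: U_def Q_def)
    qed
    have "(\<lambda>n. 1 * (sqrt U * sqrt (E n)) + r * (sqrt U * sqrt (F n)) + r * (sqrt (energy t) * sqrt (E n)))
        \<longlonglongrightarrow> 1 * (sqrt U * sqrt 0) + r * (sqrt U * sqrt 0) + r * (sqrt (energy t) * sqrt 0)"
      using d(2) e(2) unfolding E_def[symmetric] F_def[symmetric] by (intro tendsto_intros)
    moreover have "\<bar>U + 2 * Q\<bar> \<le> 1 * (sqrt U * sqrt (E n)) + r * (sqrt U * sqrt (F n)) + r * (sqrt (energy t) * sqrt (E n))" for n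
      using conjunct2[OF P1[of n]] conjunct2[OF P2[of n]] conjunct2[OF P3[of n]] key[of n] by linarith
    ultimately have "\<bar>U + 2 * Q\<bar> \<le> 1 * (sqrt U * sqrt 0) + r * (sqrt U * sqrt 0) + r * (sqrt (energy t) * sqrt 0)"
      by (intro LIMSEQ_le_const) auto
    then have "U = - 2 * Q" by simp
    then have U: "U \<le> 2 * (r * (sqrt U * sqrt (energy t)))" using conjunct2[OF P4, folded Q_def] by linarith
    have U0: "0 \<le> U" by (simp add: U_def)
    have "sqrt U \<le> 2 * r * sqrt (energy t)"
    proof (cases "U = 0")
      case True
      then show ?thesis using r energy_nonneg by simp
    next
      case False
      then have "0 < sqrt U" using U0 by simp
      moreover have "sqrt U * sqrt U \<le> sqrt U * (2 * r * sqrt (energy t))"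
        using U U0 by (simp add: mult_ac)
      ultimately show ?thesis by (rule mult_left_le_imp_le[rotated])
    qed
    then have "(sqrt U)\<^sup>2 \<le> (2 * r * sqrt (energy t))\<^sup>2" using U0 by (intro power_mono) auto
    then have U2: "U \<le> 4 * r\<^sup>2 * energy t" using U0 energy_nonneg[of t] by (simp add: power_mult_distrib)
    have "integral\<^sup>L ?M (\<lambda>x. \<bar>1 * u x t\<bar>) \<le> sqrt (integral\<^sup>L ?M (\<lambda>x. (1::real)\<^sup>2)) * sqrt U"
      unfolding U_def by (rule Cauchy_Schwarz_integral(2)) (use g in auto)
    then have "\<bar>mass t\<bar> \<le> sqrt ?m * sqrt U"
      unfolding mass_def by (intro order_trans[OF integral_abs_bound]) simp
    then have "\<bar>mass t\<bar>\<^sup>2 \<le> (sqrt ?m * sqrt U)\<^sup>2" by (intro power_mono) auto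
    then have "(mass t)\<^sup>2 \<le> ?m * U" using U0 by (simp add: power_mult_distrib)
    also have "\<dots> \<le> (?m + 1) * (4 * r\<^sup>2 * energy t)" using U2 U0 by (intro mult_mono) auto
    finally show ?thesis by simp
  qed
  have "0 < (?m + 1) * (4 * r\<^sup>2)" using r by (intro mult_pos_pos add_nonneg_pos) auto
  then show thesis using bound by (rule that)
qed

end

lemma borel_measurable_fst_lebesgue:
  fixes w :: "'a::euclidean_space \<Rightarrow> real"
  assumes "w \<in> borel_measurable lebesgue"
  shows "(\<lambda>p::'a \<times> 'b::euclidean_space. w (fst p)) \<in> borel_measurable lebesgue"
proof -
  obtain g where g: "g \<in> borel_measurable lborel" "AE x in lborel. w x = g x"
    using completion_ex_borel_measurable_real[OF assms] by auto
  obtain N where N: "{x \<in> space lborel. w x \<noteq> g x} \<subseteq> N" "emeasure lborel N = 0" "N \<in> sets lborel"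
    using g(2) by (rule AE_E)
  have "emeasure (lborel \<Otimes>\<^sub>M lborel) (N \<times> (UNIV :: 'b set)) = emeasure lborel N * emeasure lborel (UNIV :: 'b set)"
    using N(3) by (intro lborel.emeasure_pair_measure_Times) auto
  then have e: "emeasure lborel (N \<times> (UNIV :: 'b set)) = 0" using N(2) unfolding lborel_prod by simp
  have "N \<times> (UNIV :: 'b set) \<in> sets lborel" using N(3) by (simp add: borel_Times)
  with e have "AE p in lborel. p \<notin> N \<times> (UNIV :: 'b set)" by (intro AE_not_in) auto
  then have "AE p in lebesgue. p \<notin> N \<times> (UNIV :: 'b set)" by (simp only: AE_completion_iff)
  then have ae: "AE p::'a \<times> 'b in lebesgue. w (fst p) = g (fst p)"
    by eventually_elim (use N(1) in \<open>auto simp: mem_Times_iff\<close>)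
  have "g \<in> borel_measurable borel" using g(1) by simp
  then have "(\<lambda>p::'a \<times> 'b. g (fst p)) \<in> borel_measurable lborel"
    using measurable_compose[OF borel_measurable_continuous_onI[OF continuous_on_fst[OF continuous_on_id]]] by simp
  then have "(\<lambda>p::'a \<times> 'b. g (fst p)) \<in> borel_measurable lebesgue" by (rule measurable_completion)
  then show ?thesis using ae by (rule borel_measurable_lebesgue_AE_eq)
qed

lemma borel_measurable_fst_lebesgue_on:
  fixes w :: "'a::euclidean_space \<Rightarrow> real"
  assumes "w \<in> borel_measurable (lebesgue_on S)" "S \<in> sets borel" "I \<in> sets borel"
  shows "(\<lambda>p::'a \<times> 'b::euclidean_space. w (fst p)) \<in> borel_measurable (lebesgue_on (S \<times> I))"
proof -
  have "(\<lambda>x. indicator S x *\<^sub>R w x) \<in> borel_measurable lebesgue"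
    using assms(1,2) by (simp add: borel_measurable_restrict_space_iff)
  from borel_measurable_fst_lebesgue[OF this, where 'b='b]
  have "(\<lambda>p::'a \<times> 'b. indicator S (fst p) *\<^sub>R w (fst p)) \<in> borel_measurable (lebesgue_on (S \<times> I))"
    by (rule measurable_restrict_space1)
  then show ?thesis by (rule measurable_cong[THEN iffD1, rotated]) auto
qed

lemma AE_interval_witness:
  assumes "AE s in lebesgue_on {0<..<T'}. P s" "0 < t" "t < T'" "(0::real) < e"
  shows "\<exists>s. P s \<and> 0 < s \<and> s < T' \<and> s \<noteq> t \<and> \<bar>s - t\<bar> < e"
proof (rule ccontr)
  assume c: "\<not> ?thesis"
  define m where "m = min (t + e) T'"
  have m: "t < m" "m \<le> T'" "m \<le> t + e" using assms by (auto simp: m_def)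
  have "AE s in lebesgue. s \<in> {0<..<T'} \<longrightarrow> P s" using assms(1) by (simp add: AE_restrict_space_iff)
  then have "AE s in lebesgue. s \<notin> {t<..<m}" 
  proof eventually_elim
    case (elim s)
    show ?case
    proof
      assume s: "s \<in> {t<..<m}"
      then have "P s" using elim m assms by simp
      moreover have "0 < s" "s < T'" "s \<noteq> t" "\<bar>s - t\<bar> < e" using s m assms by auto
      ultimately show False using c by blast
    qed
  qed
  then have "AE s in lborel. s \<notin> {t<..<m}" by (simp only: AE_completion_iff)
  then have "emeasure lborel {t<..<m} = 0"
    by (subst (asm) AE_iff_measurable[of "{t<..<m}"]) auto
  then show False using m by simp
qed

context degenerate_flow
begin

lemma approx_times:
  assumes "AE s in lebesgue_on {0<..<T'}. P s" "0 < t" "t < T'" "ereal T' < T"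
  obtains r :: "nat \<Rightarrow> real" where "\<And>n. P (r n)" "\<And>n. 0 < r n \<and> r n < T'"
    "AE x in lebesgue_on \<Omega>. (\<lambda>n. u x (r n)) \<longlonglongrightarrow> u x t"
proof -
  have sub: "{0<..<T'} \<subseteq> tint T" by (rule interval_subset_tint[OF assms(4)])
  then have tt: "t \<in> tint T" using assms by auto
  have "\<exists>s. P s \<and> 0 < s \<and> s < T' \<and> s \<noteq> t \<and> \<bar>s - t\<bar> < 1 / Suc n" for n
    by (rule AE_interval_witness[OF assms(1-3)]) simp
  then obtain q where q: "\<And>n. P (q n)" "\<And>n. 0 < q n \<and> q n < T'" "\<And>n. q n \<noteq> t" "\<And>n. \<bar>q n - t\<bar> < 1 / Suc n"
    by metis
  have "(\<lambda>n. q n - t) \<longlonglongrightarrow> 0"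
    by (rule Lim_null_comparison[OF _ LIMSEQ_Suc[OF lim_1_over_n]])
      (use q(4) in \<open>auto intro!: always_eventually less_imp_le\<close>)
  then have "q \<longlonglongrightarrow> t" by (rule LIM_zero_cancel)
  then have "filterlim q (at t) sequentially"
    using q(3) by (auto simp: filterlim_at)
  from filterlim_compose[OF u_L1_cont[OF tt] this]
  have l: "(\<lambda>n. integral\<^sup>L (lebesgue_on \<Omega>) (\<lambda>x. norm (u x (q n) - u x t))) \<longlonglongrightarrow> 0" by simp
  have "integrable (lebesgue_on \<Omega>) (\<lambda>x. u x (q n) - u x t)" for n
    using u_integrable[of "q n"] u_integrable[OF tt] q(2)[of n] sub by (intro Bochner_Integration.integrable_diff) auto
  from tendsto_L1_AE_subseq[OF this l] obtain r :: "nat \<Rightarrow> nat" where r: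
    "AE x in lebesgue_on \<Omega>. (\<lambda>n. u x (q (r n)) - u x t) \<longlonglongrightarrow> 0" by blast
  have "AE x in lebesgue_on \<Omega>. (\<lambda>n. u x (q (r n))) \<longlonglongrightarrow> u x t"
    using r by eventually_elim (rule LIM_zero_cancel)
  then show thesis by (rule that[of "\<lambda>n. q (r n)", OF q(1,2)])
qed

lemma u_bounds:
  assumes "AE s in lebesgue_on {0<..<T'}. good K s" "0 < t" "t < T'" "ereal T' < T"
  shows "AE x in lebesgue_on \<Omega>. 0 \<le> u x t \<and> u x t \<le> K"
proof -
  obtain r where r: "\<And>n. good K (r n)" "AE x in lebesgue_on \<Omega>. (\<lambda>n. u x (r n)) \<longlonglongrightarrow> u x t"
    by (rule approx_times[OF assms]) blast
  have "AE x in lebesgue_on \<Omega>. \<forall>n. 0 < u x (r n) \<and> u x (r n) \<le> K"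
    unfolding AE_all_countable using goodD(3)[OF r(1)] by blast
  with r(2) show ?thesis
  proof eventually_elim
    case (elim x)
    then show ?case
      by (auto intro: LIMSEQ_le_const[OF elim(1)] LIMSEQ_le_const2[OF elim(1)] less_imp_le)
  qed
qed

lemma ut_pairing_integrable:
  assumes "0 < T'" "ereal T' < T" "w \<in> borel_measurable (lebesgue_on \<Omega>)" "\<And>x. \<bar>w x\<bar> \<le> B"
  shows "integrable (lebesgue_on {0<..<T'}) (ut_pairing w)"
proof -
  have "integrable (lebesgue_on (\<Omega> \<times> {0<..<T'})) (\<lambda>p. ut (fst p) (snd p) * w (fst p))"
    by (rule mult_bounded_integrable[OF ut_integrable_cyl[OF assms(1,2)] borel_measurable_fst_lebesgue_on[OF assms(3)] assms(4)]) auto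
  from lebesgue_on_Fubini(2)[OF dom_borel _ this] show ?thesis by (simp add: ut_pairing_def[abs_def])
qed

definition admissible :: "('a \<Rightarrow> real) \<Rightarrow> bool" where
  "admissible w \<longleftrightarrow> w \<in> borel_measurable (lebesgue_on \<Omega>) \<and> (\<exists>B. \<forall>x. \<bar>w x\<bar> \<le> B) \<and>
    (\<forall>t\<in>tint T. pairing w t = integral\<^sup>L (lebesgue_on \<Omega>) (\<lambda>x. u0 x * w x) + integral\<^sup>L (lebesgue_on {0<..t}) (ut_pairing w))"

lemma tint_extend:
  assumes "t \<in> tint T"
  obtains T' where "0 < t" "t < T'" "0 < T'" "ereal T' < T"
proof -
  obtain T' where "t < T'" "ereal T' < T"
    using assms ereal_dense2[of "ereal t" T] by (auto simp: tint_def)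
  then show thesis using that assms by (auto simp: tint_def)
qed

lemma admissible_test_fun:
  assumes "test_fun \<Omega> \<psi>"
  shows "admissible \<psi>"
  unfolding admissible_def
proof (intro conjI ballI)
  show "\<psi> \<in> borel_measurable (lebesgue_on \<Omega>)"
    by (rule continuous_measurable_lebesgue_on[OF test_funD(2)[OF assms]])
  obtain B where "0 < B" "\<And>x. \<bar>\<psi> x\<bar> \<le> B" "\<And>x. norm (grad \<psi> x) \<le> B"
    using test_fun_bounded[OF assms] by blast
  then show "\<exists>B. \<forall>x. \<bar>\<psi> x\<bar> \<le> B" by blast
  fix t assume t: "t \<in> tint T"
  then obtain T' where T': "0 < t" "t < T'" "0 < T'" "ereal T' < T" by (rule tint_extend)
  have sub: "{0<..t} \<subseteq> {0<..<T'}" using T' by auto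
  have "AE s in lebesgue_on {0<..t}. ut_pairing \<psi> s = - flux \<psi> s"
    by (rule AE_lebesgue_on_subset[OF AE_ut_pairing_eq_flux[OF T'(3,4) assms] sub]) auto
  then have "integral\<^sup>L (lebesgue_on {0<..t}) (ut_pairing \<psi>) = integral\<^sup>L (lebesgue_on {0<..t}) (\<lambda>s. - flux \<psi> s)"
    using integrable_lebesgue_on_subset[OF pairing_integrable(2)[OF T'(3,4) assms] sub]
      integrable_lebesgue_on_subset[OF flux_integrable(2)[OF T'(3,4) assms] sub]
    by (intro integral_cong_AE) auto
  then show "pairing \<psi> t = integral\<^sup>L (lebesgue_on \<Omega>) (\<lambda>x. u0 x * \<psi> x) + integral\<^sup>L (lebesgue_on {0<..t}) (ut_pairing \<psi>)"
    using pairing_initial[OF t assms] by simp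
qed

lemma u0_integrable: "integrable (lebesgue_on \<Omega>) u0"
  using u0 by (auto simp: ess_bdd_def intro: integrable_bounded_lebesgue_on[OF bounded_dom dom_borel])

lemma dominated_pairing:
  fixes f :: "'a \<Rightarrow> real"
  assumes f: "integrable (lebesgue_on \<Omega>) f" and w: "\<And>n. w n \<in> borel_measurable (lebesgue_on \<Omega>)"
    "w' \<in> borel_measurable (lebesgue_on \<Omega>)" "\<And>n x. \<bar>w n x\<bar> \<le> B"
    "AE x in lebesgue_on \<Omega>. (\<lambda>n. w n x) \<longlonglongrightarrow> w' x"
  shows "(\<lambda>n. integral\<^sup>L (lebesgue_on \<Omega>) (\<lambda>x. f x * w n x)) \<longlonglongrightarrow> integral\<^sup>L (lebesgue_on \<Omega>) (\<lambda>x. f x * w' x)"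
proof (rule integral_dominated_convergence[where w="\<lambda>x. \<bar>f x\<bar> * B"])
  have fm: "f \<in> borel_measurable (lebesgue_on \<Omega>)" using f by auto
  show "(\<lambda>x. f x * w' x) \<in> borel_measurable (lebesgue_on \<Omega>)" using fm w(2) by (rule borel_measurable_times)
  show "(\<lambda>x. f x * w n x) \<in> borel_measurable (lebesgue_on \<Omega>)" for n using fm w(1) by (rule borel_measurable_times)
  show "integrable (lebesgue_on \<Omega>) (\<lambda>x. \<bar>f x\<bar> * B)" using f by simp
  show "AE x in lebesgue_on \<Omega>. (\<lambda>n. f x * w n x) \<longlonglongrightarrow> f x * w' x"
    using w(4) by eventually_elim (intro tendsto_mult tendsto_const)
  show "AE x in lebesgue_on \<Omega>. norm (f x * w n x) \<le> \<bar>f x\<bar> * B" for n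
    using w(3)[of n] by (auto simp: abs_mult intro!: mult_left_mono)
qed

lemma admissible_limit:
  assumes a: "\<And>n. admissible (w n)" and w': "w' \<in> borel_measurable (lebesgue_on \<Omega>)"
    and b: "\<And>n x. \<bar>w n x\<bar> \<le> B" "\<And>x. \<bar>w' x\<bar> \<le> B"
    and l: "AE x in lebesgue_on \<Omega>. (\<lambda>n. w n x) \<longlonglongrightarrow> w' x"
  shows "admissible w'"
  unfolding admissible_def
proof (intro conjI ballI)
  have w: "w n \<in> borel_measurable (lebesgue_on \<Omega>)" for n using a[of n] by (simp add: admissible_def)
  note dom = dominated_pairing[OF _ w w' b(1) l]
  show "w' \<in> borel_measurable (lebesgue_on \<Omega>)" by fact
  show "\<exists>B. \<forall>x. \<bar>w' x\<bar> \<le> B" using b by blast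
  fix t assume t: "t \<in> tint T"
  then obtain T' where T': "0 < t" "t < T'" "0 < T'" "ereal T' < T" by (rule tint_extend)
  have sub: "{0<..t} \<subseteq> {0<..<T'}" using T' by auto
  have 1: "(\<lambda>n. pairing (w n) t) \<longlonglongrightarrow> pairing w' t"
    unfolding pairing_def by (rule dom[OF u_integrable[OF t]])
  have 2: "(\<lambda>n. integral\<^sup>L (lebesgue_on \<Omega>) (\<lambda>x. u0 x * w n x)) \<longlonglongrightarrow> integral\<^sup>L (lebesgue_on \<Omega>) (\<lambda>x. u0 x * w' x)"
    by (rule dom[OF u0_integrable])
  have uti: "AE s in lebesgue_on {0<..<T'}. integrable (lebesgue_on \<Omega>) (\<lambda>x. ut x s)"
    using lebesgue_on_Fubini(1)[OF dom_borel _ ut_integrable_cyl[OF T'(3,4)]] by simp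
  have abi: "integrable (lebesgue_on {0<..<T'}) (\<lambda>s. integral\<^sup>L (lebesgue_on \<Omega>) (\<lambda>x. \<bar>ut x s\<bar>))"
    using lebesgue_on_Fubini(2)[OF dom_borel _ integrable_abs[OF ut_integrable_cyl[OF T'(3,4)]]] by simp
  have 3: "(\<lambda>n. integral\<^sup>L (lebesgue_on {0<..t}) (ut_pairing (w n))) \<longlonglongrightarrow> integral\<^sup>L (lebesgue_on {0<..t}) (ut_pairing w')"
  proof (rule integral_dominated_convergence[where w="\<lambda>s. integral\<^sup>L (lebesgue_on \<Omega>) (\<lambda>x. \<bar>ut x s\<bar>) * B"])
    show "ut_pairing w' \<in> borel_measurable (lebesgue_on {0<..t})"
      using integrable_lebesgue_on_subset[OF ut_pairing_integrable[OF T'(3,4) w' b(2)] sub] by auto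
    show "ut_pairing (w n) \<in> borel_measurable (lebesgue_on {0<..t})" for n
      using integrable_lebesgue_on_subset[OF ut_pairing_integrable[OF T'(3,4) w b(1)] sub] by auto
    show "integrable (lebesgue_on {0<..t}) (\<lambda>s. integral\<^sup>L (lebesgue_on \<Omega>) (\<lambda>x. \<bar>ut x s\<bar>) * B)"
      using integrable_lebesgue_on_subset[OF abi sub] by simp
    have uti': "AE s in lebesgue_on {0<..t}. integrable (lebesgue_on \<Omega>) (\<lambda>x. ut x s)"
      by (rule AE_lebesgue_on_subset[OF uti sub]) auto
    then show "AE s in lebesgue_on {0<..t}. (\<lambda>n. ut_pairing (w n) s) \<longlonglongrightarrow> ut_pairing w' s"
      unfolding ut_pairing_def by eventually_elim (rule dom)
    show "AE s in lebesgue_on {0<..t}. norm (ut_pairing (w n) s) \<le> integral\<^sup>L (lebesgue_on \<Omega>) (\<lambda>x. \<bar>ut x s\<bar>) * B" for n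
      using uti'
    proof eventually_elim
      case (elim s)
      have "\<bar>ut_pairing (w n) s\<bar> \<le> integral\<^sup>L (lebesgue_on \<Omega>) (\<lambda>x. \<bar>ut x s\<bar> * B)"
        unfolding ut_pairing_def
      proof (rule integral_abs_bound_integral)
        show "integrable (lebesgue_on \<Omega>) (\<lambda>x. ut x s * w n x)" by (rule mult_bounded_integrable[OF elim w b(1)])
        show "integrable (lebesgue_on \<Omega>) (\<lambda>x. \<bar>ut x s\<bar> * B)" using elim by simp
        show "\<bar>ut x s * w n x\<bar> \<le> \<bar>ut x s\<bar> * B" for x
          using b(1)[of n x] unfolding abs_mult by (intro mult_left_mono) auto
      qed
      then show ?case by simp
    qed
  qed
  have "(\<lambda>n. pairing (w n) t) \<longlonglongrightarrow> integral\<^sup>L (lebesgue_on \<Omega>) (\<lambda>x. u0 x * w' x) + integral\<^sup>L (lebesgue_on {0<..t}) (ut_pairing w')"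
  proof -
    have "pairing (w n) t = integral\<^sup>L (lebesgue_on \<Omega>) (\<lambda>x. u0 x * w n x) + integral\<^sup>L (lebesgue_on {0<..t}) (ut_pairing (w n))" for n
      using a[of n] t by (simp add: admissible_def)
    then show ?thesis using tendsto_add[OF 2 3] by simp
  qed
  with 1 show "pairing w' t = integral\<^sup>L (lebesgue_on \<Omega>) (\<lambda>x. u0 x * w' x) + integral\<^sup>L (lebesgue_on {0<..t}) (ut_pairing w')"
    by (rule LIMSEQ_unique)
qed

lemma admissible_sat:
  assumes t: "t \<in> tint T" and R: "0 < R" and p: "0 < p"
  shows "admissible (\<lambda>x. sat R (u x t) ^ p)"
proof -
  obtain T' where T': "0 < t" "t < T'" "0 < T'" "ereal T' < T" using t by (rule tint_extend)
  obtain K where K: "0 < K" "AE s in lebesgue_on {0<..<T'}. good K s" using AE_good[OF T'(3,4)] by blast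
  have bd: "\<bar>sat R s ^ p\<bar> \<le> 1" for s using sat_power_bounds[OF R, of s p] by auto
  have lim: "(\<lambda>n. sat R (f n) ^ p) \<longlonglongrightarrow> sat R s ^ p" if "f \<longlonglongrightarrow> s" for f s
    using continuous_on_tendsto_compose[OF continuous_sat[OF R, of p] that] by simp
  have good: "admissible (\<lambda>x. sat R (u x s) ^ p)" if s: "good K s" for s
  proof -
    obtain w where w: "\<And>n. test_fun \<Omega> (w n)" "AE x in lebesgue_on \<Omega>. (\<lambda>n. w n x) \<longlonglongrightarrow> u x s"
      by (rule AE_convergent_test_functions[OF s]) blast
    show ?thesis
    proof (rule admissible_limit[where w="\<lambda>n x. sat R (w n x) ^ p" and B=1])
      show "AE x in lebesgue_on \<Omega>. (\<lambda>n. sat R (w n x) ^ p) \<longlonglongrightarrow> sat R (u x s) ^ p"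
        using w(2) by eventually_elim (rule lim)
    qed (use bd admissible_test_fun[OF test_fun_sat[OF w(1) R p]] continuous_compose_measurable[OF continuous_sat[OF R] goodD(7)[OF s]] in auto)
  qed
  obtain r where r: "\<And>n. good K (r n)" "AE x in lebesgue_on \<Omega>. (\<lambda>n. u x (r n)) \<longlonglongrightarrow> u x t"
    by (rule approx_times[OF K(2) T'(1,2,4)]) blast
  show ?thesis
  proof (rule admissible_limit[where w="\<lambda>n x. sat R (u x (r n)) ^ p" and B=1])
    show "AE x in lebesgue_on \<Omega>. (\<lambda>n. sat R (u x (r n)) ^ p) \<longlonglongrightarrow> sat R (u x t) ^ p"
      using r(2) by eventually_elim (rule lim)
    show "(\<lambda>x. sat R (u x t) ^ p) \<in> borel_measurable (lebesgue_on \<Omega>)"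
      by (rule continuous_compose_measurable[OF continuous_sat[OF R] borel_measurable_integrable[OF u_integrable[OF t]]])
  qed (use bd good[OF r(1)] in auto)
qed

lemma admissible_1:
  assumes "0 < T"
  shows "admissible (\<lambda>x. 1)"
proof -
  obtain T' where T': "0 < T'" "ereal T' < T" using ereal_dense2[of 0 T] assms by (auto simp: zero_ereal_def)
  obtain K where K: "0 < K" "AE s in lebesgue_on {0<..<T'}. good K s" using AE_good[OF T'] by blast
  have "\<exists>s. good K s \<and> 0 < s \<and> s < T' \<and> s \<noteq> T' / 2 \<and> \<bar>s - T' / 2\<bar> < 1"
    by (rule AE_interval_witness[OF K(2)]) (use T' in auto)
  then obtain s where s: "good K s" by blast
  have R: "0 < 1 / real (Suc n)" for n by simp
  show ?thesis
  proof (rule admissible_limit[where w="\<lambda>n x. sat (1 / Suc n) (u x s) ^ 1" and B=1])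
    show "admissible (\<lambda>x. sat (1 / Suc n) (u x s) ^ 1)" for n
      by (rule admissible_sat[OF goodD(1)[OF s] R]) simp
    show "\<bar>sat (1 / Suc n) (u x s) ^ 1\<bar> \<le> 1" for n x using sat_bounds[OF R, of n "u x s"] by simp
    show "AE x in lebesgue_on \<Omega>. (\<lambda>n. sat (1 / Suc n) (u x s) ^ 1) \<longlonglongrightarrow> 1"
      using goodD(3)[OF s] unfolding power_one_right by eventually_elim (simp only: sat_tendsto_1(1))
  qed auto
qed

lemma mass_integrable:
  assumes "0 < T'" "ereal T' < T"
  shows "integrable (lebesgue_on {0<..<T'}) (\<lambda>s. (mass s - 1) * energy s)"
    "AE s in lebesgue_on {0<..<T'}. ut_pairing (\<lambda>x. 1) s = (mass s - 1) * energy s"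
proof -
  obtain K where K: "0 < K" "AE s in lebesgue_on {0<..<T'}. good K s" using AE_good[OF assms] by blast
  show ae: "AE s in lebesgue_on {0<..<T'}. ut_pairing (\<lambda>x. 1) s = (mass s - 1) * energy s"
    using K(2) by eventually_elim (simp add: ut_pairing_def integral_ut[OF _ K(1)])
  have ui: "integrable (lebesgue_on (\<Omega> \<times> {0<..<T'})) (\<lambda>p. u (fst p) (snd p))"
    using u_integrable_cyl[OF assms, of "\<lambda>p. 1" 1] by simp
  have mi: "integrable (lebesgue_on {0<..<T'}) mass"
    using lebesgue_on_Fubini(2)[OF dom_borel _ ui] by (simp add: mass_def[abs_def])
  have m: "(\<lambda>s. (mass s - 1) * energy s) \<in> borel_measurable (lebesgue_on {0<..<T'})"
    using mi energy_integrable[OF assms] by (intro borel_measurable_times borel_measurable_diff) auto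
  have i: "integrable (lebesgue_on {0<..<T'}) (ut_pairing (\<lambda>x. 1))"
    by (rule ut_pairing_integrable[OF assms, of _ 1]) auto
  show "integrable (lebesgue_on {0<..<T'}) (\<lambda>s. (mass s - 1) * energy s)"
    using integrable_cong_AE[OF borel_measurable_integrable[OF i] m ae] i by simp
qed

lemma mass_equation:
  assumes "t \<in> tint T"
  shows "mass t = integral\<^sup>L (lebesgue_on \<Omega>) u0 + integral\<^sup>L (lebesgue_on {0<..t}) (\<lambda>s. (mass s - 1) * energy s)"
proof -
  obtain T' where T': "0 < t" "t < T'" "0 < T'" "ereal T' < T" using assms by (rule tint_extend)
  have sub: "{0<..t} \<subseteq> {0<..<T'}" using T' by auto
  have "0 < T" using T' by (metis ereal_less(2) less_trans zero_ereal_def)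
  then have "pairing (\<lambda>x. 1) t = integral\<^sup>L (lebesgue_on \<Omega>) (\<lambda>x. u0 x * 1) + integral\<^sup>L (lebesgue_on {0<..t}) (ut_pairing (\<lambda>x. 1))"
    using admissible_1 assms unfolding admissible_def by blast
  moreover have "integral\<^sup>L (lebesgue_on {0<..t}) (ut_pairing (\<lambda>x. 1)) = integral\<^sup>L (lebesgue_on {0<..t}) (\<lambda>s. (mass s - 1) * energy s)"
  proof (rule integral_cong_AE)
    have "integrable (lebesgue_on {0<..<T'}) (ut_pairing (\<lambda>x. 1))"
      by (rule ut_pairing_integrable[OF T'(3,4), of _ 1]) auto
    then show "ut_pairing (\<lambda>x. 1) \<in> borel_measurable (lebesgue_on {0<..t})"
      using integrable_lebesgue_on_subset[OF _ sub] by auto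
    show "(\<lambda>s. (mass s - 1) * energy s) \<in> borel_measurable (lebesgue_on {0<..t})"
      using integrable_lebesgue_on_subset[OF mass_integrable(1)[OF T'(3,4)] sub] by auto
    show "AE s in lebesgue_on {0<..t}. ut_pairing (\<lambda>x. 1) s = (mass s - 1) * energy s"
      by (rule AE_lebesgue_on_subset[OF mass_integrable(2)[OF T'(3,4)] sub]) auto
  qed
  ultimately show ?thesis by (simp add: pairing_def mass_def)
qed

end

subsection \<open>A primitive of the saturation, and Gronwall's inequality\<close>

lemma sat_mono: "0 < R \<Longrightarrow> 0 \<le> a \<Longrightarrow> a \<le> b \<Longrightarrow> sat R a ^ p \<le> sat R b ^ p"
proof (rule power_mono)
  assume a: "0 < R" "0 \<le> a" "a \<le> b"
  have "a\<^sup>2 \<le> b\<^sup>2" using a by (intro power_mono) auto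
  moreover have "sat R s = 1 - R / (s\<^sup>2 + R)" for s
    using a(1) by (simp add: sat_def field_simps add_nonneg_eq_0_iff)
  ultimately show "sat R a \<le> sat R b" using a(1) by (simp add: frac_le add_nonneg_pos)
qed (rule sat_bounds)

lemma sat_primitive:
  assumes R: "0 < R"
  obtains H where "\<And>s. (H has_real_derivative sat R s ^ p) (at s)" "H 0 = 0"
    "\<And>a b. 0 \<le> a \<Longrightarrow> 0 \<le> b \<Longrightarrow> H b - H a \<le> sat R b ^ p * (b - a)"
    "\<And>s. 0 \<le> s \<Longrightarrow> 0 \<le> H s" "\<And>s. 0 \<le> s \<Longrightarrow> H s \<le> s * sat R s ^ p"
    "\<And>s. 0 \<le> s \<Longrightarrow> s * sat R s ^ p \<le> (2 * real p + 1) * H s"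
proof -
  have "isCont (\<lambda>s. sat R s ^ p) x" for x
    using continuous_sat[OF R, of p] by (simp add: continuous_on_eq_continuous_at)
  then obtain F where F: "\<And>x. (F has_vector_derivative sat R x ^ p) (at x)"
    using einterval_antiderivative[of "-\<infinity>" "\<infinity>" "\<lambda>s. sat R s ^ p"] by auto
  define H where "H s = F s - F 0" for s
  have D: "(H has_real_derivative sat R s ^ p) (at s)" for s
    unfolding H_def[abs_def] using F[of s]
    by (auto intro!: derivative_eq_intros simp: has_real_derivative_iff_has_vector_derivative)
  have H0: "H 0 = 0" by (simp add: H_def)
  have conv: "H b - H a \<le> sat R b ^ p * (b - a)" if ab: "0 \<le> a" "0 \<le> b" for a b
  proof -
    consider "a < b" | "a = b" | "b < a" by linarith
    then show ?thesis
    proof cases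
      case 1
      then obtain z where z: "a < z" "z < b" "H b - H a = (b - a) * sat R z ^ p"
        using MVT2[OF 1, of H "\<lambda>s. sat R s ^ p"] D by blast
      have "(b - a) * sat R z ^ p \<le> (b - a) * sat R b ^ p"
        using z 1 ab by (intro mult_left_mono sat_mono[OF R]) auto
      then show ?thesis using z by (simp add: mult.commute)
    next
      case 3
      then obtain z where z: "b < z" "z < a" "H a - H b = (a - b) * sat R z ^ p"
        using MVT2[OF 3, of H "\<lambda>s. sat R s ^ p"] D by blast
      have "(a - b) * sat R b ^ p \<le> (a - b) * sat R z ^ p"
        using z 3 ab by (intro mult_left_mono sat_mono[OF R]) auto
      then show ?thesis using z by (simp add: algebra_simps)
    qed simp
  qed
  have nn: "0 \<le> H s" if "0 \<le> s" for s
    using conv[of s 0] that sat_power_bounds(1)[OF R, of 0 p] H0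
    by (smt (verit) mult_nonneg_nonpos2 mult_nonneg_nonneg mult_minus_right)
  have "0 \<le> (2 * real p + 1) * H s - s * sat R s ^ p" if s: "0 \<le> s" for s
  proof -
    let ?f = "\<lambda>s. (2 * real p + 1) * H s - s * sat R s ^ p"
    have "?f 0 \<le> ?f s"
    proof (rule DERIV_nonneg_imp_nondecreasing[OF s])
      fix x assume x: "0 \<le> x" "x \<le> s"
      have d: "(?f has_real_derivative (2 * real p + 1) * sat R x ^ p - (1 * sat R x ^ p + sat_deriv R p x * x)) (at x)"
        by (intro DERIV_diff DERIV_cmult D DERIV_mult DERIV_ident sat_deriv_DERIV R)
      have "sat_deriv R p x * x = real p * (sat R x ^ (p - 1) * (x * sat' R x))" by (simp add: sat_deriv_def)
      also have "\<dots> \<le> real p * (sat R x ^ (p - 1) * (2 * sat R x))"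
        by (intro mult_left_mono sat_sat' R sat_power_bounds) auto
      also have "\<dots> = 2 * real p * sat R x ^ p" by (cases p) auto
      finally show "\<exists>y. (?f has_real_derivative y) (at x) \<and> 0 \<le> y"
        using d by (intro exI[of _ "(2 * real p + 1) * sat R x ^ p - (1 * sat R x ^ p + sat_deriv R p x * x)"]) (simp add: algebra_simps)
    qed
    then show ?thesis by (simp add: H0)
  qed
  then show thesis
    using that[of H] D H0 conv nn conv[of 0] by (simp add: mult.commute)
qed

lemma continuous_indefinite_integral:
  fixes h :: "real \<Rightarrow> real"
  assumes h: "integrable (lebesgue_on {0<..<T'}) h" and t: "t < T'"
  shows "continuous_on {0..t} (\<lambda>b. integral\<^sup>L (lebesgue_on {0<..b}) h)"
proof -
  define H where "H x = indicator {0<..<T'} x * h x" for x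
  have H: "set_integrable lebesgue UNIV H"
    using h by (simp add: set_integrable_def integrable_restrict_space H_def[abs_def])
  have Hs: "set_integrable lebesgue {0..b} H" for b by (rule set_integrable_subset[OF H]) auto
  have eq: "integral\<^sup>L (lebesgue_on {0<..b}) h = integral {0..b} H" if b: "b \<in> {0..t}" for b
  proof -
    have "integral {0..b} H = set_lebesgue_integral lebesgue {0..b} H"
      using set_lebesgue_integral_eq_integral(2)[OF Hs] by simp
    also have "\<dots> = integral\<^sup>L lebesgue (\<lambda>x. indicator {0<..b} x * h x)"
      unfolding set_lebesgue_integral_def
    proof (rule Bochner_Integration.integral_cong[OF refl])
      fix x show "indicator {0..b} x *\<^sub>R H x = indicator {0<..b} x * h x"
        using b t by (auto simp: H_def indicator_def)
    qed
    also have "\<dots> = integral\<^sup>L (lebesgue_on {0<..b}) h" by (simp add: integral_restrict_space)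
    finally show ?thesis by simp
  qed
  have "continuous_on {0..t} (\<lambda>b. integral {0..b} H)"
    by (rule indefinite_integral_continuous_1[OF set_lebesgue_integral_eq_integral(1)[OF Hs]])
  then show ?thesis by (rule continuous_on_eq) (simp add: eq)
qed

lemma gronwall_half:
  fixes f J :: "real \<Rightarrow> real"
  assumes J: "integrable (lebesgue_on {s<..t}) J" "\<And>r. 0 \<le> J r" and st: "s \<le> t"
    and f: "\<And>r. s \<le> r \<Longrightarrow> r \<le> t \<Longrightarrow> 0 \<le> f r \<and> f r \<le> C"
    and fJ: "integrable (lebesgue_on {s<..t}) (\<lambda>r. J r * f r)"
    and step: "\<And>r. s \<le> r \<Longrightarrow> r \<le> t \<Longrightarrow> f r - f s \<le> integral\<^sup>L (lebesgue_on {s<..r}) (\<lambda>r. J r * f r)"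
    and half: "integral\<^sup>L (lebesgue_on {s<..t}) J \<le> 1 / 2"
  shows "f t \<le> 2 * f s"
proof -
  define S where "S = (SUP r\<in>{s..t}. f r)"
  have bdd: "bdd_above (f ` {s..t})" using f by (auto intro!: bdd_aboveI[of _ C])
  have fS: "f r \<le> S" if "r \<in> {s..t}" for r unfolding S_def by (rule cSUP_upper[OF that bdd])
  have S0: "0 \<le> S" using fS[of s] f[of s] st by auto
  have "f r \<le> f s + S / 2" if r: "r \<in> {s..t}" for r
  proof -
    have sub: "{s<..r} \<subseteq> {s<..t}" using r by auto
    have "integral\<^sup>L (lebesgue_on {s<..r}) (\<lambda>r. J r * f r) \<le> integral\<^sup>L (lebesgue_on {s<..t}) (\<lambda>r. J r * f r)"
    proof -
      have "integral\<^sup>L (lebesgue_on {s<..t}) (\<lambda>r. J r * f r) = integral\<^sup>L (lebesgue_on {s<..r}) (\<lambda>r. J r * f r) + integral\<^sup>L (lebesgue_on {r<..t}) (\<lambda>r. J r * f r)"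
        by (rule integral_interval_split[OF fJ]) (use r in auto)
      moreover have "0 \<le> integral\<^sup>L (lebesgue_on {r<..t}) (\<lambda>r. J r * f r)"
        by (rule integral_nonneg_AE, rule AE_I2) (use f J(2) r in auto)
      ultimately show ?thesis by simp
    qed
    also have "\<dots> \<le> integral\<^sup>L (lebesgue_on {s<..t}) (\<lambda>r. J r * S)"
      by (rule integral_mono_AE[OF fJ]) (use J fS in \<open>auto intro!: AE_I2 mult_left_mono\<close>)
    also have "\<dots> \<le> S / 2" using half S0 mult_right_mono[OF half S0] by simp
    finally show ?thesis using step[of r] r by auto
  qed
  then have "S \<le> f s + S / 2" unfolding S_def by (intro cSUP_least) (use st in auto)
  then show ?thesis using fS[of t] st by auto
qed

lemma gronwall_doubling:
  fixes f J :: "real \<Rightarrow> real"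
  assumes J: "integrable (lebesgue_on {0<..<T'}) J" "\<And>r. 0 \<le> J r" and st: "0 < s" "s \<le> t" "t < T'"
    and f: "\<And>r. s \<le> r \<Longrightarrow> r \<le> t \<Longrightarrow> 0 \<le> f r \<and> f r \<le> C"
    and fJ: "integrable (lebesgue_on {0<..<T'}) (\<lambda>r. J r * f r)"
    and step: "\<And>a b. s \<le> a \<Longrightarrow> a \<le> b \<Longrightarrow> b \<le> t \<Longrightarrow> f b - f a \<le> integral\<^sup>L (lebesgue_on {a<..b}) (\<lambda>r. J r * f r)"
    and half: "integral\<^sup>L (lebesgue_on {s<..t}) J \<le> real (Suc n) / 2"
  shows "f t \<le> 2 ^ Suc n * f s"
  using st f step half
proof (induction n arbitrary: t)
  have sub: "integrable (lebesgue_on {a<..b}) g" if "integrable (lebesgue_on {0<..<T'}) g" "0 \<le> a" "b < T'" for g :: "real \<Rightarrow> real" and a b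
    by (rule integrable_lebesgue_on_subset[OF that(1)]) (use that in auto)
  {
    case (0 t)
    have "f t \<le> 2 * f s"
      by (rule gronwall_half[OF sub[OF J(1)] J(2) 0(2) 0(4) sub[OF fJ] 0(5)]) (use 0 in auto)
    then show ?case by simp
  next
    case (Suc n t)
    let ?I = "\<lambda>b. integral\<^sup>L (lebesgue_on {0<..b}) J"
    have split: "integral\<^sup>L (lebesgue_on {a<..c}) J = integral\<^sup>L (lebesgue_on {a<..b}) J + integral\<^sup>L (lebesgue_on {b<..c}) J"
      if "0 \<le> a" "a \<le> b" "b \<le> c" "c \<le> t" for a b c
      by (rule integral_interval_split[OF sub[OF J(1)]]) (use that Suc.prems in auto)
    define m where "m = max (?I s) (?I t - 1 / 2)"
    have nn: "0 \<le> integral\<^sup>L (lebesgue_on {a<..b}) J" for a b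
      using J(2) by (intro Bochner_Integration.integral_nonneg) auto
    have "?I s \<le> m" "m \<le> ?I t" using split[of 0 s t] nn[of s t] Suc.prems by (auto simp: m_def)
    moreover have "continuous_on {s..t} ?I"
      by (rule continuous_on_subset[OF continuous_indefinite_integral[OF J(1) Suc.prems(3)]]) (use Suc.prems in auto)
    ultimately obtain b where b: "s \<le> b" "b \<le> t" "?I b = m" using IVT'[of ?I s m t] Suc.prems by auto
    have bt: "integral\<^sup>L (lebesgue_on {b<..t}) J \<le> 1 / 2"
      using split[of 0 b t] b Suc.prems by (auto simp: m_def)
    have sb: "integral\<^sup>L (lebesgue_on {s<..b}) J \<le> real (Suc n) / 2"
    proof -
      have "integral\<^sup>L (lebesgue_on {s<..b}) J = max 0 (integral\<^sup>L (lebesgue_on {s<..t}) J - 1 / 2)"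
        using split[of 0 s b] split[of 0 s t] b Suc.prems by (auto simp: m_def)
      also have "\<dots> \<le> real (Suc n) / 2"
        using Suc.prems(6) by (intro max.boundedI) (auto simp: add_divide_distrib)
      finally show ?thesis .
    qed
    have "f b \<le> 2 ^ Suc n * f s"
      by (rule Suc.IH) (use Suc.prems b sb in auto)
    moreover have "f t \<le> 2 * f b"
    proof (rule gronwall_half[OF sub[OF J(1)] J(2) b(2) _ sub[OF fJ] _ bt])
      show "0 \<le> f r \<and> f r \<le> C" if "b \<le> r" "r \<le> t" for r using Suc.prems(4)[of r] that b by auto
      show "f r - f b \<le> integral\<^sup>L (lebesgue_on {b<..r}) (\<lambda>r. J r * f r)" if "b \<le> r" "r \<le> t" for r
        using Suc.prems(5)[of b r] that b by auto
    qed (use Suc.prems b in auto)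
    ultimately show ?case by simp
  }
qed

lemma additive_error_vanishes:
  fixes D e :: "real \<Rightarrow> real \<Rightarrow> real"
  assumes D: "\<And>a b c. s \<le> a \<Longrightarrow> a \<le> b \<Longrightarrow> b \<le> c \<Longrightarrow> c \<le> t \<Longrightarrow> D a c = D a b + D b c"
    and e: "\<And>a b c. s \<le> a \<Longrightarrow> a \<le> b \<Longrightarrow> b \<le> c \<Longrightarrow> c \<le> t \<Longrightarrow> e a c = e a b + e b c"
    and small: "\<And>a b. s \<le> a \<Longrightarrow> a < b \<Longrightarrow> b \<le> t \<Longrightarrow> D a b \<le> sqrt (b - a) * e a b"
    and st: "s < t"
  shows "D s t \<le> 0"
proof -
  have *: "D a b \<le> sqrt ((b - a) / 2 ^ k) * e a b" if "s \<le> a" "a < b" "b \<le> t" for a b k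
    using that
  proof (induction k arbitrary: a b)
    case (Suc k)
    define m where "m = (a + b) / 2"
    have m: "a < m" "m < b" "b - m = (b - a) / 2" "m - a = (b - a) / 2"
      using Suc.prems by (auto simp: m_def field_simps)
    have "D a b = D a m + D m b" using D[of a m b] m Suc.prems by auto
    also have "\<dots> \<le> sqrt ((m - a) / 2 ^ k) * e a m + sqrt ((b - m) / 2 ^ k) * e m b"
      using m(1,2) Suc.prems by (intro add_mono Suc.IH) auto
    also have "\<dots> = sqrt ((b - a) / 2 ^ Suc k) * (e a m + e m b)"
      by (simp add: m(3,4) distrib_left)
    also have "e a m + e m b = e a b" using e[of a m b] m Suc.prems by auto
    finally show ?case .
  qed (use small in simp)
  have "(\<lambda>k. (t - s) * (1 / 2) ^ k) \<longlonglongrightarrow> (t - s) * 0"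
    by (intro tendsto_mult tendsto_const LIMSEQ_power_zero) auto
  then have "(\<lambda>k. sqrt ((t - s) / 2 ^ k) * e s t) \<longlonglongrightarrow> sqrt 0 * e s t"
    by (intro tendsto_mult tendsto_const tendsto_real_sqrt) (simp add: power_one_over)
  then show ?thesis using * st by (intro LIMSEQ_le_const[of _ 0]) auto
qed

subsection \<open>A maximum principle\<close>

context degenerate_flow
begin

definition ut_energy :: "real \<Rightarrow> real" where
  "ut_energy t = integral\<^sup>L (lebesgue_on \<Omega>) (\<lambda>x. (ut x t)\<^sup>2)"

lemma ut_energy_integrable:
  assumes "0 < T'" "ereal T' < T"
  shows "integrable (lebesgue_on {0<..<T'}) ut_energy"
  using lebesgue_on_Fubini(2)[OF dom_borel _ ut_L2[OF assms]] by (simp add: ut_energy_def[abs_def])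

lemma ut_energy_nonneg: "0 \<le> ut_energy t" by (simp add: ut_energy_def)

lemma pairing_increment:
  assumes w: "admissible w" and ab: "0 < a" "a \<le> b" "ereal b < T"
  shows "pairing w b - pairing w a = integral\<^sup>L (lebesgue_on {a<..b}) (ut_pairing w)"
proof -
  have t: "a \<in> tint T" "b \<in> tint T"
    using ab le_less_trans[of "ereal a" "ereal b" T] by (auto simp: tint_def)
  obtain T' where T': "0 < b" "b < T'" "0 < T'" "ereal T' < T" using t(2) by (rule tint_extend)
  obtain B where wm: "w \<in> borel_measurable (lebesgue_on \<Omega>)" "\<And>x. \<bar>w x\<bar> \<le> B"
    using w by (auto simp: admissible_def)
  have "integrable (lebesgue_on {0<..b}) (ut_pairing w)"
    by (rule integrable_lebesgue_on_subset[OF ut_pairing_integrable[OF T'(3,4) wm]]) (use T' in auto)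
  from integral_interval_split[OF this, of a]
  show ?thesis using w t ab by (simp add: admissible_def)
qed

lemma ut_pairing_young:
  assumes gd: "good K t" and w: "w \<in> borel_measurable (lebesgue_on \<Omega>)" "\<And>x. \<bar>w x\<bar> \<le> B" and d: "0 < \<delta>"
  shows "ut_pairing w t \<le> \<delta> / 2 * ut_energy t + integral\<^sup>L (lebesgue_on \<Omega>) (\<lambda>x. (w x)\<^sup>2) / (2 * \<delta>)"
proof -
  note g = goodD[OF gd]
  have w2: "integrable (lebesgue_on \<Omega>) (\<lambda>x. (w x)\<^sup>2)"
  proof (rule integrable_bounded_lebesgue_on[OF bounded_dom dom_borel])
    show "(\<lambda>x. (w x)\<^sup>2) \<in> borel_measurable (lebesgue_on \<Omega>)" using w(1) by measurable
    have "\<bar>(w x)\<^sup>2\<bar> \<le> B\<^sup>2" for x using w(2)[of x] by (metis abs_ge_zero abs_power2 power2_abs power_mono)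
    then show "AE x in lebesgue_on \<Omega>. \<bar>(w x)\<^sup>2\<bar> \<le> B\<^sup>2" by simp
  qed
  have "ut_pairing w t \<le> integral\<^sup>L (lebesgue_on \<Omega>) (\<lambda>x. \<delta> / 2 * (ut x t)\<^sup>2 + (w x)\<^sup>2 / (2 * \<delta>))"
    unfolding ut_pairing_def
  proof (rule integral_mono)
    show "integrable (lebesgue_on \<Omega>) (\<lambda>x. ut x t * w x)" by (rule mult_bounded_integrable[OF g(4) w])
    show "integrable (lebesgue_on \<Omega>) (\<lambda>x. \<delta> / 2 * (ut x t)\<^sup>2 + (w x)\<^sup>2 / (2 * \<delta>))"
      using g(5) w2 by (intro Bochner_Integration.integrable_add integrable_mult_right integrable_divide)
    fix x
    have "0 \<le> (\<delta> * ut x t - w x)\<^sup>2 / (2 * \<delta>)" using d by simp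
    also have "\<dots> = \<delta> / 2 * (ut x t)\<^sup>2 + (w x)\<^sup>2 / (2 * \<delta>) - ut x t * w x"
      using d by (simp add: power2_eq_square field_simps)
    finally show "ut x t * w x \<le> \<delta> / 2 * (ut x t)\<^sup>2 + (w x)\<^sup>2 / (2 * \<delta>)" by simp
  qed
  also have "\<dots> = \<delta> / 2 * ut_energy t + integral\<^sup>L (lebesgue_on \<Omega>) (\<lambda>x. (w x)\<^sup>2) / (2 * \<delta>)"
    using g(5) w2 by (simp add: ut_energy_def)
  finally show ?thesis .
qed

context
  fixes T' K R :: real and p :: nat
  assumes T': "0 < T'" "ereal T' < T" and K: "0 < K"
    and ae: "AE s in lebesgue_on {0<..<T'}. good K s" and R: "0 < R" and p: "0 < p"
begin

lemma sat_u_measurable: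
  assumes "0 < t" "t < T'"
  shows "(\<lambda>x. sat R (u x t) ^ p) \<in> borel_measurable (lebesgue_on \<Omega>)" "admissible (\<lambda>x. sat R (u x t) ^ p)"
    "\<And>x. \<bar>sat R (u x t) ^ p\<bar> \<le> 1" "t \<in> tint T"
proof -
  show t: "t \<in> tint T" using assms interval_subset_tint[OF T'(2)] by auto
  show "(\<lambda>x. sat R (u x t) ^ p) \<in> borel_measurable (lebesgue_on \<Omega>)"
    by (rule continuous_compose_measurable[OF continuous_sat[OF R] borel_measurable_integrable[OF u_integrable[OF t]]])
  show "admissible (\<lambda>x. sat R (u x t) ^ p)" by (rule admissible_sat[OF t R p])
  show "\<bar>sat R (u x t) ^ p\<bar> \<le> 1" for x using sat_power_bounds[OF R, of "u x t" p] by auto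
qed

lemma subinterval:
  assumes "0 \<le> a" "b < T'"
  shows "integrable (lebesgue_on {0<..<T'}) f \<Longrightarrow> integrable (lebesgue_on {a<..b}) (f :: real \<Rightarrow> real)"
    "AE s in lebesgue_on {0<..<T'}. P s \<Longrightarrow> AE s in lebesgue_on {a<..b}. P s"
  using assms by (auto intro: integrable_lebesgue_on_subset AE_lebesgue_on_subset)

text \<open>With w = G(u(b)) - G(u(a)), where G is the saturation, the left-hand side is at most the Lipschitz
  constant of G times the integral of (u(b) - u(a)) w, that is, of u_t w over (a, b); Young's inequality absorbs w.\<close>

lemma sat_holder:
  assumes ab: "0 < a" "a < b" "b < T'"
  shows "integral\<^sup>L (lebesgue_on \<Omega>) (\<lambda>x. (sat R (u x b) ^ p - sat R (u x a) ^ p)\<^sup>2)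
    \<le> (real p / sqrt R)\<^sup>2 * (b - a) * integral\<^sup>L (lebesgue_on {0<..<T'}) ut_energy"
proof -
  let ?M = "lebesgue_on \<Omega>"
  let ?G = "\<lambda>s. sat R s ^ p"
  define w where "w x = ?G (u x b) - ?G (u x a)" for x
  define C where "C = real p / sqrt R"
  have C: "0 < C" using p R by (simp add: C_def)
  define N where "N = integral\<^sup>L (lebesgue_on {0<..<T'}) ut_energy"
  define g where "g = integral\<^sup>L ?M (\<lambda>x. (w x)\<^sup>2)"
  note mb = sat_u_measurable[of b] and ma = sat_u_measurable[of a]
  have wm: "w \<in> borel_measurable ?M" unfolding w_def[abs_def]
    using mb ma ab by (intro borel_measurable_diff) auto
  have wb: "\<bar>w x\<bar> \<le> 2" for x using mb(3)[of x] ma(3)[of x] ab unfolding w_def by linarith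
  have ui: "integrable ?M (\<lambda>x. u x b)" "integrable ?M (\<lambda>x. u x a)"
    using u_integrable mb(4) ma(4) ab by auto
  have uwi: "integrable ?M (\<lambda>x. (u x b - u x a) * w x)"
    by (rule mult_bounded_integrable[OF Bochner_Integration.integrable_diff[OF ui] wm wb])
  have "g \<le> integral\<^sup>L ?M (\<lambda>x. C * ((u x b - u x a) * w x))"
    unfolding g_def
  proof (rule integral_mono_AE)
    show "integrable ?M (\<lambda>x. (w x)\<^sup>2)"
    proof (rule integrable_bounded_lebesgue_on[OF bounded_dom dom_borel])
      show "(\<lambda>x. (w x)\<^sup>2) \<in> borel_measurable ?M" using wm by measurable
      have "\<bar>(w x)\<^sup>2\<bar> \<le> 2\<^sup>2" for x using wb[of x] by (metis abs_ge_zero abs_power2 power2_abs power_mono)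
      then show "AE x in ?M. \<bar>(w x)\<^sup>2\<bar> \<le> 2\<^sup>2" by simp
    qed
    show "integrable ?M (\<lambda>x. C * ((u x b - u x a) * w x))" using uwi by (rule integrable_mult_right)
    have "AE x in ?M. 0 \<le> u x a \<and> u x a \<le> K" "AE x in ?M. 0 \<le> u x b \<and> u x b \<le> K"
      using u_bounds[OF ae _ _ T'(2)] ab by auto
    then show "AE x in ?M. (w x)\<^sup>2 \<le> C * ((u x b - u x a) * w x)"
    proof eventually_elim
      case (elim x)
      have lip: "\<bar>w x\<bar> \<le> C * \<bar>u x b - u x a\<bar>"
        unfolding w_def C_def real_norm_def[symmetric]
        by (rule field_differentiable_bound[of UNIV ?G "sat_deriv R p"])
          (use sat_deriv_DERIV[OF R] sat_deriv_bound[OF R] in auto)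
      have sg: "(u x b - u x a) * w x = \<bar>u x b - u x a\<bar> * \<bar>w x\<bar>"
      proof (cases "u x a \<le> u x b")
        case True
        then have "0 \<le> w x" using sat_mono[OF R _ True, of p] elim by (simp add: w_def)
        then show ?thesis using True by simp
      next
        case False
        then have "w x \<le> 0" using sat_mono[OF R, of "u x b" "u x a" p] elim by (simp add: w_def)
        moreover have "u x b - u x a < 0" using False by simp
        ultimately show ?thesis by (simp only: abs_of_nonpos abs_of_neg minus_mult_minus)
      qed
      have "(w x)\<^sup>2 = \<bar>w x\<bar> * \<bar>w x\<bar>" by (simp add: power2_eq_square)
      also have "\<dots> \<le> C * \<bar>u x b - u x a\<bar> * \<bar>w x\<bar>" by (rule mult_right_mono[OF lip]) simp
      finally show ?case by (simp add: sg mult.assoc)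
    qed
  qed
  also have "\<dots> = C * integral\<^sup>L ?M (\<lambda>x. (u x b - u x a) * w x)" by simp
  also have "integral\<^sup>L ?M (\<lambda>x. (u x b - u x a) * w x) =
      integral\<^sup>L (lebesgue_on {a<..b}) (ut_pairing w)"
  proof -
    have pr: "integrable ?M (\<lambda>x. u x s * ?G (u x r))" if "0 < s" "s < T'" "0 < r" "r < T'" for s r
      by (rule mult_bounded_integrable[OF u_integrable[OF sat_u_measurable(4)[OF that(1,2)]] sat_u_measurable(1,3)[OF that(3,4)]])
    have upi: "integrable (lebesgue_on {a<..b}) (ut_pairing (\<lambda>x. ?G (u x r)))" if "0 < r" "r < T'" for r
      by (rule subinterval(1)[OF _ _ ut_pairing_integrable[OF T' sat_u_measurable(1,3)[OF that]]]) (use ab in auto)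
    have "integral\<^sup>L ?M (\<lambda>x. (u x b - u x a) * w x) =
      integral\<^sup>L ?M (\<lambda>x. (u x b * ?G (u x b) - u x a * ?G (u x b)) - (u x b * ?G (u x a) - u x a * ?G (u x a)))"
      by (simp add: w_def algebra_simps)
    also have "\<dots> = (pairing (\<lambda>x. ?G (u x b)) b - pairing (\<lambda>x. ?G (u x b)) a)
        - (pairing (\<lambda>x. ?G (u x a)) b - pairing (\<lambda>x. ?G (u x a)) a)"
      unfolding pairing_def using pr ab by (subst Bochner_Integration.integral_diff; simp)+
    also have "\<dots> = integral\<^sup>L (lebesgue_on {a<..b}) (ut_pairing (\<lambda>x. ?G (u x b)))
        - integral\<^sup>L (lebesgue_on {a<..b}) (ut_pairing (\<lambda>x. ?G (u x a)))"
      using pairing_increment[of "\<lambda>x. ?G (u x b)" a b] pairing_increment[of "\<lambda>x. ?G (u x a)" a b] mb ma ab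
      by (simp add: tint_def)
    also have "\<dots> = integral\<^sup>L (lebesgue_on {a<..b}) (\<lambda>s. ut_pairing (\<lambda>x. ?G (u x b)) s - ut_pairing (\<lambda>x. ?G (u x a)) s)"
      by (rule Bochner_Integration.integral_diff[symmetric, OF upi upi]) (use ab in auto)
    also have "\<dots> = integral\<^sup>L (lebesgue_on {a<..b}) (ut_pairing w)"
    proof (rule integral_cong_AE)
      show "(\<lambda>s. ut_pairing (\<lambda>x. ?G (u x b)) s - ut_pairing (\<lambda>x. ?G (u x a)) s) \<in> borel_measurable (lebesgue_on {a<..b})"
        by (rule borel_measurable_integrable[OF Bochner_Integration.integrable_diff[OF upi upi]]) (use ab in auto)
      show "ut_pairing w \<in> borel_measurable (lebesgue_on {a<..b})"
        using ab by (intro borel_measurable_integrable subinterval(1) ut_pairing_integrable[OF T' wm wb]) auto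
      have "AE s in lebesgue_on {a<..b}. good K s" using subinterval(2)[OF _ _ ae] ab by auto
      then show "AE s in lebesgue_on {a<..b}. ut_pairing (\<lambda>x. ?G (u x b)) s - ut_pairing (\<lambda>x. ?G (u x a)) s = ut_pairing w s"
      proof eventually_elim
        case (elim s)
        have "integrable ?M (\<lambda>x. ut x s * ?G (u x b))" "integrable ?M (\<lambda>x. ut x s * ?G (u x a))"
          using ab mb ma by (auto intro!: mult_bounded_integrable[OF goodD(4)[OF elim], of _ 1])
        then show ?case by (simp add: ut_pairing_def w_def right_diff_distrib)
      qed
    qed
    finally show ?thesis .
  qed
  also have "integral\<^sup>L (lebesgue_on {a<..b}) (ut_pairing w) \<le>
      integral\<^sup>L (lebesgue_on {a<..b}) (\<lambda>s. C * (b - a) / 2 * ut_energy s + g / (2 * (C * (b - a))))"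
  proof (rule integral_mono_AE)
    interpret I: finite_measure "lebesgue_on {a<..b}" by (rule finite_measure_lebesgue_on_bounded) auto
    show "integrable (lebesgue_on {a<..b}) (ut_pairing w)"
      using ab by (intro subinterval(1) ut_pairing_integrable[OF T' wm wb]) auto
    show "integrable (lebesgue_on {a<..b}) (\<lambda>s. C * (b - a) / 2 * ut_energy s + g / (2 * (C * (b - a))))"
      using subinterval(1)[OF _ _ ut_energy_integrable[OF T'], of a b] ab
      by (intro Bochner_Integration.integrable_add integrable_mult_right) auto
    have "AE s in lebesgue_on {a<..b}. good K s" using subinterval(2)[OF _ _ ae] ab by auto
    then show "AE s in lebesgue_on {a<..b}. ut_pairing w s \<le> C * (b - a) / 2 * ut_energy s + g / (2 * (C * (b - a)))"
      unfolding g_def by eventually_elim (rule ut_pairing_young[OF _ wm wb], use C ab in auto)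
  qed
  also have "\<dots> = C * (b - a) / 2 * integral\<^sup>L (lebesgue_on {a<..b}) ut_energy + (b - a) * (g / (2 * (C * (b - a))))"
  proof -
    interpret I: finite_measure "lebesgue_on {a<..b}" by (rule finite_measure_lebesgue_on_bounded) auto
    have "integrable (lebesgue_on {a<..b}) ut_energy"
      using subinterval(1)[OF _ _ ut_energy_integrable[OF T'], of a b] ab by auto
    moreover have "measure (lebesgue_on {a<..b}) {a<..b} = b - a" using ab by (simp add: measure_restrict_space)
    ultimately show ?thesis by simp
  qed
  also have "(b - a) * (g / (2 * (C * (b - a)))) = g / (2 * C)" using C ab by simp
  finally have "g \<le> C * (C * (b - a) / 2 * integral\<^sup>L (lebesgue_on {a<..b}) ut_energy + g / (2 * C))"
    using C by simp
  also have "\<dots> = C\<^sup>2 * (b - a) * integral\<^sup>L (lebesgue_on {a<..b}) ut_energy / 2 + g / 2"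
    using C by (simp add: power2_eq_square algebra_simps)
  finally have "g \<le> C\<^sup>2 * (b - a) * integral\<^sup>L (lebesgue_on {a<..b}) ut_energy" by simp
  also have "\<dots> \<le> C\<^sup>2 * (b - a) * N"
  proof (rule mult_left_mono)
    have "integral\<^sup>L (lebesgue_on {a<..b}) ut_energy = integral\<^sup>L (lebesgue_on {0<..<T'}) (\<lambda>s. indicator {a<..b} s * ut_energy s)"
      by (rule integral_lebesgue_on_subset) (use ab in auto)
    also have "\<dots> \<le> N" unfolding N_def
    proof (rule integral_mono_AE')
      show "integrable (lebesgue_on {0<..<T'}) ut_energy" by (rule ut_energy_integrable[OF T'])
    qed (auto simp: indicator_def ut_energy_nonneg)
    finally show "integral\<^sup>L (lebesgue_on {a<..b}) ut_energy \<le> N" .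
  qed (use ab in auto)
  finally show ?thesis unfolding g_def w_def C_def N_def .
qed

end

context
  fixes T' K R :: real and p :: nat and H :: "real \<Rightarrow> real"
  assumes T': "0 < T'" "ereal T' < T" and K: "0 < K"
    and ae: "AE s in lebesgue_on {0<..<T'}. good K s" and R: "0 < R" and p: "0 < p"
    and H: "\<And>s. (H has_real_derivative sat R s ^ p) (at s)"
      "\<And>a b. 0 \<le> a \<Longrightarrow> 0 \<le> b \<Longrightarrow> H b - H a \<le> sat R b ^ p * (b - a)"
      "\<And>s. 0 \<le> s \<Longrightarrow> 0 \<le> H s" "\<And>s. 0 \<le> s \<Longrightarrow> H s \<le> s * sat R s ^ p"
      "\<And>s. 0 \<le> s \<Longrightarrow> s * sat R s ^ p \<le> (2 * real p + 1) * H s"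
begin

lemmas sat_u = sat_u_measurable[OF T' K ae R p]
lemmas subint = subinterval[OF T' K ae R p]

lemma H_cont: "continuous_on UNIV H"
  by (rule DERIV_continuous_on[where s=UNIV, OF has_field_derivative_at_within[OF H(1)]])

lemma H_bounds: "0 \<le> s \<and> s \<le> K \<Longrightarrow> 0 \<le> H s \<and> H s \<le> K"
proof -
  assume s: "0 \<le> s \<and> s \<le> K"
  have "s * sat R s ^ p \<le> K * 1" using s K sat_power_bounds[OF R, of s p] by (intro mult_mono) auto
  then show ?thesis using H(3,4)[of s] s by auto
qed

definition Hfun :: "real \<Rightarrow> real" where
  "Hfun t = integral\<^sup>L (lebesgue_on \<Omega>) (\<lambda>x. H (u x t))"

lemma Hu_integrable:
  assumes "0 < t" "t < T'"
  shows "integrable (lebesgue_on \<Omega>) (\<lambda>x. H (u x t))"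
    "0 \<le> Hfun t \<and> Hfun t \<le> K * measure (lebesgue_on \<Omega>) (space (lebesgue_on \<Omega>))"
proof -
  interpret finite_measure "lebesgue_on \<Omega>" by (rule finite_dom)
  have b: "AE x in lebesgue_on \<Omega>. 0 \<le> H (u x t) \<and> H (u x t) \<le> K"
    using u_bounds[OF ae assms T'(2)] by eventually_elim (rule H_bounds)
  have m: "(\<lambda>x. H (u x t)) \<in> borel_measurable (lebesgue_on \<Omega>)"
    by (rule continuous_compose_measurable[OF H_cont borel_measurable_integrable[OF u_integrable[OF sat_u(4)[OF assms]]]])
  show i: "integrable (lebesgue_on \<Omega>) (\<lambda>x. H (u x t))"
    by (rule integrable_bounded_lebesgue_on[OF bounded_dom dom_borel m, of K])
      (use b in \<open>eventually_elim; auto\<close>)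
  have "0 \<le> Hfun t" unfolding Hfun_def
    by (rule integral_nonneg_AE) (use b in \<open>eventually_elim; auto\<close>)
  moreover have "Hfun t \<le> integral\<^sup>L (lebesgue_on \<Omega>) (\<lambda>x. K)" unfolding Hfun_def
    by (rule integral_mono_AE[OF i]) (use b in \<open>auto elim: eventually_mono\<close>)
  ultimately show "0 \<le> Hfun t \<and> Hfun t \<le> K * measure (lebesgue_on \<Omega>) (space (lebesgue_on \<Omega>))"
    by (simp add: mult.commute)
qed

lemma energy_Hfun_integrable: "integrable (lebesgue_on {0<..<T'}) (\<lambda>s. c * energy s * Hfun s)"
proof -
  obtain K' where K': "0 < K'" "AE p in lebesgue_on (\<Omega> \<times> {0<..<T'}). 0 \<le> u (fst p) (snd p) \<and> u (fst p) (snd p) \<le> K'"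
    using u_bounded_cyl[OF T'] by blast
  have "bounded (H ` {0..K'})"
    using H_cont by (intro compact_imp_bounded compact_continuous_image) (auto intro: continuous_on_subset)
  then obtain B where B: "\<And>s. s \<in> {0..K'} \<Longrightarrow> \<bar>H s\<bar> \<le> B"
    unfolding bounded_iff by (metis image_eqI real_norm_def)
  have "integrable (lebesgue_on (\<Omega> \<times> {0<..<T'})) (\<lambda>p. H (u (fst p) (snd p)))"
  proof (rule integrable_bounded_lebesgue_on[OF cyl_bounded cyl_borel(1)])
    show "(\<lambda>p. H (u (fst p) (snd p))) \<in> borel_measurable (lebesgue_on (\<Omega> \<times> {0<..<T'}))"
      by (rule continuous_compose_measurable[OF H_cont u_meas[OF T'(2)]])
    show "AE p in lebesgue_on (\<Omega> \<times> {0<..<T'}). \<bar>H (u (fst p) (snd p))\<bar> \<le> B"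
      using K'(2) by eventually_elim (rule B, simp)
  qed
  from lebesgue_on_Fubini(2)[OF dom_borel _ this]
  have fm: "Hfun \<in> borel_measurable (lebesgue_on {0<..<T'})" by (auto simp: Hfun_def[abs_def])
  note ei = energy_integrable[OF T']
  let ?C = "K * measure (lebesgue_on \<Omega>) (space (lebesgue_on \<Omega>))"
  show ?thesis
  proof (rule Bochner_Integration.integrable_bound)
    show "integrable (lebesgue_on {0<..<T'}) (\<lambda>s. c * energy s * ?C)" using ei by simp
    show "(\<lambda>s. c * energy s * Hfun s) \<in> borel_measurable (lebesgue_on {0<..<T'})"
      by (intro borel_measurable_times fm borel_measurable_integrable[OF ei]) auto
    show "AE s in lebesgue_on {0<..<T'}. norm (c * energy s * Hfun s) \<le> norm (c * energy s * ?C)"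
    proof (rule AE_I2)
      fix s assume "s \<in> space (lebesgue_on {0<..<T'})"
      then have "\<bar>Hfun s\<bar> \<le> \<bar>?C\<bar>" using Hu_integrable(2)[of s] by auto
      then show "norm (c * energy s * Hfun s) \<le> norm (c * energy s * ?C)"
        unfolding real_norm_def abs_mult[of "c * energy s"] by (intro mult_left_mono) auto
    qed
  qed
qed

lemma Hfun_step:
  assumes st: "0 < s" "s < t" "t < T'"
  shows "Hfun t - Hfun s \<le> integral\<^sup>L (lebesgue_on {s<..t}) (\<lambda>r. (2 * real p + 1) * energy r * Hfun r)"
proof -
  let ?M = "lebesgue_on \<Omega>"
  let ?G = "\<lambda>s. sat R s ^ p"
  let ?h = "\<lambda>r. (2 * real p + 1) * energy r * Hfun r"
  define C where "C = real p / sqrt R"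
  define N where "N = integral\<^sup>L (lebesgue_on {0<..<T'}) ut_energy"
  have N0: "0 \<le> N" unfolding N_def using ut_energy_nonneg by (intro Bochner_Integration.integral_nonneg) auto
  define D where "D a b = Hfun b - Hfun a - integral\<^sup>L (lebesgue_on {a<..b}) ?h" for a b
  define e where "e a b = (integral\<^sup>L (lebesgue_on {a<..b}) ut_energy + C\<^sup>2 * N * (b - a)) / 2" for a b
  have hi: "integrable (lebesgue_on {a<..b}) ?h" if "s \<le> a" "b \<le> t" for a b
    using subint(1)[OF _ _ energy_Hfun_integrable] that st by auto
  have qi: "integrable (lebesgue_on {a<..b}) ut_energy" if "s \<le> a" "b \<le> t" for a b
    using subint(1)[OF _ _ ut_energy_integrable[OF T']] that st by auto
  have "D s t \<le> 0"
  proof (rule additive_error_vanishes[where D=D and e=e and s=s and t=t])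
    show "D a c = D a b + D b c" if "s \<le> a" "a \<le> b" "b \<le> c" "c \<le> t" for a b c
      using integral_interval_split[OF hi, of a c b] that by (simp add: D_def)
    show "e a c = e a b + e b c" if "s \<le> a" "a \<le> b" "b \<le> c" "c \<le> t" for a b c
      using integral_interval_split[OF qi, of a c b] that by (simp add: e_def field_simps)
    show "D a b \<le> sqrt (b - a) * e a b" if ab: "s \<le> a" "a < b" "b \<le> t" for a b
    proof -
      have a0: "0 < a" "a < T'" and b0: "0 < b" "b < T'" using ab st by auto
      define \<delta> where "\<delta> = sqrt (b - a)"
      have \<delta>: "0 < \<delta>" "(b - a) / \<delta> = \<delta>" using ab by (auto simp: \<delta>_def real_div_sqrt)
      define w where "w x = ?G (u x b)" for x
      have w: "w \<in> borel_measurable ?M" "\<And>x. \<bar>w x\<bar> \<le> 1" "admissible w"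
        unfolding w_def[abs_def] using sat_u[OF b0] by auto
      have uwi: "integrable ?M (\<lambda>x. u x r * w x)" if "0 < r" "r < T'" for r
        by (rule mult_bounded_integrable[OF u_integrable[OF sat_u(4)[OF that]] w(1,2)])
      have "Hfun b - Hfun a = integral\<^sup>L ?M (\<lambda>x. H (u x b) - H (u x a))"
        unfolding Hfun_def by (rule Bochner_Integration.integral_diff[symmetric, OF Hu_integrable(1)[OF b0] Hu_integrable(1)[OF a0]])
      also have "\<dots> \<le> integral\<^sup>L ?M (\<lambda>x. u x b * w x - u x a * w x)"
      proof (rule integral_mono_AE)
        show "integrable ?M (\<lambda>x. H (u x b) - H (u x a))"
          by (rule Bochner_Integration.integrable_diff[OF Hu_integrable(1)[OF b0] Hu_integrable(1)[OF a0]])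
        show "integrable ?M (\<lambda>x. u x b * w x - u x a * w x)"
          by (rule Bochner_Integration.integrable_diff[OF uwi[OF b0] uwi[OF a0]])
        show "AE x in ?M. H (u x b) - H (u x a) \<le> u x b * w x - u x a * w x"
          using u_bounds[OF ae a0 T'(2)] u_bounds[OF ae b0 T'(2)]
        proof eventually_elim
          case (elim x)
          have "H (u x b) - H (u x a) \<le> w x * (u x b - u x a)"
            unfolding w_def by (rule H(2)) (use elim in auto)
          then show ?case by (simp add: algebra_simps)
        qed
      qed
      also have "\<dots> = pairing w b - pairing w a"
        unfolding pairing_def by (rule Bochner_Integration.integral_diff[OF uwi[OF b0] uwi[OF a0]])
      also have "\<dots> = integral\<^sup>L (lebesgue_on {a<..b}) (ut_pairing w)"
        by (rule pairing_increment[OF w(3) a0(1)]) (use ab sat_u(4)[OF b0] in \<open>auto simp: tint_def\<close>)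
      also have "\<dots> \<le> integral\<^sup>L (lebesgue_on {a<..b}) (\<lambda>r. ?h r + \<delta> / 2 * (ut_energy r + C\<^sup>2 * N))"
      proof (rule integral_mono_AE)
        interpret I: finite_measure "lebesgue_on {a<..b}" by (rule finite_measure_lebesgue_on_bounded) auto
        show "integrable (lebesgue_on {a<..b}) (ut_pairing w)"
          by (rule subint(1)[OF _ _ ut_pairing_integrable[OF T' w(1,2)]]) (use a0 b0 in auto)
        show "integrable (lebesgue_on {a<..b}) (\<lambda>r. ?h r + \<delta> / 2 * (ut_energy r + C\<^sup>2 * N))"
          using hi[of a b] qi[of a b] ab by (intro Bochner_Integration.integrable_add integrable_mult_right) auto
        have "AE r in lebesgue_on {a<..b}. good K r" by (rule subint(2)[OF _ _ ae]) (use a0 b0 in auto)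
        moreover have "AE r in lebesgue_on {a<..b}. r \<in> {a<..b}" by (rule AE_I2) auto
        ultimately show "AE r in lebesgue_on {a<..b}. ut_pairing w r \<le> ?h r + \<delta> / 2 * (ut_energy r + C\<^sup>2 * N)"
        proof eventually_elim
          case (elim r)
          note g = goodD[OF elim(1)]
          have r0: "0 < r" "r < T'" using elim(2) a0 b0 by auto
          note sr = sat_u[OF r0]
          have sq: "integral\<^sup>L ?M (\<lambda>x. (w x - ?G (u x r))\<^sup>2) \<le> C\<^sup>2 * N * (b - a)"
          proof (cases "r = b")
            case True
            then show ?thesis using N0 ab by (simp add: w_def)
          next
            case False
            have "integral\<^sup>L ?M (\<lambda>x. (w x - ?G (u x r))\<^sup>2) \<le> C\<^sup>2 * (b - r) * N"
              unfolding w_def C_def N_def by (rule sat_holder[OF T' K ae R p r0(1)]) (use elim False b0 in auto)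
            also have "\<dots> \<le> C\<^sup>2 * (b - a) * N" using elim N0 by (intro mult_right_mono mult_left_mono) auto
            finally show ?thesis by (simp add: mult_ac)
          qed
          have "ut_pairing w r = integral\<^sup>L ?M (\<lambda>x. ut x r * ?G (u x r) + ut x r * (w x - ?G (u x r)))"
            unfolding ut_pairing_def by (simp add: algebra_simps)
          also have "\<dots> = integral\<^sup>L ?M (\<lambda>x. ut x r * ?G (u x r)) + ut_pairing (\<lambda>x. w x - ?G (u x r)) r"
            unfolding ut_pairing_def
          proof (rule Bochner_Integration.integral_add)
            show "integrable ?M (\<lambda>x. ut x r * ?G (u x r))" by (rule mult_bounded_integrable[OF g(4) sr(1,3)])
            have "\<bar>w x - ?G (u x r)\<bar> \<le> 2" for x using w(2)[of x] sr(3)[of x] by linarith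
            then show "integrable ?M (\<lambda>x. ut x r * (w x - ?G (u x r)))"
              using w(1) sr(1) by (intro mult_bounded_integrable[OF g(4), of _ 2] borel_measurable_diff) auto
          qed
          also have "\<dots> \<le> energy r * integral\<^sup>L ?M (\<lambda>x. u x r * ?G (u x r))
              + (\<delta> / 2 * ut_energy r + integral\<^sup>L ?M (\<lambda>x. (w x - ?G (u x r))\<^sup>2) / (2 * \<delta>))"
          proof (rule add_mono[OF test_with_sat_le[OF elim(1) K R p]])
            have "\<bar>w x - ?G (u x r)\<bar> \<le> 2" for x using w(2)[of x] sr(3)[of x] by linarith
            then show "ut_pairing (\<lambda>x. w x - ?G (u x r)) r \<le>
                \<delta> / 2 * ut_energy r + integral\<^sup>L ?M (\<lambda>x. (w x - ?G (u x r))\<^sup>2) / (2 * \<delta>)"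
              using w(1) sr(1) by (intro ut_pairing_young[OF elim(1), of _ 2] borel_measurable_diff \<delta>(1)) auto
          qed
          also have "\<dots> \<le> energy r * ((2 * real p + 1) * Hfun r) + (\<delta> / 2 * ut_energy r + C\<^sup>2 * N * (b - a) / (2 * \<delta>))"
          proof (intro add_mono mult_left_mono energy_nonneg order_refl)
            have "integral\<^sup>L ?M (\<lambda>x. u x r * ?G (u x r)) \<le> integral\<^sup>L ?M (\<lambda>x. (2 * real p + 1) * H (u x r))"
            proof (rule integral_mono_AE)
              show "integrable ?M (\<lambda>x. u x r * ?G (u x r))"
                by (rule mult_bounded_integrable[OF u_integrable[OF sr(4)] sr(1,3)])
              show "integrable ?M (\<lambda>x. (2 * real p + 1) * H (u x r))"
                by (rule integrable_mult_right[OF Hu_integrable(1)[OF r0]])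
              show "AE x in ?M. u x r * ?G (u x r) \<le> (2 * real p + 1) * H (u x r)"
                using g(3) by eventually_elim (rule H(5), simp)
            qed
            then show "integral\<^sup>L ?M (\<lambda>x. u x r * ?G (u x r)) \<le> (2 * real p + 1) * Hfun r"
              by (simp add: Hfun_def)
            show "integral\<^sup>L ?M (\<lambda>x. (w x - ?G (u x r))\<^sup>2) / (2 * \<delta>) \<le> C\<^sup>2 * N * (b - a) / (2 * \<delta>)"
              using sq \<delta>(1) by (intro divide_right_mono) auto
          qed (use \<delta>(1) in auto)
          also have "C\<^sup>2 * N * (b - a) / (2 * \<delta>) = C\<^sup>2 * N * ((b - a) / \<delta>) / 2" by simp
          finally show ?case unfolding \<delta>(2) by (simp add: algebra_simps)
        qed
      qed
      also have "\<dots> = integral\<^sup>L (lebesgue_on {a<..b}) ?h + \<delta> / 2 * (integral\<^sup>L (lebesgue_on {a<..b}) ut_energy + C\<^sup>2 * N * (b - a))"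
      proof -
        interpret I: finite_measure "lebesgue_on {a<..b}" by (rule finite_measure_lebesgue_on_bounded) auto
        have "integrable (lebesgue_on {a<..b}) (\<lambda>r. \<delta> / 2 * (ut_energy r + C\<^sup>2 * N))"
          using qi[of a b] ab by (intro Bochner_Integration.integrable_add integrable_mult_right) auto
        from Bochner_Integration.integral_add[OF hi[OF ab(1,3)] this]
        have "integral\<^sup>L (lebesgue_on {a<..b}) (\<lambda>r. ?h r + \<delta> / 2 * (ut_energy r + C\<^sup>2 * N)) =
          integral\<^sup>L (lebesgue_on {a<..b}) ?h + \<delta> / 2 * integral\<^sup>L (lebesgue_on {a<..b}) (\<lambda>r. ut_energy r + C\<^sup>2 * N)"
          by simp
        moreover have "integral\<^sup>L (lebesgue_on {a<..b}) (\<lambda>r. ut_energy r + C\<^sup>2 * N) =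
          integral\<^sup>L (lebesgue_on {a<..b}) ut_energy + C\<^sup>2 * N * (b - a)"
          using qi[of a b] ab by (simp add: measure_restrict_space)
        ultimately show ?thesis by simp
      qed
      finally show ?thesis unfolding D_def e_def \<delta>_def[symmetric] by simp
    qed
  qed (use st in auto)
  then show ?thesis by (simp add: D_def)
qed

lemma Hfun_growth:
  assumes st: "0 < s" "s < t" "t < T'"
    and I: "integral\<^sup>L (lebesgue_on {s<..t}) (\<lambda>r. (2 * real p + 1) * energy r) \<le> real (Suc n) / 2"
  shows "Hfun t \<le> 2 ^ Suc n * Hfun s"
proof (rule gronwall_doubling[OF _ _ st(1) _ st(3) _ energy_Hfun_integrable _ I])
  show "integrable (lebesgue_on {0<..<T'}) (\<lambda>r. (2 * real p + 1) * energy r)" using energy_integrable[OF T'] by simp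
  show "0 \<le> (2 * real p + 1) * energy r" for r using energy_nonneg by simp
  show "0 \<le> Hfun r \<and> Hfun r \<le> K * measure (lebesgue_on \<Omega>) (space (lebesgue_on \<Omega>))" if "s \<le> r" "r \<le> t" for r
    by (rule Hu_integrable(2)) (use that st in auto)
  show "Hfun b - Hfun a \<le> integral\<^sup>L (lebesgue_on {a<..b}) (\<lambda>r. (2 * real p + 1) * energy r * Hfun r)"
    if "s \<le> a" "a \<le> b" "b \<le> t" for a b
  proof (cases "a = b")
    case True
    have "lebesgue_on {b<..b} = lebesgue_on ({}::real set)" by simp
    then show ?thesis using True by (simp add: integral_restrict_space)
  next
    case False
    then show ?thesis by (intro Hfun_step) (use that st in auto)
  qed
qed (use st in auto)

end

lemma sat_moment_bound:
  assumes st: "0 < s" "s < t" "t < T'" and T': "ereal T' < T" and M: "0 < M" "AE x in lebesgue_on \<Omega>. u x s \<le> M"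
    and I: "integral\<^sup>L (lebesgue_on {s<..t}) energy \<le> real k" and K: "0 < K" "AE r in lebesgue_on {0<..<T'}. good K r"
    and R: "0 < R" and p: "0 < p"
  shows "integral\<^sup>L (lebesgue_on \<Omega>) (\<lambda>x. u x t * sat R (u x t) ^ p)
    \<le> (2 * real p + 1) * (2 * 4 ^ k * M * measure (lebesgue_on \<Omega>) (space (lebesgue_on \<Omega>))) * (16 ^ k * sat R M) ^ p"
proof -
  let ?M = "lebesgue_on \<Omega>" and ?m = "measure (lebesgue_on \<Omega>) (space (lebesgue_on \<Omega>))"
  interpret finite_measure ?M by (rule finite_dom)
  have T0: "0 < T'" using st by simp
  obtain H where H: "\<And>s. (H has_real_derivative sat R s ^ p) (at s)" "H 0 = 0"
    "\<And>a b. 0 \<le> a \<Longrightarrow> 0 \<le> b \<Longrightarrow> H b - H a \<le> sat R b ^ p * (b - a)"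
    "\<And>s. 0 \<le> s \<Longrightarrow> 0 \<le> H s" "\<And>s. 0 \<le> s \<Longrightarrow> H s \<le> s * sat R s ^ p"
    "\<And>s. 0 \<le> s \<Longrightarrow> s * sat R s ^ p \<le> (2 * real p + 1) * H s"
    using sat_primitive[OF R, of p] by blast
  have Hdef: "Hfun H r = integral\<^sup>L ?M (\<lambda>x. H (u x r))" for r
    by (rule Hfun_def[of T' K R p H]; fact)
  have Hi: "integrable ?M (\<lambda>x. H (u x r))" if "0 < r" "r < T'" for r
    by (rule Hu_integrable(1)[of T' K R p H]; fact)
  have s0: "0 < s" "s < T'" and t0: "0 < t" "t < T'" using st by auto
  define n where "n = 2 * (2 * p + 1) * k"
  have "integral\<^sup>L (lebesgue_on {s<..t}) (\<lambda>r. (2 * real p + 1) * energy r) \<le> (2 * real p + 1) * real k"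
    using I by (simp add: mult_left_mono)
  also have "\<dots> \<le> real (Suc n) / 2" by (simp add: n_def algebra_simps)
  finally have nk: "integral\<^sup>L (lebesgue_on {s<..t}) (\<lambda>r. (2 * real p + 1) * energy r) \<le> real (Suc n) / 2" .
  have "Hfun H t \<le> 2 ^ Suc n * Hfun H s"
    by (rule Hfun_growth[of T' K R p H]; fact)
  moreover have "Hfun H s \<le> M * sat R M ^ p * ?m"
  proof -
    have "Hfun H s \<le> integral\<^sup>L ?M (\<lambda>x. M * sat R M ^ p)"
      unfolding Hdef
    proof (rule integral_mono_AE[OF Hi[OF s0]])
      show "AE x in ?M. H (u x s) \<le> M * sat R M ^ p"
        using M(2) u_bounds[OF K(2) s0 T']
      proof eventually_elim
        case (elim x)
        have "H (u x s) \<le> u x s * sat R (u x s) ^ p" using elim by (intro H) auto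
        also have "\<dots> \<le> M * sat R M ^ p"
          using elim M sat_power_bounds(1)[OF R] by (intro mult_mono sat_mono[OF R]) auto
        finally show ?case .
      qed
    qed auto
    then show ?thesis by (simp add: mult_ac)
  qed
  ultimately have 1: "Hfun H t \<le> 2 ^ Suc n * (M * sat R M ^ p * ?m)"
    by (meson mult_left_mono order_trans zero_le_numeral zero_le_power)
  have "integral\<^sup>L ?M (\<lambda>x. u x t * sat R (u x t) ^ p) \<le> integral\<^sup>L ?M (\<lambda>x. (2 * real p + 1) * H (u x t))"
  proof (rule integral_mono_AE)
    note su = sat_u_measurable[OF T0 T' K R p t0]
    show "integrable ?M (\<lambda>x. u x t * sat R (u x t) ^ p)"
      by (rule mult_bounded_integrable[OF u_integrable[OF su(4)] su(1,3)])
    show "integrable ?M (\<lambda>x. (2 * real p + 1) * H (u x t))"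
      by (rule integrable_mult_right[OF Hi[OF t0]])
    show "AE x in ?M. u x t * sat R (u x t) ^ p \<le> (2 * real p + 1) * H (u x t)"
      using u_bounds[OF K(2) t0 T'] by eventually_elim (rule H(6), simp)
  qed
  also have "\<dots> = (2 * real p + 1) * Hfun H t" by (simp add: Hdef)
  also have "\<dots> \<le> (2 * real p + 1) * (2 ^ Suc n * (M * sat R M ^ p * ?m))"
    by (rule mult_left_mono[OF 1]) simp
  also have "(2::real) ^ Suc n = 2 * 4 ^ k * (16 ^ k) ^ p"
  proof -
    have "(2::real) ^ n = (2 ^ 2) ^ k * ((2 ^ 4) ^ k) ^ p"
      unfolding n_def power_mult[symmetric] power_add[symmetric] by (simp add: algebra_simps)
    then show ?thesis by simp
  qed
  finally show ?thesis by (simp add: power_mult_distrib mult_ac)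
qed

lemma linf_bound:
  assumes st: "0 < s" "s < t" "ereal t < T" and M: "0 < M" "AE x in lebesgue_on \<Omega>. u x s \<le> M"
    and I: "integral\<^sup>L (lebesgue_on {s<..t}) energy \<le> real k"
  shows "AE x in lebesgue_on \<Omega>. 0 \<le> u x t \<and> u x t \<le> 2 * 4 ^ k * M"
proof -
  let ?M = "lebesgue_on \<Omega>" and ?m = "measure (lebesgue_on \<Omega>) (space (lebesgue_on \<Omega>))"
  interpret finite_measure ?M by (rule finite_dom)
  have "t \<in> tint T" using st by (auto simp: tint_def)
  then obtain T' where T': "0 < t" "t < T'" "0 < T'" "ereal T' < T" by (rule tint_extend)
  obtain K where K: "0 < K" "AE r in lebesgue_on {0<..<T'}. good K r" using AE_good[OF T'(3,4)] by blast
  define R where "R = K\<^sup>2"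
  have R: "0 < R" using K by (simp add: R_def)
  note su = sat_u_measurable[OF T'(3,4) K R zero_less_one T'(1,2)]
  have ub: "AE x in ?M. 0 \<le> u x t \<and> u x t \<le> K" by (rule u_bounds[OF K(2) T'(1,2,4)])
  have sM: "0 < sat R M" using M R by (simp add: sat_def add_pos_pos)
  define \<theta> where "\<theta> = 2 * (16 ^ k * sat R M)"
  have \<theta>: "0 < \<theta>" using sM by (simp add: \<theta>_def)
  define S where "S = {x \<in> space ?M. \<theta> \<le> sat R (u x t)}"
  have Sm: "S \<in> sets ?M" unfolding S_def
    using su(1) by (intro borel_measurable_le borel_measurable_const) (simp only: power_one_right)
  define c where "c = sqrt (\<theta> * R)"
  have c: "0 < c" using \<theta> R by (simp add: c_def)
  have "measure ?M S * c \<le> (2 * 4 ^ k * M * ?m) * ((2 * real p + 1) * (1 / 2) ^ p)" if p: "0 < p" for p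
  proof -
    note sp = sat_u_measurable[OF T'(3,4) K R p T'(1,2)]
    have "measure ?M S * (c * \<theta> ^ p) = integral\<^sup>L ?M (\<lambda>x. indicator S x * (c * \<theta> ^ p))"
      using Sm sets.sets_into_space[OF Sm] by (simp add: Int_absorb2)
    also have "\<dots> \<le> integral\<^sup>L ?M (\<lambda>x. u x t * sat R (u x t) ^ p)"
    proof (rule integral_mono_AE)
      show "integrable ?M (\<lambda>x. indicator S x * (c * \<theta> ^ p))"
        using Sm by (intro integrable_mult_left integrable_real_indicator) (auto simp: less_top[symmetric])
      show "integrable ?M (\<lambda>x. u x t * sat R (u x t) ^ p)"
        by (rule mult_bounded_integrable[OF u_integrable[OF sp(4)] sp(1,3)])
      show "AE x in ?M. indicator S x * (c * \<theta> ^ p) \<le> u x t * sat R (u x t) ^ p"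
        using ub
      proof eventually_elim
        case (elim x)
        show ?case
        proof (cases "x \<in> S")
          case True
          then have th: "\<theta> \<le> sat R (u x t)" by (simp add: S_def)
          also have "\<dots> \<le> (u x t)\<^sup>2 / R" unfolding sat_def using R by (intro divide_left_mono mult_pos_pos add_nonneg_pos) auto
          finally have "\<theta> * R \<le> (u x t)\<^sup>2" using R by (simp add: pos_le_divide_eq)
          then have "c \<le> u x t" unfolding c_def using elim by (intro real_le_lsqrt) auto
          then have "c * \<theta> ^ p \<le> u x t * sat R (u x t) ^ p"
            using th \<theta> elim c by (intro mult_mono power_mono) auto
          then show ?thesis using True by simp
        next
          case False
          then show ?thesis using elim sat_power_bounds(1)[OF R] by simp
        qed
      qed
    qed
    also have "\<dots> \<le> (2 * real p + 1) * (2 * 4 ^ k * M * ?m) * (16 ^ k * sat R M) ^ p"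
      by (rule sat_moment_bound[OF st(1,2) T'(2,4) M I K R p])
    also have "(16 ^ k * sat R M) ^ p = (1 / 2) ^ p * \<theta> ^ p"
      unfolding \<theta>_def power_mult_distrib[symmetric] by simp
    finally have "(measure ?M S * c) * \<theta> ^ p \<le> ((2 * 4 ^ k * M * ?m) * ((2 * real p + 1) * (1 / 2) ^ p)) * \<theta> ^ p"
      by (simp add: mult_ac)
    then show ?thesis by (rule mult_right_le_imp_le) (use \<theta> in simp)
  qed
  moreover have "(\<lambda>p. (2 * 4 ^ k * M * ?m) * ((2 * real p + 1) * (1 / 2) ^ p)) \<longlonglongrightarrow> (2 * 4 ^ k * M * ?m) * 0"
    by (intro tendsto_mult tendsto_const) real_asymp
  ultimately have "measure ?M S * c \<le> (2 * 4 ^ k * M * ?m) * 0"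
    by (intro LIMSEQ_le_const) (auto intro!: exI[of _ 1])
  then have "measure ?M S * c \<le> 0" by simp
  then have "measure ?M S = 0" using c by (simp add: mult_le_0_iff) (metis measure_nonneg antisym)
  then have "S \<in> null_sets ?M" using Sm by (auto intro!: null_setsI simp: emeasure_eq_measure)
  then have "AE x in ?M. x \<notin> S" by (rule AE_not_in)
  moreover have "AE x in ?M. x \<in> space ?M" by (rule AE_space)
  ultimately show ?thesis
    using ub
  proof eventually_elim
    case (elim x)
    then have "sat R (u x t) < \<theta>" by (auto simp: S_def)
    then have "(u x t)\<^sup>2 < \<theta> * ((u x t)\<^sup>2 + R)"
      using R by (simp add: sat_def pos_divide_less_eq add_nonneg_pos)
    also have "(u x t)\<^sup>2 \<le> K\<^sup>2" using elim by (intro power_mono) auto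
    then have "\<theta> * ((u x t)\<^sup>2 + R) \<le> \<theta> * (2 * R)" using \<theta> by (intro mult_left_mono) (auto simp: R_def)
    also have "sat R M \<le> M\<^sup>2 / R" unfolding sat_def using R by (intro divide_left_mono mult_pos_pos add_nonneg_pos) auto
    then have "\<theta> * (2 * R) \<le> 2 * (16 ^ k * (M\<^sup>2 / R)) * (2 * R)"
      unfolding \<theta>_def using R by (intro mult_right_mono mult_left_mono) auto
    also have "\<dots> = (2 * 4 ^ k * M)\<^sup>2"
    proof -
      have "(16::real) ^ k = (4 ^ k)\<^sup>2" by (simp add: power_mult[symmetric] mult.commute[of k] power_mult)
      then show ?thesis using R by (simp add: power_mult_distrib)
    qed
    finally have "(u x t)\<^sup>2 \<le> (2 * 4 ^ k * M)\<^sup>2" by simp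
    then have "u x t \<le> 2 * 4 ^ k * M" by (rule power2_le_imp_le) (use M in simp)
    then show ?case using elim by simp
  qed
qed

lemma global_if_energy_bounded:
  assumes ext: "extensibility \<Omega> T u" and T: "0 < T"
    and I: "\<And>s t. 0 < s \<Longrightarrow> s < t \<Longrightarrow> ereal t < T \<Longrightarrow> integral\<^sup>L (lebesgue_on {s<..t}) energy \<le> C"
  shows "T = \<infinity>"
proof (rule ccontr)
  assume "T \<noteq> \<infinity>"
  then obtain \<tau> where \<tau>: "T = ereal \<tau>" using T by (cases T) auto
  have \<tau>0: "0 < \<tau>" using T \<tau> by simp
  define s where "s = \<tau> / 2"
  have s: "0 < s" "s < 3 * \<tau> / 4" "ereal (3 * \<tau> / 4) < T" using \<tau>0 by (auto simp: s_def \<tau>)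
  have "0 < 3 * \<tau> / 4" using \<tau>0 by simp
  then obtain K where K: "0 < K" "AE r in lebesgue_on {0<..<3 * \<tau> / 4}. good K r" using AE_good[OF _ s(3)] by blast
  have us: "AE x in lebesgue_on \<Omega>. u x s \<le> K"
    using u_bounds[OF K(2) s] by eventually_elim simp
  obtain k where k: "C \<le> real k" using real_arch_simple by blast
  define B where "B = 2 * 4 ^ k * K"
  have "Limsup (at_left \<tau>) (\<lambda>t. Linf_norm \<Omega> (\<lambda>x. u x t)) \<le> ereal B"
  proof (rule Limsup_bounded)
    have "\<forall>\<^sub>F t in at_left \<tau>. t \<in> {s<..<\<tau>}"
      by (rule eventually_at_leftI[of s]) (use \<tau>0 in \<open>auto simp: s_def\<close>)
    then show "\<forall>\<^sub>F t in at_left \<tau>. Linf_norm \<Omega> (\<lambda>x. u x t) \<le> ereal B"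
    proof eventually_elim
      case (elim t)
      then have t: "s < t" "ereal t < T" "t \<in> tint T" using s by (auto simp: \<tau> tint_def)
      have "integral\<^sup>L (lebesgue_on {s<..t}) energy \<le> real k" using I[OF s(1) t(1,2)] k by simp
      from linf_bound[OF s(1) t(1,2) K(1) us this]
      have "AE x in lebesgue_on \<Omega>. ereal \<bar>u x t\<bar> \<le> ereal B"
        by eventually_elim (simp add: B_def)
      moreover have "(\<lambda>x. ereal \<bar>u x t\<bar>) \<in> borel_measurable (lebesgue_on \<Omega>)"
        using u_integrable[OF t(3)] by (intro borel_measurable_ereal borel_measurable_abs) auto
      ultimately show ?case unfolding Linf_norm_def by (intro esssup_I)
    qed
  qed
  then show False using ext \<tau> by (auto simp: extensibility_def)
qed

end

subsection \<open>Linear integral equations with integrable coefficient\<close>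

lemma linear_integral_eq_positive:
  fixes z J :: "real \<Rightarrow> real"
  assumes J: "\<And>r. 0 \<le> J r" and zJ: "integrable (lebesgue_on {0<..<T'}) (\<lambda>r. z r * J r)"
    and eq: "\<And>t. 0 \<le> t \<Longrightarrow> t < T' \<Longrightarrow> z t = z 0 + integral\<^sup>L (lebesgue_on {0<..t}) (\<lambda>r. z r * J r)"
    and z0: "0 < z 0" and t: "0 \<le> t" "t < T'"
  shows "z 0 \<le> z t"
proof -
  have cont: "continuous_on {0..t} z"
  proof (rule continuous_on_eq)
    show "continuous_on {0..t} (\<lambda>t. z 0 + integral\<^sup>L (lebesgue_on {0<..t}) (\<lambda>r. z r * J r))"
      by (intro continuous_intros continuous_indefinite_integral[OF zJ t(2)])
    show "z 0 + integral\<^sup>L (lebesgue_on {0<..r}) (\<lambda>r. z r * J r) = z r" if "r \<in> {0..t}" for r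
      using eq[of r] that t by simp
  qed
  have ge: "z 0 \<le> z r" if "0 \<le> r" "r \<le> t" "\<And>q. 0 < q \<Longrightarrow> q < r \<Longrightarrow> 0 \<le> z q" for r
  proof -
    have "0 \<le> integral\<^sup>L (lebesgue_on {0<..r}) (\<lambda>r. z r * J r)"
    proof (rule integral_nonneg_AE)
      have "AE q in lebesgue. q \<noteq> r" unfolding AE_completion_iff by (rule AE_lborel_singleton)
      then have "AE q in lebesgue. q \<in> {0<..r} \<longrightarrow> 0 \<le> z q * J q"
        by eventually_elim (use that J in auto)
      then show "AE q in lebesgue_on {0<..r}. 0 \<le> z q * J q" by (simp add: AE_restrict_space_iff)
    qed
    then show ?thesis using eq[of r] that t by simp
  qed
  have "0 \<le> z q" if "0 \<le> q" "q \<le> t" for q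
  proof (rule ccontr)
    assume neg: "\<not> 0 \<le> z q"
    define Z where "Z = {r \<in> {0..t}. z r \<in> {..0}}"
    have "closed Z" unfolding Z_def
      using continuous_closed_preimage[OF cont, of "{..0}"] by (simp add: Int_def vimage_def conj_commute)
    moreover have Zq: "q \<in> Z" using neg that by (simp add: Z_def)
    moreover have bdd: "bdd_below Z" by (rule bdd_belowI[of _ 0]) (simp add: Z_def)
    ultimately have inf: "Inf Z \<in> Z" by (intro closed_contains_Inf) auto
    have "z 0 \<le> z (Inf Z)"
    proof (rule ge)
      show "0 \<le> z r" if "0 < r" "r < Inf Z" for r
      proof (rule ccontr)
        assume "\<not> 0 \<le> z r"
        then have "r \<in> Z" using that inf by (auto simp: Z_def)
        then show False using cInf_lower[OF _ bdd, of r] that by simp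
      qed
    qed (use inf in \<open>auto simp: Z_def\<close>)
    then show False using inf z0 by (simp add: Z_def)
  qed
  then show ?thesis by (intro ge) (use t in auto)
qed

lemma linear_integral_eq_nonpos:
  fixes z J :: "real \<Rightarrow> real"
  assumes J: "\<And>r. 0 \<le> J r" "integrable (lebesgue_on {0<..<T'}) J"
    and zJ: "integrable (lebesgue_on {0<..<T'}) (\<lambda>r. z r * J r)"
    and eq: "\<And>t. 0 \<le> t \<Longrightarrow> t < T' \<Longrightarrow> z t = z 0 + integral\<^sup>L (lebesgue_on {0<..t}) (\<lambda>r. z r * J r)"
    and z0: "z 0 = 0" and t: "0 \<le> t" "t < T'"
  shows "z t \<le> 0"
proof (rule ccontr)
  assume pos: "\<not> z t \<le> 0"
  have cont: "continuous_on {0..t} z"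
  proof (rule continuous_on_eq)
    show "continuous_on {0..t} (\<lambda>t. z 0 + integral\<^sup>L (lebesgue_on {0<..t}) (\<lambda>r. z r * J r))"
      by (intro continuous_intros continuous_indefinite_integral[OF zJ t(2)])
    show "z 0 + integral\<^sup>L (lebesgue_on {0<..r}) (\<lambda>r. z r * J r) = z r" if "r \<in> {0..t}" for r
      using eq[of r] that t by simp
  qed
  define Z where "Z = {r \<in> {0..t}. z r \<in> {..0}}"
  have "closed Z" unfolding Z_def
    using continuous_closed_preimage[OF cont, of "{..0}"] by (simp add: Int_def vimage_def conj_commute)
  moreover have "0 \<in> Z" using z0 t by (simp add: Z_def)
  moreover have bdd: "bdd_above Z" by (rule bdd_aboveI[of _ t]) (simp add: Z_def)
  ultimately have sup: "Sup Z \<in> Z" by (intro closed_contains_Sup) auto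
  define s where "s = Sup Z"
  have s: "0 \<le> s" "s < t" "z s \<le> 0" using sup pos by (auto simp: Z_def s_def order_less_le)
  have zpos: "0 < z r" if "s < r" "r \<le> t" for r
  proof (rule ccontr)
    assume "\<not> 0 < z r"
    then have "r \<in> Z" using that s by (auto simp: Z_def)
    then show False using cSup_upper[OF _ bdd, of r] that by (simp add: s_def)
  qed
  have sub: "integrable (lebesgue_on {a<..b}) g" if "integrable (lebesgue_on {0<..<T'}) g" "0 \<le> a" "b \<le> t" for g :: "real \<Rightarrow> real" and a b
    by (rule integrable_lebesgue_on_subset[OF that(1)]) (use that t in auto)
  let ?I = "\<lambda>b. integral\<^sup>L (lebesgue_on {0<..b}) J"
  have "continuous_on {0..t} ?I" by (rule continuous_indefinite_integral[OF J(2) t(2)])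
  then obtain d where d: "0 < d" "\<And>r. r \<in> {0..t} \<Longrightarrow> dist r s < d \<Longrightarrow> dist (?I r) (?I s) < 1 / 2"
    using s unfolding continuous_on_iff by (metis atLeastAtMost_iff half_gt_zero less_imp_le zero_less_one)
  define b where "b = min t (s + d / 2)"
  have b: "s < b" "b \<le> t" "dist b s < d" using s d by (auto simp: b_def dist_real_def min_def)
  have Ib: "integral\<^sup>L (lebesgue_on {s<..b}) J \<le> 1 / 2"
  proof -
    have "?I b = ?I s + integral\<^sup>L (lebesgue_on {s<..b}) J"
      by (rule integral_interval_split[OF sub[OF J(2)]]) (use s b in auto)
    then show ?thesis using d(2)[of b] b s by (auto simp: dist_real_def)
  qed
  define f where "f r = (if r = s then 0 else z r)" for r
  have "compact (z ` {0..t})" using cont by (intro compact_continuous_image) auto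
  then obtain C where C: "\<And>r. r \<in> {0..t} \<Longrightarrow> z r \<le> C"
    using compact_imp_bounded bounded_iff by (metis abs_le_D1 imageI real_norm_def)
  have zJs: "integral\<^sup>L (lebesgue_on {s<..r}) (\<lambda>r. J r * f r) = integral\<^sup>L (lebesgue_on {s<..r}) (\<lambda>r. z r * J r)" for r
    by (rule Bochner_Integration.integral_cong) (auto simp: f_def)
  have fJ: "integrable (lebesgue_on {s<..b}) (\<lambda>r. J r * f r)"
  proof -
    have "integrable (lebesgue_on {s<..b}) (\<lambda>r. z r * J r)" by (rule sub[OF zJ]) (use s b in auto)
    then show ?thesis by (rule Bochner_Integration.integrable_cong[OF refl, THEN iffD1, rotated]) (auto simp: f_def)
  qed
  have "f b \<le> 2 * f s"
  proof (rule gronwall_half[OF sub[OF J(2)] J(1) _ _ fJ _ Ib])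
    show "0 \<le> f r \<and> f r \<le> max 0 C" if "s \<le> r" "r \<le> b" for r
      using zpos[of r] C[of r] that b s by (auto simp: f_def less_imp_le max_def) 
    show "f r - f s \<le> integral\<^sup>L (lebesgue_on {s<..r}) (\<lambda>r. J r * f r)" if r: "s \<le> r" "r \<le> b" for r
    proof (cases "r = s")
      case True
      then show ?thesis by (simp add: integral_restrict_space)
    next
      case False
      have "integral\<^sup>L (lebesgue_on {0<..r}) (\<lambda>r. z r * J r) =
        integral\<^sup>L (lebesgue_on {0<..s}) (\<lambda>r. z r * J r) + integral\<^sup>L (lebesgue_on {s<..r}) (\<lambda>r. z r * J r)"
        by (rule integral_interval_split[OF sub[OF zJ]]) (use s b r in auto)
      then have "z r = z s + integral\<^sup>L (lebesgue_on {s<..r}) (\<lambda>r. z r * J r)"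
        using eq[of r] eq[of s] r s b t by simp
      then show ?thesis unfolding zJs using s(3) False by (simp add: f_def)
    qed
  qed (use s b in auto)
  then have "z b \<le> 0" using b by (simp add: f_def)
  then show False using zpos[of b] b by simp
qed

subsection \<open>The torsion function of a ball\<close>

lemma Cinf_sq_dist: "Cinf UNIV (\<lambda>x::'a::euclidean_space. (x - z) \<bullet> (x - z))"
  unfolding Cinf_def
proof
  fix k
  have "(\<lambda>x::'a. (x - z) \<bullet> (x - z)) = (\<lambda>x. \<Sum>i\<in>Basis. (x \<bullet> i - z \<bullet> i)\<^sup>2)"
    by (rule ext) (subst euclidean_inner, simp add: inner_diff_left power2_eq_square)
  moreover have "Ck k UNIV (\<lambda>x::'a. \<Sum>i\<in>Basis. (x \<bullet> i - z \<bullet> i)\<^sup>2)"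
    by (intro Ck_sum finite_Basis Ck_power Ck_diff Ck_inner Ck_const)
  ultimately show "Ck k UNIV (\<lambda>x::'a. (x - z) \<bullet> (x - z))" by simp
qed

lemma mem_ball_sq: "0 < r \<Longrightarrow> x \<in> ball z r \<longleftrightarrow> (x - z) \<bullet> (x - z) < r\<^sup>2"
  by (simp add: dist_norm norm_minus_commute norm_lt_square)

lemma smoothly_bounded_ball:
  assumes "0 < r"
  shows "smoothly_bounded (ball (z::'a::euclidean_space) r)"
  unfolding smoothly_bounded_def smooth_boundary_def
proof (intro conjI ballI)
  fix y assume "y \<in> frontier (ball z r)"
  then have y: "dist z y = r" using assms by simp
  let ?\<rho> = "\<lambda>x. (x - z) \<bullet> (x - z) - r\<^sup>2"
  have C: "Cinf UNIV ?\<rho>"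
    using Cinf_sq_dist[of z] unfolding Cinf_def by (auto intro!: Ck_diff Ck_const)
  have "grad ?\<rho> y = 2 *\<^sub>R (y - z)"
    by (rule grad_unique) (auto intro!: derivative_eq_intros simp: inner_commute algebra_simps)
  moreover have "y - z \<noteq> 0" using y assms by auto
  ultimately have "grad ?\<rho> y \<noteq> 0" by simp
  moreover have "Cinf (ball y 1) ?\<rho>" using C unfolding Cinf_def by (blast intro: Ck_subset)
  moreover have "\<forall>x\<in>ball y 1. x \<in> ball z r \<longleftrightarrow> ?\<rho> x < 0"
    by (simp only: mem_ball_sq[OF assms]) simp
  ultimately show "\<exists>ra>0. \<exists>\<rho>. Cinf (ball y ra) \<rho> \<and> (\<forall>x\<in>ball y ra. (x \<in> ball z r) = (\<rho> x < 0)) \<and> grad \<rho> y \<noteq> 0"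
    by (intro exI[of _ 1] exI[of _ ?\<rho>]) auto
qed (use assms in auto)

definition ball_torsion :: "'a::euclidean_space \<Rightarrow> real \<Rightarrow> 'a \<Rightarrow> real" where
  "ball_torsion z r x = (r\<^sup>2 - (x - z) \<bullet> (x - z)) / (2 * real DIM('a))"

lemma torsion_function_ball:
  fixes z :: "'a::euclidean_space"
  assumes "0 < r"
  shows "torsion_function (ball z r) (ball_torsion z r)"
proof -
  let ?N = "real DIM('a)"
  have N: "0 < ?N" by simp
  have eq: "ball_torsion z r = (\<lambda>x. (1 / (2 * ?N)) * (r\<^sup>2 - (x - z) \<bullet> (x - z)))"
    by (rule ext) (simp add: ball_torsion_def)
  have C: "Ck k UNIV (ball_torsion z r)" for k
    unfolding eq using Cinf_sq_dist[of z] unfolding Cinf_def by (intro Ck_cmult Ck_diff Ck_const) blast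
  have p1: "pderiv i (ball_torsion z r) = (\<lambda>x. - (1 / ?N) * ((x - z) \<bullet> i))" if i: "i \<in> Basis" for i
  proof
    fix x
    have "((\<lambda>x. (x - z) \<bullet> (x - z)) has_derivative (\<lambda>h. 2 * ((x - z) \<bullet> h))) (at x)"
      by (auto intro!: derivative_eq_intros simp: inner_commute)
    from has_derivative_mult_right[OF has_derivative_diff[OF has_derivative_const this], of "1 / (2 * ?N)" "r\<^sup>2"]
    have "(ball_torsion z r has_derivative (\<lambda>h. (- (1 / ?N)) *\<^sub>R (x - z) \<bullet> h)) (at x)"
      unfolding eq by simp
    from grad_unique[OF this] show "pderiv i (ball_torsion z r) x = - (1 / ?N) * ((x - z) \<bullet> i)"
      using grad_inner_Basis[OF i, of "ball_torsion z r" x] by simp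
  qed
  have p2: "pderiv i (pderiv i (ball_torsion z r)) x = - (1 / ?N)" if i: "i \<in> Basis" for i x
  proof -
    have "((\<lambda>x. - (1 / ?N) * ((x - z) \<bullet> i)) has_derivative (\<lambda>h. (- (1 / ?N)) *\<^sub>R i \<bullet> h)) (at x)"
      by (auto intro!: derivative_eq_intros simp: inner_commute)
    note gr = grad_unique[OF this]
    have "pderiv i (pderiv i (ball_torsion z r)) x = grad (pderiv i (ball_torsion z r)) x \<bullet> i"
      by (rule grad_inner_Basis[OF i, symmetric])
    also have "\<dots> = (- (1 / ?N)) *\<^sub>R i \<bullet> i" unfolding p1[OF i] gr ..
    also have "\<dots> = - (1 / ?N)" using i by simp
    finally show ?thesis .
  qed
  have "laplacian (ball_torsion z r) x = -1" for x
  proof -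
    have "laplacian (ball_torsion z r) x = (\<Sum>i\<in>(Basis::'a set). - (1 / ?N))"
      unfolding laplacian_def by (rule sum.cong) (simp_all only: p2)
    then show ?thesis by simp
  qed
  moreover have "continuous_on UNIV (ball_torsion z r)" using C[of 0] by simp
  moreover have "ball_torsion z r x = 0" if "x \<in> frontier (ball z r)" for x
  proof -
    have "dist z x = r" using that assms by simp
    then have "(x - z) \<bullet> (x - z) = r\<^sup>2" by (simp add: dist_norm norm_minus_commute dot_square_norm)
    then show ?thesis by (simp add: ball_torsion_def)
  qed
  ultimately show ?thesis
    unfolding torsion_function_def using Ck_subset[OF C] by (auto intro: continuous_on_subset)
qed

lemma ball_torsion_bounds:
  fixes z :: "'a::euclidean_space"
  assumes "0 < r" "x \<in> ball z r"
  shows "0 \<le> ball_torsion z r x" "ball_torsion z r x \<le> r\<^sup>2"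
proof -
  have lt: "(x - z) \<bullet> (x - z) < r\<^sup>2" using assms mem_ball_sq by blast
  then show "0 \<le> ball_torsion z r x" by (simp add: ball_torsion_def)
  have "ball_torsion z r x \<le> r\<^sup>2 / (2 * real DIM('a))"
    unfolding ball_torsion_def by (intro divide_right_mono) auto
  also have "\<dots> \<le> r\<^sup>2 / 1" by (intro divide_left_mono) (auto simp: Suc_leI le_less_trans[of 1] intro: order_trans[of 1 "real DIM('a)"])
  finally show "ball_torsion z r x \<le> r\<^sup>2" by simp
qed

subsection \<open>The three regimes\<close>

context degenerate_flow
begin

lemma mass_nonneg:
  assumes "t \<in> tint T"
  shows "0 \<le> mass t"
proof -
  obtain T' where T': "0 < t" "t < T'" "0 < T'" "ereal T' < T" using assms by (rule tint_extend)
  obtain K where K: "0 < K" "AE s in lebesgue_on {0<..<T'}. good K s" using AE_good[OF T'(3,4)] by blast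
  show ?thesis unfolding mass_def
    using u_bounds[OF K(2) T'(1,2,4)] by (intro integral_nonneg_AE) (auto elim: eventually_mono)
qed

definition excess :: "real \<Rightarrow> real" where
  "excess t = (if t = 0 then integral\<^sup>L (lebesgue_on \<Omega>) u0 else mass t) - 1"

lemma excess_equation:
  assumes "0 < T'" "ereal T' < T"
  shows "integrable (lebesgue_on {0<..<T'}) (\<lambda>r. excess r * energy r)"
    and "\<And>t. 0 \<le> t \<Longrightarrow> t < T' \<Longrightarrow> excess t = excess 0 + integral\<^sup>L (lebesgue_on {0<..t}) (\<lambda>r. excess r * energy r)"
proof -
  show "integrable (lebesgue_on {0<..<T'}) (\<lambda>r. excess r * energy r)"
    using mass_integrable(1)[OF assms]
    by (rule Bochner_Integration.integrable_cong[OF refl, THEN iffD1, rotated]) (auto simp: excess_def)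
  fix t assume t: "0 \<le> t" "t < T'"
  show "excess t = excess 0 + integral\<^sup>L (lebesgue_on {0<..t}) (\<lambda>r. excess r * energy r)"
  proof (cases "t = 0")
    case True
    then show ?thesis by (simp add: integral_restrict_space)
  next
    case False
    then have "t \<in> tint T" using t assms interval_subset_tint[OF assms(2)] by auto
    moreover have "integral\<^sup>L (lebesgue_on {0<..t}) (\<lambda>r. excess r * energy r) = integral\<^sup>L (lebesgue_on {0<..t}) (\<lambda>s. (mass s - 1) * energy s)"
      by (rule Bochner_Integration.integral_cong) (auto simp: excess_def)
    ultimately show ?thesis using mass_equation[of t] False by (simp add: excess_def)
  qed
qed

lemma excess_diff:
  assumes "0 < s" "s \<le> t" "ereal t < T"
  shows "integrable (lebesgue_on {s<..t}) (\<lambda>r. excess r * energy r)" "integrable (lebesgue_on {s<..t}) energy"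
    "excess t - excess s = integral\<^sup>L (lebesgue_on {s<..t}) (\<lambda>r. excess r * energy r)"
proof -
  have "t \<in> tint T" using assms by (simp add: tint_def)
  then obtain T' where T': "0 < t" "t < T'" "0 < T'" "ereal T' < T" by (rule tint_extend)
  note e = excess_equation[OF T'(3,4)]
  show "integrable (lebesgue_on {s<..t}) (\<lambda>r. excess r * energy r)" "integrable (lebesgue_on {s<..t}) energy"
    by (rule integrable_lebesgue_on_subset[OF e(1)] integrable_lebesgue_on_subset[OF energy_integrable[OF T'(3,4)]];
        use T' assms in auto)+
  have "integrable (lebesgue_on {0<..t}) (\<lambda>r. excess r * energy r)"
    by (rule integrable_lebesgue_on_subset[OF e(1)]) (use T' in auto)
  from integral_interval_split[OF this, of s]
  show "excess t - excess s = integral\<^sup>L (lebesgue_on {s<..t}) (\<lambda>r. excess r * energy r)"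
    using e(2)[of t] e(2)[of s] assms T' by simp
qed

lemma excess_ge:
  assumes "0 < excess 0" "t \<in> tint T"
  shows "excess 0 \<le> excess t"
proof -
  obtain T' where T': "0 < t" "t < T'" "0 < T'" "ereal T' < T" using assms(2) by (rule tint_extend)
  show ?thesis
    by (rule linear_integral_eq_positive[where J=energy, OF energy_nonneg excess_equation[OF T'(3,4)] assms(1)])
      (use T' in auto)
qed

lemma uminus_excess_equation:
  assumes "0 < T'" "ereal T' < T"
  shows "integrable (lebesgue_on {0<..<T'}) (\<lambda>r. - excess r * energy r)"
    and "\<And>t. 0 \<le> t \<Longrightarrow> t < T' \<Longrightarrow> - excess t = - excess 0 + integral\<^sup>L (lebesgue_on {0<..t}) (\<lambda>r. - excess r * energy r)"
proof -
  show "integrable (lebesgue_on {0<..<T'}) (\<lambda>r. - excess r * energy r)"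
    using integrable_minus[OF excess_equation(1)[OF assms]] by simp
  fix t assume "0 \<le> t" "t < T'"
  from excess_equation(2)[OF assms this]
  have "- excess t = - excess 0 - integral\<^sup>L (lebesgue_on {0<..t}) (\<lambda>r. excess r * energy r)" by linarith
  then show "- excess t = - excess 0 + integral\<^sup>L (lebesgue_on {0<..t}) (\<lambda>r. - excess r * energy r)" by simp
qed

lemma excess_le:
  assumes "excess 0 < 0" "t \<in> tint T"
  shows "excess t \<le> excess 0"
proof -
  obtain T' where T': "0 < t" "t < T'" "0 < T'" "ereal T' < T" using assms(2) by (rule tint_extend)
  have "- excess 0 \<le> - excess t"
    by (rule linear_integral_eq_positive[where J=energy, OF energy_nonneg uminus_excess_equation[OF T'(3,4)]])
      (use T' assms in auto)
  then show ?thesis by simp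
qed

lemma excess_eq_0:
  assumes "excess 0 = 0" "t \<in> tint T"
  shows "excess t = 0"
proof -
  obtain T' where T': "0 < t" "t < T'" "0 < T'" "ereal T' < T" using assms(2) by (rule tint_extend)
  have "excess t \<le> 0"
    by (rule linear_integral_eq_nonpos[where J=energy, OF energy_nonneg energy_integrable[OF T'(3,4)] excess_equation[OF T'(3,4)] assms(1)])
      (use T' in auto)
  moreover have "- excess t \<le> 0"
    by (rule linear_integral_eq_nonpos[where J=energy, OF energy_nonneg energy_integrable[OF T'(3,4)] uminus_excess_equation[OF T'(3,4)]])
      (use T' assms in auto)
  ultimately show ?thesis by simp
qed

lemma tintI: "0 < t \<Longrightarrow> ereal t < T \<Longrightarrow> t \<in> tint T" by (simp add: tint_def)

lemma tint_le: "0 < s \<Longrightarrow> s \<le> t \<Longrightarrow> ereal t < T \<Longrightarrow> s \<in> tint T"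
  using le_less_trans[of "ereal s" "ereal t" T] by (simp add: tint_def)

lemma subcritical:
  assumes ext: "extensibility \<Omega> T u" and T: "0 < T" and sub: "integral\<^sup>L (lebesgue_on \<Omega>) u0 < 1"
  shows "T = \<infinity> \<and> (mass \<longlongrightarrow> 0) at_top"
proof -
  have e0: "excess 0 < 0" using sub by (simp add: excess_def)
  define c where "c = - excess 0"
  have c: "0 < c" using e0 by (simp add: c_def)
  have ex: "excess t \<le> - c" if "t \<in> tint T" for t using excess_le[OF e0 that] by (simp add: c_def)
  have ge: "- 1 \<le> excess t" if "t \<in> tint T" for t using mass_nonneg[OF that] that by (auto simp: excess_def tint_def)
  have cJ: "c * integral\<^sup>L (lebesgue_on {s<..t}) energy \<le> excess s - excess t" if st: "0 < s" "s \<le> t" "ereal t < T" for s t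
  proof -
    note d = excess_diff[OF st]
    have "excess t - excess s \<le> integral\<^sup>L (lebesgue_on {s<..t}) (\<lambda>r. - c * energy r)"
      unfolding d(3)
    proof (rule integral_mono_AE[OF d(1)])
      show "integrable (lebesgue_on {s<..t}) (\<lambda>r. - c * energy r)" using d(2) by simp
      show "AE r in lebesgue_on {s<..t}. excess r * energy r \<le> - c * energy r"
        using st by (intro AE_I2 mult_right_mono ex energy_nonneg) (auto intro: tint_le)
    qed
    then show ?thesis by simp
  qed
  have I: "integral\<^sup>L (lebesgue_on {s<..t}) energy \<le> 1 / c" if st: "0 < s" "s < t" "ereal t < T" for s t
  proof -
    have "c * integral\<^sup>L (lebesgue_on {s<..t}) energy \<le> 1"
      using cJ[of s t] ge[of t] ex[of s] c st tint_le[of s t] tintI[of t] by auto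
    then show ?thesis using c by (simp add: field_simps)
  qed
  have Tinf: "T = \<infinity>" by (rule global_if_energy_bounded[OF ext T I])
  then have tT: "t \<in> tint T" if "0 < t" for t using that by (simp add: tint_def)
  have mono: "mass t \<le> mass s" if "0 < s" "s \<le> t" for s t
  proof -
    have "0 \<le> c * integral\<^sup>L (lebesgue_on {s<..t}) energy"
      using c energy_nonneg by (intro mult_nonneg_nonneg Bochner_Integration.integral_nonneg) auto
    then show ?thesis using cJ[of s t] that Tinf by (simp add: excess_def)
  qed
  obtain C where C: "0 < C" "\<And>K t. good K t \<Longrightarrow> (mass t)\<^sup>2 \<le> C * energy t" using poincare by blast
  have small: "\<exists>t>0. mass t < e" if e: "0 < e" for e
  proof (rule ccontr)
    assume "\<not> (\<exists>t>0. mass t < e)"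
    then have me: "e \<le> mass t" if "0 < t" for t using that not_less by blast
    define L where "L = C / e\<^sup>2 * (1 / c + 1)"
    have L: "0 < L" using C c e by (simp add: L_def add_pos_pos)
    have "integral\<^sup>L (lebesgue_on {1<..1 + L}) (\<lambda>r. e\<^sup>2 / C) \<le> integral\<^sup>L (lebesgue_on {1<..1 + L}) energy"
    proof (rule integral_mono_AE)
      interpret finite_measure "lebesgue_on {1<..1 + L}" by (rule finite_measure_lebesgue_on_bounded) auto
      show "integrable (lebesgue_on {1<..1 + L}) (\<lambda>r. e\<^sup>2 / C)" by simp
      show "integrable (lebesgue_on {1<..1 + L}) energy" using L Tinf by (intro excess_diff(2)) auto
      have "0 < L + 2" "ereal (L + 2) < T" using L Tinf by auto
      then obtain K where K: "0 < K" "AE s in lebesgue_on {0<..<L + 2}. good K s" using AE_good by blast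
      have "AE s in lebesgue_on {1<..1 + L}. good K s" by (rule AE_lebesgue_on_subset[OF K(2)]) auto
      moreover have "AE s in lebesgue_on {1<..1 + L}. s \<in> {1<..1 + L}" by (rule AE_I2) auto
      ultimately show "AE r in lebesgue_on {1<..1 + L}. e\<^sup>2 / C \<le> energy r"
      proof eventually_elim
        case (elim r)
        have "e\<^sup>2 \<le> (mass r)\<^sup>2" using me[of r] elim e by (intro power_mono) auto
        also have "\<dots> \<le> C * energy r" by (rule C(2)[OF elim(1)])
        finally show ?case using C by (simp add: pos_divide_le_eq mult.commute)
      qed
    qed
    also have "\<dots> \<le> 1 / c" using L Tinf by (intro I) auto
    also have "integral\<^sup>L (lebesgue_on {1<..1 + L}) (\<lambda>r. e\<^sup>2 / C) = L * (e\<^sup>2 / C)"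
      using L by (simp add: measure_restrict_space)
    also have "L * (e\<^sup>2 / C) = 1 / c + 1" using C e by (simp add: L_def)
    finally show False by simp
  qed
  have "(mass \<longlongrightarrow> 0) at_top"
  proof (rule tendstoI)
    fix e :: real assume "0 < e"
    then obtain t where t: "0 < t" "mass t < e" using small by blast
    show "\<forall>\<^sub>F r in at_top. dist (mass r) 0 < e"
      using eventually_ge_at_top[of t]
    proof eventually_elim
      case (elim r)
      then show ?case using mono[OF t(1) elim] t mass_nonneg[OF tT, of r] by (simp add: dist_real_def)
    qed
  qed
  with Tinf show ?thesis by blast
qed

lemma supercritical:
  assumes ext: "extensibility \<Omega> T u" and T: "0 < T" and sup: "1 < integral\<^sup>L (lebesgue_on \<Omega>) u0"
  shows "T < \<infinity> \<and> Limsup (at_left (real_of_ereal T)) (\<lambda>t. ereal (mass t)) = \<infinity>"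
proof -
  have e0: "0 < excess 0" using sup by (simp add: excess_def)
  define c where "c = excess 0"
  have c: "0 < c" using e0 by (simp add: c_def)
  have ex: "c \<le> excess t" if "t \<in> tint T" for t using excess_ge[OF e0 that] by (simp add: c_def)
  have zJ: "0 \<le> integral\<^sup>L (lebesgue_on {s<..t}) (\<lambda>r. excess r * energy r)" if st: "0 < s" "s \<le> t" "ereal t < T" for s t
    using st c ex by (intro integral_nonneg_AE AE_I2 mult_nonneg_nonneg energy_nonneg) (auto intro!: order_trans[OF _ ex] less_imp_le[OF c] tint_le)
  have mono: "excess s \<le> excess t" if st: "0 < s" "s \<le> t" "ereal t < T" for s t
    using excess_diff(3)[OF st] zJ[OF st] by simp
  have cJ: "c * integral\<^sup>L (lebesgue_on {s<..t}) energy \<le> excess t - excess s" if st: "0 < s" "s \<le> t" "ereal t < T" for s t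
  proof -
    note d = excess_diff[OF st]
    have "integral\<^sup>L (lebesgue_on {s<..t}) (\<lambda>r. c * energy r) \<le> excess t - excess s"
      unfolding d(3)
    proof (rule integral_mono_AE)
      show "integrable (lebesgue_on {s<..t}) (\<lambda>r. c * energy r)" using d(2) by simp
      show "AE r in lebesgue_on {s<..t}. c * energy r \<le> excess r * energy r"
        using st by (intro AE_I2 mult_right_mono ex energy_nonneg) (auto intro: tint_le)
    qed (rule d(1))
    then show ?thesis by simp
  qed
  obtain C where C: "0 < C" "\<And>K t. good K t \<Longrightarrow> (mass t)\<^sup>2 \<le> C * energy t" using poincare by blast
  have Tfin: "T \<noteq> \<infinity>"
  proof
    assume Tinf: "T = \<infinity>"
    have tT: "t \<in> tint T" if "0 < t" for t using that Tinf by (simp add: tint_def)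
    text \<open>The excess doubles within time C / z^2, and these times are summable.\<close>
    have dbl: "2 * z \<le> excess (s + C / z\<^sup>2)" if s: "0 < s" and z: "0 < z" "z \<le> excess s" for s z
    proof -
      define t where "t = s + C / z\<^sup>2"
      have st: "0 < s" "s \<le> t" "ereal t < T" using s C z Tinf by (auto simp: t_def)
      note d = excess_diff[OF st]
      interpret finite_measure "lebesgue_on {s<..t}" by (rule finite_measure_lebesgue_on_bounded) auto
      have "integral\<^sup>L (lebesgue_on {s<..t}) (\<lambda>r. z * (z\<^sup>2 / C)) \<le> excess t - excess s"
        unfolding d(3)
      proof (rule integral_mono_AE)
        have "0 < t + 1" "ereal (t + 1) < T" using st Tinf by auto
        then obtain K where K: "0 < K" "AE r in lebesgue_on {0<..<t + 1}. good K r" using AE_good by blast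
        have "AE r in lebesgue_on {s<..t}. good K r"
          by (rule AE_lebesgue_on_subset[OF K(2)]) (use st in auto)
        moreover have "AE r in lebesgue_on {s<..t}. r \<in> {s<..t}" by (rule AE_I2) auto
        ultimately show "AE r in lebesgue_on {s<..t}. z * (z\<^sup>2 / C) \<le> excess r * energy r"
        proof eventually_elim
          case (elim r)
          have zr: "z \<le> excess r" using mono[of s r] elim s z Tinf by auto
          have "excess r = mass r - 1" using elim s by (simp add: excess_def)
          then have "z\<^sup>2 \<le> (mass r)\<^sup>2" using zr z by (intro power_mono) auto
          also have "\<dots> \<le> C * energy r" by (rule C(2)[OF elim(1)])
          finally have "z\<^sup>2 / C \<le> energy r" using C by (simp add: pos_divide_le_eq mult.commute)
          then show ?case using zr z C by (intro mult_mono) auto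
        qed
      qed (use d(1) in auto)
      moreover have "integral\<^sup>L (lebesgue_on {s<..t}) (\<lambda>r. z * (z\<^sup>2 / C)) = z"
        using st z C by (simp add: measure_restrict_space t_def)
      ultimately have "2 * z \<le> excess t" using z(2) by linarith
      then show ?thesis by (simp add: t_def)
    qed
    define B where "B = C / c\<^sup>2"
    have B: "0 < B" using C c by (simp add: B_def)
    have "\<exists>t. 0 < t \<and> t \<le> 1 + B * (2 - 2 / 2 ^ n) \<and> 2 ^ n * c \<le> excess t" for n
    proof (induction n)
      case 0
      show ?case using ex[OF tT, of 1] by (intro exI[of _ 1]) simp
    next
      case (Suc n)
      then obtain t where t: "0 < t" "t \<le> 1 + B * (2 - 2 / 2 ^ n)" "2 ^ n * c \<le> excess t" by blast
      have "2 * (2 ^ n * c) \<le> excess (t + C / (2 ^ n * c)\<^sup>2)" by (rule dbl[OF t(1) _ t(3)]) (use c in simp)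
      moreover have "C / (2 ^ n * c)\<^sup>2 = B / (2 ^ n)\<^sup>2" by (simp add: B_def power_mult_distrib mult.commute)
      moreover have "B / (2 ^ n)\<^sup>2 \<le> B / 2 ^ n"
        using B self_le_power[of "2 ^ n" 2] by (intro divide_left_mono) auto
      moreover have "1 + B * (2 - 2 / 2 ^ n) + B / 2 ^ n = 1 + B * (2 - 2 / 2 ^ Suc n)"
        by (simp add: algebra_simps)
      moreover have "0 < B / (2 ^ n)\<^sup>2" using B by simp
      ultimately show ?case using t by (intro exI[of _ "t + C / (2 ^ n * c)\<^sup>2"]) (auto simp: mult.assoc)
    qed
    moreover have "excess t \<le> excess (1 + 2 * B)" if "0 < t" "t \<le> 1 + B * (2 - 2 / 2 ^ n)" for t and n :: nat
    proof (rule mono)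
      have "B * (2 - 2 / 2 ^ n) \<le> B * 2" using B by (intro mult_left_mono) auto
      then show "t \<le> 1 + 2 * B" using that by simp
    qed (use that Tinf in auto)
    ultimately have big: "2 ^ n * c \<le> excess (1 + 2 * B)" for n by (meson order_trans)
    obtain n where "excess (1 + 2 * B) / c < 2 ^ n" using real_arch_pow[of 2] by auto
    then show False using big[of n] c by (simp add: field_simps)
  qed
  then obtain \<tau> where \<tau>: "T = ereal \<tau>" using T by (cases T) auto
  have "Limsup (at_left \<tau>) (\<lambda>t. ereal (mass t)) = \<infinity>"
  proof (rule ccontr)
    assume "Limsup (at_left \<tau>) (\<lambda>t. ereal (mass t)) \<noteq> \<infinity>"
    then obtain Y where "Limsup (at_left \<tau>) (\<lambda>t. ereal (mass t)) < ereal Y"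
      using less_PInf_Ex_of_nat by (auto simp: less_top[symmetric])
    then have "\<forall>\<^sub>F t in at_left \<tau>. ereal (mass t) < ereal Y" by (rule Limsup_lessD)
    then obtain b where b: "b < \<tau>" "\<And>t. b < t \<Longrightarrow> t < \<tau> \<Longrightarrow> mass t < Y"
      unfolding eventually_at_left_field by auto
    have bound: "excess t \<le> Y" if "0 < t" "ereal t < T" for t
    proof -
      have tt: "t < \<tau>" using that \<tau> by simp
      define q where "q = (max t b + \<tau>) / 2"
      have q: "t \<le> q" "b < q" "q < \<tau>" using tt b by (auto simp: q_def)
      have "excess t \<le> excess q" using mono[of t q] that q \<tau> by simp
      also have "\<dots> \<le> Y" using b(2)[OF q(2,3)] that q by (simp add: excess_def)
      finally show ?thesis .
    qed
    have "integral\<^sup>L (lebesgue_on {s<..t}) energy \<le> Y / c" if st: "0 < s" "s < t" "ereal t < T" for s t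
    proof -
      have "c * integral\<^sup>L (lebesgue_on {s<..t}) energy \<le> Y"
        using cJ[of s t] bound[of t] ex[of s] c st tint_le[of s t] by auto
      then show ?thesis using c by (simp add: field_simps)
    qed
    from global_if_energy_bounded[OF ext T this] show False using \<tau> by simp
  qed
  then show ?thesis using \<tau> by simp
qed

lemma critical:
  assumes ext: "extensibility \<Omega> T u" and T: "0 < T" and crit: "integral\<^sup>L (lebesgue_on \<Omega>) u0 = 1"
    and grd: "gradient_estimate \<Omega> u0 Du0 T u Du" and ne: "\<Omega> \<noteq> {}"
  shows "T = \<infinity> \<and> (\<forall>t>0. mass t = 1)"
proof -
  have m1: "mass t = 1" if "t \<in> tint T" for t
    using excess_eq_0[OF _ that] crit that by (auto simp: excess_def tint_def)
  obtain z r where zr: "0 < r" "cball z r \<subseteq> \<Omega>" using open_dom ne open_contains_cball by blast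
  have sub: "ball z r \<subseteq> \<Omega>" "ball z r \<in> sets lebesgue" using zr ball_subset_cball[of z r] by auto
  let ?B = "ball z r" and ?\<phi> = "ball_torsion z r"
  let ?Q = "\<lambda>C t. integral\<^sup>L (lebesgue_on \<Omega>) (\<lambda>x. (norm (Du x t))\<^sup>2) \<le>
         integral\<^sup>L (lebesgue_on \<Omega>) (\<lambda>x. (norm (Du0 x))\<^sup>2) *
         exp (1 / (2 * C) * Sup ((\<lambda>\<tau>. integral\<^sup>L (lebesgue_on \<Omega>) (\<lambda>x. u x \<tau>)) ` {0<..<t}) *
              (integral\<^sup>L (lebesgue_on ?B) (\<lambda>x. ?\<phi> x * ln (u x t))
               - integral\<^sup>L (lebesgue_on ?B) (\<lambda>x. ?\<phi> x * ln (u0 x))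
               + integral\<^sup>L (lebesgue_on (?B \<times> {0<..<t})) (\<lambda>p. u (fst p) (snd p))))"
  have "closure ?B \<subseteq> \<Omega>" using zr by simp
  then obtain C where C: "0 < C" and est: "AE t in lebesgue_on (tint T). ?Q C t"
    using grd smoothly_bounded_ball[OF zr(1), of z] torsion_function_ball[OF zr(1), of z]
    unfolding gradient_estimate_def by blast
  define J0 where "J0 = integral\<^sup>L (lebesgue_on \<Omega>) (\<lambda>x. (norm (Du0 x))\<^sup>2)"
  have J0: "0 \<le> J0" by (simp add: J0_def)
  define c0 where "c0 = \<bar>integral\<^sup>L (lebesgue_on ?B) (\<lambda>x. ?\<phi> x * ln (u0 x))\<bar>"
  have energy_bd: "energy t \<le> J0 * exp (1 / (2 * C) * (r\<^sup>2 + c0 + t))"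
    if gd: "good K t" and e: "?Q C t" for K t
  proof -
    note g = goodD[OF gd]
    have t: "0 < t" "ereal t < T" using g(1) by (auto simp: tint_def)
    have "(\<lambda>\<tau>. integral\<^sup>L (lebesgue_on \<Omega>) (\<lambda>x. u x \<tau>)) ` {0<..<t} = (\<lambda>\<tau>. 1) ` {0<..<t}"
    proof (rule image_cong[OF refl])
      fix \<tau> assume "\<tau> \<in> {0<..<t}"
      then have "\<tau> \<in> tint T" using t interval_subset_tint[OF t(2)] by auto
      from m1[OF this] show "integral\<^sup>L (lebesgue_on \<Omega>) (\<lambda>x. u x \<tau>) = 1" by (simp add: mass_def)
    qed
    then have sup1: "Sup ((\<lambda>\<tau>. integral\<^sup>L (lebesgue_on \<Omega>) (\<lambda>x. u x \<tau>)) ` {0<..<t}) = 1"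
      using t by (simp add: image_constant_conv)
    have posB: "AE x in lebesgue_on ?B. 0 < u x t" "AE x in lebesgue_on ?B. x \<in> ?B"
      using AE_lebesgue_on_subset[OF g(3) sub(1,2)] by (auto elim: eventually_mono intro: AE_I2)
    have uB: "integrable (lebesgue_on ?B) (\<lambda>x. u x t)"
      by (rule integrable_lebesgue_on_subset[OF u_integrable[OF g(1)] sub]) simp
    have A1: "integral\<^sup>L (lebesgue_on ?B) (\<lambda>x. ?\<phi> x * ln (u x t)) \<le> r\<^sup>2"
    proof -
      have "integral\<^sup>L (lebesgue_on ?B) (\<lambda>x. ?\<phi> x * ln (u x t)) \<le> integral\<^sup>L (lebesgue_on ?B) (\<lambda>x. r\<^sup>2 * u x t)"
      proof (rule integral_mono_AE')
        show "integrable (lebesgue_on ?B) (\<lambda>x. r\<^sup>2 * u x t)" using uB by simp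
        show "AE x in lebesgue_on ?B. ?\<phi> x * ln (u x t) \<le> r\<^sup>2 * u x t"
          using posB
        proof eventually_elim
          case (elim x)
          note bt = ball_torsion_bounds[OF zr(1) elim(2)]
          have "?\<phi> x * ln (u x t) \<le> ?\<phi> x * u x t"
            using ln_le_minus_one[OF elim(1)] bt by (intro mult_left_mono) auto
          also have "\<dots> \<le> r\<^sup>2 * u x t" using bt elim by (intro mult_right_mono) auto
          finally show ?case .
        qed
        show "AE x in lebesgue_on ?B. 0 \<le> r\<^sup>2 * u x t" using posB(1) by eventually_elim simp
      qed
      also have "\<dots> = r\<^sup>2 * integral\<^sup>L (lebesgue_on ?B) (\<lambda>x. u x t)" by simp
      also have "\<dots> \<le> r\<^sup>2 * mass t"
      proof (rule mult_left_mono)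
        have "integral\<^sup>L (lebesgue_on ?B) (\<lambda>x. u x t) = integral\<^sup>L (lebesgue_on \<Omega>) (\<lambda>x. indicator ?B x * u x t)"
          by (rule integral_lebesgue_on_subset[OF sub]) simp
        also have "\<dots> \<le> mass t" unfolding mass_def
        proof (rule integral_mono_AE'[OF u_integrable[OF g(1)]])
          show "AE x in lebesgue_on \<Omega>. indicator ?B x * u x t \<le> u x t"
            using g(3) by eventually_elim (auto simp: indicator_def)
          show "AE x in lebesgue_on \<Omega>. 0 \<le> u x t" using g(3) by eventually_elim simp
        qed
        finally show "integral\<^sup>L (lebesgue_on ?B) (\<lambda>x. u x t) \<le> mass t" .
      qed simp
      finally show ?thesis using m1[OF g(1)] by simp
    qed
    have A2: "integral\<^sup>L (lebesgue_on (?B \<times> {0<..<t})) (\<lambda>p. u (fst p) (snd p)) \<le> t"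
    proof -
      have ui: "integrable (lebesgue_on (\<Omega> \<times> {0<..<t})) (\<lambda>p. u (fst p) (snd p))"
        using u_integrable_cyl[OF t, of "\<lambda>p. 1" 1] by simp
      have Bs: "?B \<times> {0<..<t} \<subseteq> \<Omega> \<times> {0<..<t}" using sub by auto
      have "?B \<times> {0<..<t} \<in> sets borel" by (intro borel_Times) auto
      then have "?B \<times> {0<..<t} \<in> sets lebesgue" by (simp add: sets_completionI_sets)
      then have "integral\<^sup>L (lebesgue_on (?B \<times> {0<..<t})) (\<lambda>p. u (fst p) (snd p)) =
          integral\<^sup>L (lebesgue_on (\<Omega> \<times> {0<..<t})) (\<lambda>p. indicator (?B \<times> {0<..<t}) p * u (fst p) (snd p))"
        by (rule integral_lebesgue_on_subset[OF Bs _ cyl_lebesgue(1)])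
      also have "\<dots> \<le> integral\<^sup>L (lebesgue_on (\<Omega> \<times> {0<..<t})) (\<lambda>p. u (fst p) (snd p))"
      proof (rule integral_mono_AE'[OF ui])
        obtain K' where K': "AE p in lebesgue_on (\<Omega> \<times> {0<..<t}). 0 \<le> u (fst p) (snd p) \<and> u (fst p) (snd p) \<le> K'"
          using u_bounded_cyl[OF t] by blast
        show "AE p in lebesgue_on (\<Omega> \<times> {0<..<t}). indicator (?B \<times> {0<..<t}) p * u (fst p) (snd p) \<le> u (fst p) (snd p)"
          using K' by eventually_elim (auto simp: indicator_def)
        show "AE p in lebesgue_on (\<Omega> \<times> {0<..<t}). 0 \<le> u (fst p) (snd p)"
          using K' by eventually_elim simp
      qed
      also have "\<dots> = integral\<^sup>L (lebesgue_on {0<..<t}) mass"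
        using lebesgue_on_Fubini(3)[OF dom_borel _ ui] by (simp add: mass_def[abs_def])
      also have "\<dots> = integral\<^sup>L (lebesgue_on {0<..<t}) (\<lambda>s. 1)"
        by (rule Bochner_Integration.integral_cong) (use m1 interval_subset_tint[OF t(2)] in auto)
      also have "\<dots> = t" using t by (simp add: measure_restrict_space)
      finally show ?thesis .
    qed
    have "energy t \<le> J0 * exp (1 / (2 * C) * 1 *
              (integral\<^sup>L (lebesgue_on ?B) (\<lambda>x. ?\<phi> x * ln (u x t))
               - integral\<^sup>L (lebesgue_on ?B) (\<lambda>x. ?\<phi> x * ln (u0 x))
               + integral\<^sup>L (lebesgue_on (?B \<times> {0<..<t})) (\<lambda>p. u (fst p) (snd p))))"
      using e unfolding sup1 J0_def energy_def .
    also have "\<dots> \<le> J0 * exp (1 / (2 * C) * 1 * (r\<^sup>2 + c0 + t))"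
    proof (intro mult_left_mono J0)
      have "integral\<^sup>L (lebesgue_on ?B) (\<lambda>x. ?\<phi> x * ln (u x t))
               - integral\<^sup>L (lebesgue_on ?B) (\<lambda>x. ?\<phi> x * ln (u0 x))
               + integral\<^sup>L (lebesgue_on (?B \<times> {0<..<t})) (\<lambda>p. u (fst p) (snd p)) \<le> r\<^sup>2 + c0 + t"
        using A1 A2 unfolding c0_def by linarith
      then show "exp (1 / (2 * C) * 1 *
              (integral\<^sup>L (lebesgue_on ?B) (\<lambda>x. ?\<phi> x * ln (u x t))
               - integral\<^sup>L (lebesgue_on ?B) (\<lambda>x. ?\<phi> x * ln (u0 x))
               + integral\<^sup>L (lebesgue_on (?B \<times> {0<..<t})) (\<lambda>p. u (fst p) (snd p))))
          \<le> exp (1 / (2 * C) * 1 * (r\<^sup>2 + c0 + t))"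
        unfolding exp_le_cancel_iff using C by (intro mult_left_mono) auto
    qed
    finally show ?thesis by simp
  qed
  have "T = \<infinity>"
  proof (rule ccontr)
    assume "T \<noteq> \<infinity>"
    then obtain \<tau> where \<tau>: "T = ereal \<tau>" using T by (cases T) auto
    have \<tau>0: "0 < \<tau>" using T \<tau> by simp
    define A where "A = J0 * exp (1 / (2 * C) * (r\<^sup>2 + c0 + \<tau>))"
    have A: "0 \<le> A" using J0 by (simp add: A_def)
    have "integral\<^sup>L (lebesgue_on {s<..t}) energy \<le> \<tau> * A" if st: "0 < s" "s < t" "ereal t < T" for s t
    proof -
      have "t \<in> tint T" using st by (simp add: tint_def)
      then obtain T' where T': "0 < t" "t < T'" "0 < T'" "ereal T' < T" by (rule tint_extend)
      obtain K where K: "0 < K" "AE s in lebesgue_on {0<..<T'}. good K s" using AE_good[OF T'(3,4)] by blast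
      interpret finite_measure "lebesgue_on {s<..t}" by (rule finite_measure_lebesgue_on_bounded) auto
      have "integral\<^sup>L (lebesgue_on {s<..t}) energy \<le> integral\<^sup>L (lebesgue_on {s<..t}) (\<lambda>r. A)"
      proof (rule integral_mono_AE)
        show "integrable (lebesgue_on {s<..t}) energy" using st by (intro excess_diff(2)) auto
        have "AE r in lebesgue_on {s<..t}. good K r"
          by (rule AE_lebesgue_on_subset[OF K(2)]) (use st T' in auto)
        moreover have "AE q in lebesgue_on {s<..t}. ?Q C q"
          by (rule AE_lebesgue_on_subset[OF est _ _ tint_lebesgue]) (use st in \<open>auto intro: tint_le\<close>)
        ultimately show "AE q in lebesgue_on {s<..t}. energy q \<le> A"
        proof eventually_elim
          case (elim q)
          have "energy q \<le> J0 * exp (1 / (2 * C) * (r\<^sup>2 + c0 + q))"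
            by (rule energy_bd[OF elim])
          also have "\<dots> \<le> A" unfolding A_def
          proof (intro mult_left_mono J0)
            have "q \<le> \<tau>" using goodD(1)[OF elim(1)] by (simp add: tint_def \<tau>)
            then show "exp (1 / (2 * C) * (r\<^sup>2 + c0 + q)) \<le> exp (1 / (2 * C) * (r\<^sup>2 + c0 + \<tau>))"
              unfolding exp_le_cancel_iff using C by (intro mult_left_mono) auto
          qed
          finally show ?case .
        qed
      qed auto
      also have "\<dots> = (t - s) * A" using st by (simp add: measure_restrict_space)
      also have "\<dots> \<le> \<tau> * A" using st A by (intro mult_right_mono) (auto simp: \<tau>)
      finally show ?thesis .
    qed
    from global_if_energy_bounded[OF ext T this] \<tau> show False by simp
  qed
  then show ?thesis using m1 by (simp add: tint_def)
qed

end

theorem theorem1p4: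
  fixes \<Omega> :: "'a::euclidean_space set"
    and \<Phi> u0 :: "'a \<Rightarrow> real" and Du0 :: "'a \<Rightarrow> 'a" and L :: real
    and Tmax :: ereal and u :: "'a \<Rightarrow> real \<Rightarrow> real" and Du :: "'a \<Rightarrow> real \<Rightarrow> 'a"
  assumes dom: "smooth_bounded_domain \<Omega>"
    and Phi: "torsion_function \<Omega> \<Phi>"
    and u0_Linf: "ess_bdd \<Omega> u0"
    and u0_W: "W012 \<Omega> u0 Du0"
    and u0_nonneg: "AE x in lebesgue_on \<Omega>. 0 \<le> u0 x"
    and u0_inv: "inv_Linf_loc \<Omega> u0"
    and L: "0 < L" "Phi_norm \<Omega> \<Phi> u0 \<le> ereal L"
    and Tmax: "0 < Tmax"
    and sol: "weak_solution \<Omega> u0 Tmax u Du"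
    and locpos: "locally_positive \<Omega> Tmax u"
    and rep: "L1_continuous_rep \<Omega> Tmax u"
    and ext: "extensibility \<Omega> Tmax u"
    and gradest: "gradient_estimate \<Omega> u0 Du0 Tmax u Du"
    and Phiest: "Phi_estimate \<Omega> \<Phi> u0 Tmax u Du"
  shows "(integral\<^sup>L (lebesgue_on \<Omega>) u0 < 1 \<longrightarrow>
            Tmax = \<infinity> \<and> ((\<lambda>t. integral\<^sup>L (lebesgue_on \<Omega>) (\<lambda>x. u x t)) \<longlongrightarrow> 0) at_top)
       \<and> (integral\<^sup>L (lebesgue_on \<Omega>) u0 = 1 \<longrightarrow>
            Tmax = \<infinity> \<and> (\<forall>t>0. integral\<^sup>L (lebesgue_on \<Omega>) (\<lambda>x. u x t) = 1))
       \<and> (integral\<^sup>L (lebesgue_on \<Omega>) u0 > 1 \<longrightarrow>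
            Tmax < \<infinity> \<and>
            Limsup (at_left (real_of_ereal Tmax)) (\<lambda>t. ereal (integral\<^sup>L (lebesgue_on \<Omega>) (\<lambda>x. u x t))) = \<infinity>)"
proof -
  obtain ut where ut: "(\<lambda>p. ut (fst p) (snd p)) \<in> borel_measurable (lebesgue_on (\<Omega> \<times> tint Tmax))"
    "\<And>T'. 0 < T' \<Longrightarrow> ereal T' < Tmax \<Longrightarrow>
          integrable (lebesgue_on (\<Omega> \<times> {0<..<T'})) (\<lambda>p. (ut (fst p) (snd p))\<^sup>2)"
    "\<And>\<psi>. test_fun (\<Omega> \<times> tint Tmax) \<psi> \<Longrightarrow>
          integral\<^sup>L (lebesgue_on (\<Omega> \<times> tint Tmax)) (\<lambda>p. u (fst p) (snd p) * dt \<psi> p) =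
          - integral\<^sup>L (lebesgue_on (\<Omega> \<times> tint Tmax)) (\<lambda>p. ut (fst p) (snd p) * \<psi> p)"
    using sol unfolding weak_solution_def by blast
  have ne: "\<Omega> \<noteq> {}" and op: "open \<Omega>" "bounded \<Omega>"
    using dom by (auto simp: smooth_bounded_domain_def smoothly_bounded_def)
  interpret degenerate_flow \<Omega> u0 Tmax u Du ut
    by unfold_locales (fact op u0_Linf sol locpos rep ut)+
  show ?thesis
    using subcritical[OF ext Tmax] critical[OF ext Tmax _ gradest ne] supercritical[OF ext Tmax]
    unfolding mass_def[abs_def] by simp
qed

end
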